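(* Let $k$ be an algebraically closed field, and let $\varrho$ be a 2-representation of a finite group $G$ on an object $V$ of a $k$-linear 2-category, with all the spaces $\mathbb{T}r(\varrho(g))$, $g\in G$, finite dimensional (so that the 2-character $\chi_\varrho$ is defined). Assume that $V^G$ exists. Then $$\dim\bigl(\mathcal{D}\mathrm{im}(V^G)\bigr)=\frac1{|G|}\sum_{gh=hg}\chi_\varrho(g,h),$$ where the sum is over all pairs $(g,h)\in G\times G$ with $gh=hg$.
   Context: A $k$-linear 2-category has additive $k$-linear categories of 1-morphisms and bilinear compositions. $\circ$ is vertical composition, juxtaposition is horizontal composition. For a 1-endomorphism $F$ of $V$, $\mathbb{T}r(F)=2\mathrm{Hom}(\mathrm{id}_V,F)$; $\mathcal{D}\mathrm{im}(V)=\mathbb{T}r(\mathrm{id}_V)$. A 2-representation $\varrho$ of $G$ on $V$: 1-endomorphisms $\varrho(g)$ (abbreviated $g$) of $V$ and 2-isomorphisms $\phi_{g,h}:\varrho(g)\varrho(h)\Rightarrow\varrho(gh)$, $\phi_1:\varrho(1)\Rightarrow\mathrm{id}_V$ with $\phi_{gh,k}\circ(\phi_{g,h}k)=\phi_{g,hk}\circ(g\phi_{h,k})$, $\phi_{1,g}=\phi_1 g$, $\phi_{g,1}=g\phi_1$. Characters: for $s,g\in G$, $\psi_s:\mathbb{T}r(\varrho(g))\to\mathbb{T}r(\varrho(sgs^{-1}))$ sends $\xi$ to $\mathrm{id}_V\cong\varrho(s)\varrho(s^{-1})\xrightarrow{s\xi s^{-1}}\varrho(s)\varrho(g)\varrho(s^{-1})\cong\varrho(sgs^{-1})$,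 the isomorphisms being built from the $\phi$'s. For $gh=hg$, the 2-character is $\chi_\varrho(g,h)=\mathrm{tr}\bigl(\psi_h:\mathbb{T}r(\varrho(g))\to\mathbb{T}r(\varrho(g))\bigr)$. Equivariant 1-morphisms. For $W,V$ with 2-representations of $G$, $1\mathrm{Hom}_G(W,V)$ has objects $(F,\{\tau_g\})$, $F:W\to V$, with 2-isomorphisms $\tau_g:gF\Rightarrow Fg$ such that $\tau_{gh}\circ(\phi_{g,h}F)=(F\phi_{g,h})\circ(\tau_g h)\circ(g\tau_h)$ and $\tau_1$ is the map $1F\cong F\cong F1$; morphisms are 2-morphisms commuting with the $\tau_g$. If $F,H$ have flips $\tau,\sigma$ and $HF$ is defined, it has flips $(H\tau_g)\circ(\sigma_gF)$. $1\mathrm{Hom}_G^{triv}(W,V)$ has objects $(F,\{\tau_g\},\{\epsilon_g\})$, where moreover $\epsilon_g:F\Rightarrow gF$ are 2-isomorphisms (a trivialization) with $(\phi_{g,h}F)\circ(g\epsilon_h)\circ\epsilon_g=\epsilon_{gh}$ and $(\phi_{s,g}F)\circ(s\epsilon_g)\circ\tau_s^{-1}=(\phi_{sgs^{-1},s}F)\circ\bigl((sgs^{-1})\tau_s^{-1}\bigr)\circ(\epsilon_{sgs^{-1}}s)$; morphisms must commute with the $\tau_g$ and $\epsilon_g$. "$V^G$ exists" means: there are an object $V^G$ with a 2-representation of $G$ and a trivialization $\epsilon_g:\mathrm{id}_{V^G}\Rightarrow g$ of its identity, and an equivariant 1-morphism $U:V^G\to V$ with flips $\tau^U_g$, such that for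 every $W$ with 2-representation of $G$ the functor $1\mathrm{Hom}_G(W,V^G)\to 1\mathrm{Hom}_G^{triv}(W,V)$, $F\mapsto UF$, is an equivalence, where $UF$ is trivialized by $((\tau^U_g)^{-1}F)\circ(U\epsilon_gF)$.
   Formalization: The order |G| is assumed to be nonzero in k (the characteristic of k does not divide |G|), since otherwise 1/|G| is undefined; the equation is read in k. *)

theory Defs
  imports "HOL-Algebra.Group" "HOL-Computational_Algebra.Polynomial"
begin

section \<open>Linear 2-categories\<close>

text \<open>
  2-categories are strict. The 2-cells of all hom-spaces live in one abelian group \<open>'c\<close> with a
  scalar multiplication, the space of 2-cells \<open>F \<Rightarrow> F'\<close> being a subspace \<open>Cell C F F'\<close>; the
  compositions of 2-cells are total functions on \<open>'c\<close> about which something is assumed only on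
  composable arguments. No generality is lost: given any \<open>k\<close>-linear 2-category, take for \<open>'c\<close> the
  direct sum of all its spaces of 2-cells (distinct hom-spaces then share only 0, and composing
  with 0 gives 0).
\<close>

record ('k, 'o, 'm, 'c) lin2cat =
  Ob :: "'o set"
  Mor :: "'o \<Rightarrow> 'o \<Rightarrow> 'm set"
  idm :: "'o \<Rightarrow> 'm"
  cmp :: "'m \<Rightarrow> 'm \<Rightarrow> 'm"  (infixl \<open>\<odot>\<index>\<close> 75)
  Cell :: "'m \<Rightarrow> 'm \<Rightarrow> 'c set"
  idc :: "'m \<Rightarrow> 'c"  (\<open>\<iota>\<index>\<close>)
  vcmp :: "'c \<Rightarrow> 'c \<Rightarrow> 'c"  (infixl \<open>\<cdot>\<index>\<close> 68)
  hcmp :: "'c \<Rightarrow> 'c \<Rightarrow> 'c"  (infixl \<open>\<star>\<index>\<close> 72)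
  smul :: "'k \<Rightarrow> 'c \<Rightarrow> 'c"

text \<open>
  All compositions are written in the order of functions: \<open>G \<odot> F\<close> is \<open>F\<close> followed by \<open>G\<close>,
  \<open>\<beta> \<cdot> \<alpha>\<close> is the vertical composite of \<open>\<alpha> : F \<Rightarrow> F'\<close> and \<open>\<beta> : F' \<Rightarrow> F''\<close>, and \<open>\<beta> \<star> \<alpha>\<close> the
  horizontal composite \<open>G \<odot> F \<Rightarrow> G' \<odot> F'\<close>. The whiskerings written \<open>G\<alpha>\<close> and \<open>\<beta>F\<close> by
  juxtaposition are \<open>\<iota> G \<star> \<alpha>\<close> and \<open>\<beta> \<star> \<iota> F\<close>.
\<close>

locale linear_2category = vector_space "smul C"
  for C :: "('k::field, 'o, 'm, 'c::ab_group_add) lin2cat" (structure) +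
  assumes idm_closed: "A \<in> Ob C \<Longrightarrow> idm C A \<in> Mor C A A"
    and cmp_closed: "\<lbrakk>A \<in> Ob C; B \<in> Ob C; D \<in> Ob C; F \<in> Mor C A B; G \<in> Mor C B D\<rbrakk>
          \<Longrightarrow> G \<odot> F \<in> Mor C A D"
    and cmp_assoc: "\<lbrakk>A \<in> Ob C; B \<in> Ob C; D \<in> Ob C; E \<in> Ob C;
            F \<in> Mor C A B; G \<in> Mor C B D; H \<in> Mor C D E\<rbrakk>
          \<Longrightarrow> (H \<odot> G) \<odot> F = H \<odot> (G \<odot> F)"
    and cmp_id_left: "\<lbrakk>A \<in> Ob C; B \<in> Ob C; F \<in> Mor C A B\<rbrakk> \<Longrightarrow> idm C B \<odot> F = F"
    and cmp_id_right: "\<lbrakk>A \<in> Ob C; B \<in> Ob C; F \<in> Mor C A B\<rbrakk> \<Longrightarrow> F \<odot> idm C A = F"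
    \<comment> \<open>the 1-morphisms between two objects form a linear category\<close>
    and cell_subspace: "\<lbrakk>A \<in> Ob C; B \<in> Ob C; F \<in> Mor C A B; F' \<in> Mor C A B\<rbrakk>
          \<Longrightarrow> subspace (Cell C F F')"
    and idc_closed: "\<lbrakk>A \<in> Ob C; B \<in> Ob C; F \<in> Mor C A B\<rbrakk> \<Longrightarrow> \<iota> F \<in> Cell C F F"
    and vcmp_closed: "\<lbrakk>A \<in> Ob C; B \<in> Ob C; F \<in> Mor C A B; F' \<in> Mor C A B; F'' \<in> Mor C A B;
            \<alpha> \<in> Cell C F F'; \<beta> \<in> Cell C F' F''\<rbrakk> \<Longrightarrow> \<beta> \<cdot> \<alpha> \<in> Cell C F F''"
    and vcmp_assoc: "\<lbrakk>A \<in> Ob C; B \<in> Ob C; F \<in> Mor C A B; F' \<in> Mor C A B; F'' \<in> Mor C A B;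
            F''' \<in> Mor C A B; \<alpha> \<in> Cell C F F'; \<beta> \<in> Cell C F' F''; \<gamma> \<in> Cell C F'' F'''\<rbrakk>
          \<Longrightarrow> (\<gamma> \<cdot> \<beta>) \<cdot> \<alpha> = \<gamma> \<cdot> (\<beta> \<cdot> \<alpha>)"
    and vcmp_id_left: "\<lbrakk>A \<in> Ob C; B \<in> Ob C; F \<in> Mor C A B; F' \<in> Mor C A B; \<alpha> \<in> Cell C F F'\<rbrakk>
          \<Longrightarrow> \<iota> F' \<cdot> \<alpha> = \<alpha>"
    and vcmp_id_right: "\<lbrakk>A \<in> Ob C; B \<in> Ob C; F \<in> Mor C A B; F' \<in> Mor C A B; \<alpha> \<in> Cell C F F'\<rbrakk>
          \<Longrightarrow> \<alpha> \<cdot> \<iota> F = \<alpha>"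
    and vcmp_add_right: "\<lbrakk>A \<in> Ob C; B \<in> Ob C; F \<in> Mor C A B; F' \<in> Mor C A B; F'' \<in> Mor C A B;
            \<alpha> \<in> Cell C F F'; \<alpha>' \<in> Cell C F F'; \<beta> \<in> Cell C F' F''\<rbrakk>
          \<Longrightarrow> \<beta> \<cdot> (\<alpha> + \<alpha>') = \<beta> \<cdot> \<alpha> + \<beta> \<cdot> \<alpha>'"
    and vcmp_add_left: "\<lbrakk>A \<in> Ob C; B \<in> Ob C; F \<in> Mor C A B; F' \<in> Mor C A B; F'' \<in> Mor C A B;
            \<alpha> \<in> Cell C F F'; \<beta> \<in> Cell C F' F''; \<beta>' \<in> Cell C F' F''\<rbrakk>
          \<Longrightarrow> (\<beta> + \<beta>') \<cdot> \<alpha> = \<beta> \<cdot> \<alpha> + \<beta>' \<cdot> \<alpha>"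
    and vcmp_scale_right: "\<lbrakk>A \<in> Ob C; B \<in> Ob C; F \<in> Mor C A B; F' \<in> Mor C A B; F'' \<in> Mor C A B;
            \<alpha> \<in> Cell C F F'; \<beta> \<in> Cell C F' F''\<rbrakk>
          \<Longrightarrow> \<beta> \<cdot> smul C c \<alpha> = smul C c (\<beta> \<cdot> \<alpha>)"
    and vcmp_scale_left: "\<lbrakk>A \<in> Ob C; B \<in> Ob C; F \<in> Mor C A B; F' \<in> Mor C A B; F'' \<in> Mor C A B;
            \<alpha> \<in> Cell C F F'; \<beta> \<in> Cell C F' F''\<rbrakk>
          \<Longrightarrow> smul C c \<beta> \<cdot> \<alpha> = smul C c (\<beta> \<cdot> \<alpha>)"
    \<comment> \<open>this category is additive\<close>
    and zero_object: "\<lbrakk>A \<in> Ob C; B \<in> Ob C\<rbrakk>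
          \<Longrightarrow> \<exists>Z \<in> Mor C A B. \<forall>F \<in> Mor C A B. Cell C Z F = {0} \<and> Cell C F Z = {0}"
    and biproduct: "\<lbrakk>A \<in> Ob C; B \<in> Ob C; F\<^sub>1 \<in> Mor C A B; F\<^sub>2 \<in> Mor C A B\<rbrakk>
          \<Longrightarrow> \<exists>S \<in> Mor C A B. \<exists>i\<^sub>1 \<in> Cell C F\<^sub>1 S. \<exists>i\<^sub>2 \<in> Cell C F\<^sub>2 S.
                \<exists>p\<^sub>1 \<in> Cell C S F\<^sub>1. \<exists>p\<^sub>2 \<in> Cell C S F\<^sub>2.
                p\<^sub>1 \<cdot> i\<^sub>1 = \<iota> F\<^sub>1 \<and> p\<^sub>2 \<cdot> i\<^sub>2 = \<iota> F\<^sub>2 \<and> p\<^sub>1 \<cdot> i\<^sub>2 = 0 \<and> p\<^sub>2 \<cdot> i\<^sub>1 = 0 \<and>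
                i\<^sub>1 \<cdot> p\<^sub>1 + i\<^sub>2 \<cdot> p\<^sub>2 = \<iota> S"
    \<comment> \<open>horizontal composition is a strictly associative and unital bilinear functor\<close>
    and hcmp_closed: "\<lbrakk>A \<in> Ob C; B \<in> Ob C; D \<in> Ob C; F \<in> Mor C A B; F' \<in> Mor C A B;
            G \<in> Mor C B D; G' \<in> Mor C B D; \<alpha> \<in> Cell C F F'; \<beta> \<in> Cell C G G'\<rbrakk>
          \<Longrightarrow> \<beta> \<star> \<alpha> \<in> Cell C (G \<odot> F) (G' \<odot> F')"
    and hcmp_idc: "\<lbrakk>A \<in> Ob C; B \<in> Ob C; D \<in> Ob C; F \<in> Mor C A B; G \<in> Mor C B D\<rbrakk>
          \<Longrightarrow> \<iota> G \<star> \<iota> F = \<iota> (G \<odot> F)"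
    and interchange: "\<lbrakk>A \<in> Ob C; B \<in> Ob C; D \<in> Ob C;
            F \<in> Mor C A B; F' \<in> Mor C A B; F'' \<in> Mor C A B;
            G \<in> Mor C B D; G' \<in> Mor C B D; G'' \<in> Mor C B D;
            \<alpha> \<in> Cell C F F'; \<alpha>' \<in> Cell C F' F''; \<beta> \<in> Cell C G G'; \<beta>' \<in> Cell C G' G''\<rbrakk>
          \<Longrightarrow> (\<beta>' \<cdot> \<beta>) \<star> (\<alpha>' \<cdot> \<alpha>) = (\<beta>' \<star> \<alpha>') \<cdot> (\<beta> \<star> \<alpha>)"
    and hcmp_assoc: "\<lbrakk>A \<in> Ob C; B \<in> Ob C; D \<in> Ob C; E \<in> Ob C;
            F \<in> Mor C A B; F' \<in> Mor C A B; G \<in> Mor C B D; G' \<in> Mor C B D;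
            H \<in> Mor C D E; H' \<in> Mor C D E;
            \<alpha> \<in> Cell C F F'; \<beta> \<in> Cell C G G'; \<gamma> \<in> Cell C H H'\<rbrakk>
          \<Longrightarrow> (\<gamma> \<star> \<beta>) \<star> \<alpha> = \<gamma> \<star> (\<beta> \<star> \<alpha>)"
    and hcmp_id_left: "\<lbrakk>A \<in> Ob C; B \<in> Ob C; F \<in> Mor C A B; F' \<in> Mor C A B; \<alpha> \<in> Cell C F F'\<rbrakk>
          \<Longrightarrow> \<iota> (idm C B) \<star> \<alpha> = \<alpha>"
    and hcmp_id_right: "\<lbrakk>A \<in> Ob C; B \<in> Ob C; F \<in> Mor C A B; F' \<in> Mor C A B; \<alpha> \<in> Cell C F F'\<rbrakk>
          \<Longrightarrow> \<alpha> \<star> \<iota> (idm C A) = \<alpha>"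
    and hcmp_add_right: "\<lbrakk>A \<in> Ob C; B \<in> Ob C; D \<in> Ob C; F \<in> Mor C A B; F' \<in> Mor C A B;
            G \<in> Mor C B D; G' \<in> Mor C B D; \<alpha> \<in> Cell C F F'; \<alpha>' \<in> Cell C F F'; \<beta> \<in> Cell C G G'\<rbrakk>
          \<Longrightarrow> \<beta> \<star> (\<alpha> + \<alpha>') = \<beta> \<star> \<alpha> + \<beta> \<star> \<alpha>'"
    and hcmp_add_left: "\<lbrakk>A \<in> Ob C; B \<in> Ob C; D \<in> Ob C; F \<in> Mor C A B; F' \<in> Mor C A B;
            G \<in> Mor C B D; G' \<in> Mor C B D; \<alpha> \<in> Cell C F F'; \<beta> \<in> Cell C G G'; \<beta>' \<in> Cell C G G'\<rbrakk>
          \<Longrightarrow> (\<beta> + \<beta>') \<star> \<alpha> = \<beta> \<star> \<alpha> + \<beta>' \<star> \<alpha>"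
    and hcmp_scale_right: "\<lbrakk>A \<in> Ob C; B \<in> Ob C; D \<in> Ob C; F \<in> Mor C A B; F' \<in> Mor C A B;
            G \<in> Mor C B D; G' \<in> Mor C B D; \<alpha> \<in> Cell C F F'; \<beta> \<in> Cell C G G'\<rbrakk>
          \<Longrightarrow> \<beta> \<star> smul C c \<alpha> = smul C c (\<beta> \<star> \<alpha>)"
    and hcmp_scale_left: "\<lbrakk>A \<in> Ob C; B \<in> Ob C; D \<in> Ob C; F \<in> Mor C A B; F' \<in> Mor C A B;
            G \<in> Mor C B D; G' \<in> Mor C B D; \<alpha> \<in> Cell C F F'; \<beta> \<in> Cell C G G'\<rbrakk>
          \<Longrightarrow> smul C c \<beta> \<star> \<alpha> = smul C c (\<beta> \<star> \<alpha>)"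


section \<open>Dimension and trace on subspaces\<close>

definition findim :: "('k::field \<Rightarrow> 'c::ab_group_add \<Rightarrow> 'c) \<Rightarrow> 'c set \<Rightarrow> bool" where
  "findim scale S \<longleftrightarrow> (\<exists>B. finite B \<and> module.span scale B = S)"

text \<open>
  For a linear endomorphism \<open>f\<close> of a finite dimensional subspace \<open>S\<close>: the sum of the diagonal
  entries of its matrix with respect to some basis of \<open>S\<close> (the choice being immaterial).
\<close>

definition trace_on :: "('k::field \<Rightarrow> 'c::ab_group_add \<Rightarrow> 'c) \<Rightarrow> 'c set \<Rightarrow> ('c \<Rightarrow> 'c) \<Rightarrow> 'k" where
  "trace_on scale S f =
     (let B = (SOME B. \<not> module.dependent scale B \<and> module.span scale B = S)
      in \<Sum>b\<in>B. module.representation scale B (f b) b)"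


section \<open>Categories and equivalences\<close>

text \<open>
  Hom-sets of different pairs of objects may overlap, so the arrow part of a functor also takes
  source and target as arguments.
\<close>

record ('a, 'b) cat =
  Obj :: "'a set"
  Arr :: "'a \<Rightarrow> 'a \<Rightarrow> 'b set"
  ident :: "'a \<Rightarrow> 'b"
  comp :: "'b \<Rightarrow> 'b \<Rightarrow> 'b"

definition is_functor ::
  "('a, 'b) cat \<Rightarrow> ('d, 'e) cat \<Rightarrow> ('a \<Rightarrow> 'd) \<Rightarrow> ('a \<Rightarrow> 'a \<Rightarrow> 'b \<Rightarrow> 'e) \<Rightarrow> bool" where
  "is_functor \<A> \<B> \<Phi> \<Phi>' \<longleftrightarrow>
     (\<forall>a \<in> Obj \<A>. \<Phi> a \<in> Obj \<B> \<and> \<Phi>' a a (ident \<A> a) = ident \<B> (\<Phi> a)) \<and>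
     (\<forall>a \<in> Obj \<A>. \<forall>b \<in> Obj \<A>. \<forall>f \<in> Arr \<A> a b. \<Phi>' a b f \<in> Arr \<B> (\<Phi> a) (\<Phi> b)) \<and>
     (\<forall>a \<in> Obj \<A>. \<forall>b \<in> Obj \<A>. \<forall>c \<in> Obj \<A>. \<forall>f \<in> Arr \<A> a b. \<forall>g \<in> Arr \<A> b c.
        \<Phi>' a c (comp \<A> g f) = comp \<B> (\<Phi>' b c g) (\<Phi>' a b f))"

definition cat_iso :: "('a, 'b) cat \<Rightarrow> 'a \<Rightarrow> 'a \<Rightarrow> 'b \<Rightarrow> bool" where
  "cat_iso \<A> a b f \<longleftrightarrow>
     f \<in> Arr \<A> a b \<and> (\<exists>g \<in> Arr \<A> b a. comp \<A> g f = ident \<A> a \<and> comp \<A> f g = ident \<A> b)"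

definition nat_isomorphic ::
  "('a, 'b) cat \<Rightarrow> ('d, 'e) cat \<Rightarrow> ('a \<Rightarrow> 'd) \<Rightarrow> ('a \<Rightarrow> 'a \<Rightarrow> 'b \<Rightarrow> 'e) \<Rightarrow>
     ('a \<Rightarrow> 'd) \<Rightarrow> ('a \<Rightarrow> 'a \<Rightarrow> 'b \<Rightarrow> 'e) \<Rightarrow> bool" where
  "nat_isomorphic \<A> \<B> \<Phi> \<Phi>' \<Psi> \<Psi>' \<longleftrightarrow>
     (\<exists>\<eta>. (\<forall>a \<in> Obj \<A>. cat_iso \<B> (\<Phi> a) (\<Psi> a) (\<eta> a)) \<and>
          (\<forall>a \<in> Obj \<A>. \<forall>b \<in> Obj \<A>. \<forall>f \<in> Arr \<A> a b.
             comp \<B> (\<eta> b) (\<Phi>' a b f) = comp \<B> (\<Psi>' a b f) (\<eta> a)))"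

definition is_equivalence ::
  "('a, 'b) cat \<Rightarrow> ('d, 'e) cat \<Rightarrow> ('a \<Rightarrow> 'd) \<Rightarrow> ('a \<Rightarrow> 'a \<Rightarrow> 'b \<Rightarrow> 'e) \<Rightarrow> bool" where
  "is_equivalence \<A> \<B> \<Phi> \<Phi>' \<longleftrightarrow>
     is_functor \<A> \<B> \<Phi> \<Phi>' \<and>
     (\<exists>\<Psi> \<Psi>'. is_functor \<B> \<A> \<Psi> \<Psi>' \<and>
        nat_isomorphic \<A> \<A> (\<lambda>a. \<Psi> (\<Phi> a)) (\<lambda>a b f. \<Psi>' (\<Phi> a) (\<Phi> b) (\<Phi>' a b f))
          (\<lambda>a. a) (\<lambda>a b f. f) \<and>
        nat_isomorphic \<B> \<B> (\<lambda>a. \<Phi> (\<Psi> a)) (\<lambda>a b f. \<Phi>' (\<Psi> a) (\<Psi> b) (\<Psi>' a b f))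
          (\<lambda>a. a) (\<lambda>a b f. f))"


section \<open>2-representations and 2-characters\<close>

record ('g, 'm, 'c) rep2 =
  act :: "'g \<Rightarrow> 'm"
  mulc :: "'g \<Rightarrow> 'g \<Rightarrow> 'c"  \<comment> \<open>\<open>mulc R g h\<close> is \<open>\<phi>\<^sub>g\<^sub>,\<^sub>h\<close>\<close>
  unitc :: "'c"  \<comment> \<open>\<open>\<phi>\<^sub>1\<close>\<close>

context
  fixes C :: "('k::field, 'o, 'm, 'c::ab_group_add) lin2cat" (structure)
begin

definition iso2 :: "'m \<Rightarrow> 'm \<Rightarrow> 'c \<Rightarrow> bool" where
  "iso2 F F' \<alpha> \<longleftrightarrow>
     \<alpha> \<in> Cell C F F' \<and> (\<exists>\<beta> \<in> Cell C F' F. \<beta> \<cdot> \<alpha> = \<iota> F \<and> \<alpha> \<cdot> \<beta> = \<iota> F')"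

definition inv2 :: "'m \<Rightarrow> 'm \<Rightarrow> 'c \<Rightarrow> 'c" where
  "inv2 F F' \<alpha> = (THE \<beta>. \<beta> \<in> Cell C F' F \<and> \<beta> \<cdot> \<alpha> = \<iota> F \<and> \<alpha> \<cdot> \<beta> = \<iota> F')"

definition Tr :: "'o \<Rightarrow> 'm \<Rightarrow> 'c set" where
  "Tr V F = Cell C (idm C V) F"

definition Dim :: "'o \<Rightarrow> 'c set" where
  "Dim V = Tr V (idm C V)"

context
  fixes G :: "('g, 'z) monoid_scheme"
begin

definition is_rep2 :: "'o \<Rightarrow> ('g, 'm, 'c) rep2 \<Rightarrow> bool" where
  "is_rep2 V R \<longleftrightarrow>
     V \<in> Ob C \<and>
     (\<forall>g \<in> carrier G. act R g \<in> Mor C V V) \<and>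
     (\<forall>g \<in> carrier G. \<forall>h \<in> carrier G.
        iso2 (act R g \<odot> act R h) (act R (g \<otimes>\<^bsub>G\<^esub> h)) (mulc R g h)) \<and>
     iso2 (act R \<one>\<^bsub>G\<^esub>) (idm C V) (unitc R) \<and>
     (\<forall>g \<in> carrier G. \<forall>h \<in> carrier G. \<forall>k \<in> carrier G.
        mulc R (g \<otimes>\<^bsub>G\<^esub> h) k \<cdot> (mulc R g h \<star> \<iota> (act R k)) =
        mulc R g (h \<otimes>\<^bsub>G\<^esub> k) \<cdot> (\<iota> (act R g) \<star> mulc R h k)) \<and>
     (\<forall>g \<in> carrier G.
        mulc R \<one>\<^bsub>G\<^esub> g = unitc R \<star> \<iota> (act R g) \<and>
        mulc R g \<one>\<^bsub>G\<^esub> = \<iota> (act R g) \<star> unitc R)"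

definition psi :: "'o \<Rightarrow> ('g, 'm, 'c) rep2 \<Rightarrow> 'g \<Rightarrow> 'g \<Rightarrow> 'c \<Rightarrow> 'c" where
  "psi V R s g \<xi> =
     (let t = inv\<^bsub>G\<^esub> s in
      mulc R (s \<otimes>\<^bsub>G\<^esub> g) t \<cdot>
      (mulc R s g \<star> \<iota> (act R t)) \<cdot>
      (\<iota> (act R s) \<star> \<xi> \<star> \<iota> (act R t)) \<cdot>
      inv2 (act R s \<odot> act R t) (act R \<one>\<^bsub>G\<^esub>) (mulc R s t) \<cdot>
      inv2 (act R \<one>\<^bsub>G\<^esub>) (idm C V) (unitc R))"

text \<open>Only meaningful for \<open>g h = h g\<close>, where \<open>psi V R h g\<close> is an endomorphism of \<open>Tr V (act R g)\<close>.\<close>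

definition character2 :: "'o \<Rightarrow> ('g, 'm, 'c) rep2 \<Rightarrow> 'g \<Rightarrow> 'g \<Rightarrow> 'k" where
  "character2 V R g h = trace_on (smul C) (Tr V (act R g)) (psi V R h g)"


section \<open>Equivariant and trivialized 1-morphisms\<close>

text \<open>A 1-morphism \<open>W \<rightarrow> V\<close> with flips \<open>\<tau>\<close>, for 2-representations \<open>Q\<close> on \<open>W\<close> and \<open>R\<close> on \<open>V\<close>.\<close>

definition is_equivariant ::
  "'o \<Rightarrow> ('g, 'm, 'c) rep2 \<Rightarrow> 'o \<Rightarrow> ('g, 'm, 'c) rep2 \<Rightarrow> 'm \<Rightarrow> ('g \<Rightarrow> 'c) \<Rightarrow> bool" where
  "is_equivariant W Q V R F \<tau> \<longleftrightarrow>
     F \<in> Mor C W V \<and>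
     (\<forall>g \<in> carrier G. iso2 (act R g \<odot> F) (F \<odot> act Q g) (\<tau> g)) \<and>
     (\<forall>g \<in> carrier G. \<forall>h \<in> carrier G.
        \<tau> (g \<otimes>\<^bsub>G\<^esub> h) \<cdot> (mulc R g h \<star> \<iota> F) =
        (\<iota> F \<star> mulc Q g h) \<cdot> (\<tau> g \<star> \<iota> (act Q h)) \<cdot> (\<iota> (act R g) \<star> \<tau> h)) \<and>
     \<tau> \<one>\<^bsub>G\<^esub> = (\<iota> F \<star> inv2 (act Q \<one>\<^bsub>G\<^esub>) (idm C W) (unitc Q)) \<cdot> (unitc R \<star> \<iota> F)"

definition is_trivialization ::
  "'o \<Rightarrow> ('g, 'm, 'c) rep2 \<Rightarrow> 'o \<Rightarrow> ('g, 'm, 'c) rep2 \<Rightarrow> 'm \<Rightarrow> ('g \<Rightarrow> 'c) \<Rightarrow> ('g \<Rightarrow> 'c) \<Rightarrow> bool"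
  where
  "is_trivialization W Q V R F \<tau> \<epsilon> \<longleftrightarrow>
     (\<forall>g \<in> carrier G. iso2 F (act R g \<odot> F) (\<epsilon> g)) \<and>
     (\<forall>g \<in> carrier G. \<forall>h \<in> carrier G.
        (mulc R g h \<star> \<iota> F) \<cdot> (\<iota> (act R g) \<star> \<epsilon> h) \<cdot> \<epsilon> g = \<epsilon> (g \<otimes>\<^bsub>G\<^esub> h)) \<and>
     (\<forall>s \<in> carrier G. \<forall>g \<in> carrier G.
        let c = s \<otimes>\<^bsub>G\<^esub> g \<otimes>\<^bsub>G\<^esub> inv\<^bsub>G\<^esub> s;
            \<tau>s' = inv2 (act R s \<odot> F) (F \<odot> act Q s) (\<tau> s)
        in (mulc R s g \<star> \<iota> F) \<cdot> (\<iota> (act R s) \<star> \<epsilon> g) \<cdot> \<tau>s' =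
           (mulc R c s \<star> \<iota> F) \<cdot> (\<iota> (act R c) \<star> \<tau>s') \<cdot> (\<epsilon> c \<star> \<iota> (act Q s)))"

definition eqv_cat ::
  "'o \<Rightarrow> ('g, 'm, 'c) rep2 \<Rightarrow> 'o \<Rightarrow> ('g, 'm, 'c) rep2 \<Rightarrow> ('m \<times> ('g \<Rightarrow> 'c), 'c) cat" where
  "eqv_cat W Q V R =
     \<lparr> Obj = {(F, \<tau>). is_equivariant W Q V R F \<tau>},
       Arr = (\<lambda>(F, \<tau>) (F', \<tau>'). {\<eta> \<in> Cell C F F'.
               \<forall>g \<in> carrier G. \<tau>' g \<cdot> (\<iota> (act R g) \<star> \<eta>) = (\<eta> \<star> \<iota> (act Q g)) \<cdot> \<tau> g}),
       ident = (\<lambda>(F, \<tau>). \<iota> F),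
       comp = (\<cdot>) \<rparr>"

definition triv_cat ::
  "'o \<Rightarrow> ('g, 'm, 'c) rep2 \<Rightarrow> 'o \<Rightarrow> ('g, 'm, 'c) rep2 \<Rightarrow>
     ('m \<times> ('g \<Rightarrow> 'c) \<times> ('g \<Rightarrow> 'c), 'c) cat" where
  "triv_cat W Q V R =
     \<lparr> Obj = {(F, \<tau>, \<epsilon>). is_equivariant W Q V R F \<tau> \<and> is_trivialization W Q V R F \<tau> \<epsilon>},
       Arr = (\<lambda>(F, \<tau>, \<epsilon>) (F', \<tau>', \<epsilon>'). {\<eta> \<in> Cell C F F'.
               (\<forall>g \<in> carrier G. \<tau>' g \<cdot> (\<iota> (act R g) \<star> \<eta>) = (\<eta> \<star> \<iota> (act Q g)) \<cdot> \<tau> g) \<and>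
               (\<forall>g \<in> carrier G. \<epsilon>' g \<cdot> \<eta> = (\<iota> (act R g) \<star> \<eta>) \<cdot> \<epsilon> g)}),
       ident = (\<lambda>(F, \<tau>, \<epsilon>). \<iota> F),
       comp = (\<cdot>) \<rparr>"

text \<open>
  \<open>is_fixed_object V R X S \<epsilon> U \<tau>U\<close>: the object \<open>X\<close>, with the 2-representation \<open>S\<close> and the
  trivialization \<open>\<epsilon>\<close> of its identity, together with \<open>U : X \<rightarrow> V\<close> and its flips \<open>\<tau>U\<close>, is a
  \<open>V\<^sup>G\<close> for the 2-representation \<open>R\<close> on \<open>V\<close>. The identity of \<open>X\<close> carries the identity flips.
\<close>

definition is_fixed_object ::
  "'o \<Rightarrow> ('g, 'm, 'c) rep2 \<Rightarrow> 'o \<Rightarrow> ('g, 'm, 'c) rep2 \<Rightarrow> ('g \<Rightarrow> 'c) \<Rightarrow> 'm \<Rightarrow> ('g \<Rightarrow> 'c) \<Rightarrow> bool"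
  where
  "is_fixed_object V R X S \<epsilon> U \<tau>U \<longleftrightarrow>
     is_rep2 X S \<and>
     is_trivialization X S X S (idm C X) (\<lambda>g. \<iota> (act S g)) \<epsilon> \<and>
     is_equivariant X S V R U \<tau>U \<and>
     (\<forall>W Q. is_rep2 W Q \<longrightarrow>
        is_equivalence (eqv_cat W Q X S) (triv_cat W Q V R)
          (\<lambda>(F, \<sigma>).
             (U \<odot> F,
              \<lambda>g. (\<iota> U \<star> \<sigma> g) \<cdot> (\<tau>U g \<star> \<iota> F),
              \<lambda>g. (inv2 (act R g \<odot> U) (U \<odot> act S g) (\<tau>U g) \<star> \<iota> F) \<cdot> (\<iota> U \<star> \<epsilon> g \<star> \<iota> F)))
          (\<lambda>_ _ \<eta>. \<iota> U \<star> \<eta>))"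

end

end

end

theory Submission
  imports Defs
begin

text \<open>
  Write \<open>\<rho>(g)\<close> for the 1-endomorphisms of \<open>V\<close> given by \<open>R\<close>, and \<open>X = V\<^sup>G\<close>. The flips of \<open>U : X \<rightarrow> V\<close>
  and the trivialization of \<open>id\<^sub>X\<close> combine to 2-isomorphisms \<open>u\<^sub>g : \<rho>(g) U \<Rightarrow> U\<close> with
  \<open>u\<^sub>g\<^sub>h \<cdot> \<phi>\<^sub>g\<^sub>,\<^sub>h U = u\<^sub>g \<cdot> \<rho>(g) u\<^sub>h\<close>, an action of the 2-representation on \<open>U\<close>. Applied to objects \<open>W\<close> with
  the trivial 2-representation, the universal property says two things: 2-morphisms \<open>F \<Rightarrow> F'\<close> between
  1-morphisms \<open>W \<rightarrow> X\<close> are the 2-morphisms \<open>U F \<Rightarrow> U F'\<close> that commute with \<open>u\<close> (\<open>U_faithful\<close>, \<open>U_full\<close>),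
  and every 1-morphism \<open>A : W \<rightarrow> V\<close> with an action is isomorphic to some \<open>U I\<close> (\<open>action_realized\<close>).

  The first statement for \<open>F = F' = id\<^sub>X\<close> identifies \<open>\<D>im(X)\<close> with the fixed points \<open>E\<close> of the conjugation
  \<open>Ad\<^sub>s x = u\<^sub>s \<cdot> \<rho>(s) x \<cdot> u\<^sub>s\<inverse>\<close> on \<open>End(U)\<close> (\<open>Dim_iso_invariants\<close>). On the other hand
  \<open>\<Lambda>\<^sub>g(\<xi>) = u\<^sub>g \<cdot> \<xi> U\<close> maps \<open>\<T>r(\<rho>(g))\<close> to \<open>End(U)\<close>, and \<open>Ad\<^sub>s \<Lambda>\<^sub>g = \<Lambda>\<^sub>c \<psi>\<^sub>s\<close> for \<open>c = s g s\<inverse>\<close> (\<open>conj_act_psi\<close>).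
  So everything reduces to the claim that the sum of the maps \<open>\<Lambda>\<^sub>g\<close> is injective on \<open>\<Oplus>\<^sub>g \<T>r(\<rho>(g))\<close> and that
  its image contains \<open>E\<close>: then \<open>E\<close> is the space of invariants of the finite dimensional representation
  \<open>\<Oplus>\<^sub>g \<T>r(\<rho>(g))\<close>, its dimension is the trace of the projection \<open>1/|G| \<Sum>\<^sub>h \<psi>\<^sub>h\<close>, and only the summands
  \<open>\<T>r(\<rho>(g))\<close> with \<open>g h = h g\<close> contribute to the trace of \<open>\<psi>\<^sub>h\<close> (\<open>dim_invariants\<close>).

  The claim is proved with the induction 1-morphism \<open>I : V \<rightarrow> X\<close>, obtained from \<open>action_realized\<close> for the
  direct sum \<open>\<Oplus>\<^sub>h \<rho>(h)\<close>, on which \<open>\<rho>(g)\<close> acts by translating the summands. Thus \<open>U I = \<Oplus>\<^sub>h \<rho>(h)\<close>, and the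
  summand at \<open>1\<close> gives a unit \<open>id\<^sub>V \<Rightarrow> U I\<close>. Restricting \<open>\<Sum>\<^sub>g \<Lambda>\<^sub>g(\<xi>\<^sub>g)\<close> to \<open>U I\<close> and then along the unit yields
  the 2-morphism \<open>id\<^sub>V \<Rightarrow> \<Oplus>\<^sub>g \<rho>(g)\<close> with components \<open>\<xi>\<^sub>g\<close>, whence injectivity (\<open>Tr_sum_direct\<close>). Conversely
  the maps \<open>u\<^sub>h\<close> assemble to \<open>U I U \<Rightarrow> U\<close>, which commutes with \<open>u\<close> and so comes from a counit
  \<open>q : I U \<Rightarrow> id\<^sub>X\<close>; it is split by the unit, and naturality of a central element \<open>\<eta> : id\<^sub>X \<Rightarrow> id\<^sub>X\<close> at \<open>q\<close>
  expresses \<open>U \<eta>\<close> as \<open>\<Sum>\<^sub>g \<Lambda>\<^sub>g(\<xi>\<^sub>g)\<close>, where the \<open>\<xi>\<^sub>g\<close> are the components of \<open>\<eta> I\<close> along the unit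
  (\<open>center_expansion\<close>).
\<close>

section \<open>Invariants of a finite group acting on a graded space\<close>

text \<open>
  The maps that occur below, such as composition with a fixed 2-cell, are linear only on a single
  hom-space; outside of it nothing is known about them.
\<close>

definition lin_on :: "('k::field \<Rightarrow> 'v::ab_group_add \<Rightarrow> 'v) \<Rightarrow> 'v set \<Rightarrow> ('v \<Rightarrow> 'v) \<Rightarrow> bool" where
  "lin_on scale S f \<longleftrightarrow>
     (\<forall>x\<in>S. \<forall>y\<in>S. f (x + y) = f x + f y) \<and> (\<forall>x\<in>S. \<forall>c. f (scale c x) = scale c (f x))"

lemma lin_on_compose:
  "lin_on scale S f \<Longrightarrow> f ` S \<subseteq> T \<Longrightarrow> lin_on scale T h \<Longrightarrow> lin_on scale S (\<lambda>x. h (f x))"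
  unfolding lin_on_def by (simp add: image_subset_iff)

context vector_space
begin

lemma lin_on_zero: "subspace S \<Longrightarrow> lin_on scale S f \<Longrightarrow> f 0 = 0"
  unfolding lin_on_def by (metis scale_zero_left subspace_0)

lemma lin_on_sum:
  assumes "subspace S" "lin_on scale S f" "finite I" "\<And>i. i \<in> I \<Longrightarrow> x i \<in> S"
  shows "f (\<Sum>i\<in>I. x i) = (\<Sum>i\<in>I. f (x i))"
  using assms(3,4)
proof (induction I rule: finite_induct)
  case empty
  show ?case using lin_on_zero[OF assms(1,2)] by simp
next
  case (insert i I)
  then have "(\<Sum>i\<in>I. x i) \<in> S" "x i \<in> S" using subspace_sum[OF assms(1), of I x] by auto
  then show ?case using insert assms(2) unfolding lin_on_def by simp
qed

lemma lin_on_sum_scale: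
  assumes "subspace S" "lin_on scale S f" "finite I" "\<And>i. i \<in> I \<Longrightarrow> x i \<in> S"
  shows "f (\<Sum>i\<in>I. scale (c i) (x i)) = (\<Sum>i\<in>I. scale (c i) (f (x i)))"
proof -
  have "f (\<Sum>i\<in>I. scale (c i) (x i)) = (\<Sum>i\<in>I. f (scale (c i) (x i)))"
    by (rule lin_on_sum[OF assms(1-3)]) (use assms(1,4) subspace_scale in blast)
  then show ?thesis using assms(2,4) unfolding lin_on_def by simp
qed

lemma findim_basis:
  assumes "findim scale S"
  obtains B where "finite B" "independent B" "span B = S"
proof -
  obtain D where D: "finite D" "span D = S" using assms unfolding findim_def by blast
  obtain B where "B \<subseteq> D" "independent B" "D \<subseteq> span B"
    using maximal_independent_subset[of D] by blast
  moreover from this D have "span B = S"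
    by (metis span_mono span_span subset_antisym)
  ultimately show thesis using that D(1) finite_subset by blast
qed

lemma findim_independent_finite:
  assumes "findim scale S" "independent B" "B \<subseteq> S"
  shows "finite B"
proof -
  obtain D where D: "finite D" "span D = S" using assms(1) unfolding findim_def by blast
  then show ?thesis using independent_span_bound[of D B] assms by blast
qed

lemma findim_subspace:
  assumes "subspace E" "E \<subseteq> S" "findim scale S"
  shows "findim scale E"
proof -
  obtain B where B: "B \<subseteq> E" "independent B" "E \<subseteq> span B"
    using maximal_independent_subset[of E] by blast
  then have "span B = E" using assms(1) span_minimal by blast
  then show ?thesis using B findim_independent_finite[of S B] assms unfolding findim_def by blast
qed

text \<open>
  Expanding \<open>f b\<close> in both bases turns either side into the double sum over \<open>b\<close> and \<open>b'\<close> of the coefficient of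
  \<open>b'\<close> in \<open>b\<close> times the coefficient of \<open>b\<close> in \<open>f b'\<close>.
\<close>

lemma trace_basis_independent:
  assumes "finite B" "independent B" "finite B'" "independent B'" "span B = span B'"
    and f: "lin_on scale (span B) f" "f ` span B \<subseteq> span B"
  shows "(\<Sum>b\<in>B. representation B (f b) b) = (\<Sum>b\<in>B'. representation B' (f b) b)"
proof -
  let ?r = "representation B" and ?r' = "representation B'"
  have inB: "b \<in> span B'" if "b \<in> B" for b using that assms(5) span_base by blast
  have inB': "b \<in> span B" if "b \<in> B'" for b using that assms(5) span_base by blast
  have expand: "?r (f b) b = (\<Sum>b'\<in>B'. ?r' b b' * ?r (f b') b)" if b: "b \<in> B" for b
  proof -
    have "f b = f (\<Sum>b'\<in>B'. scale (?r' b b') b')"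
      using sum_representation_eq[OF assms(4) inB[OF b] assms(3)] by simp
    also have "\<dots> = (\<Sum>b'\<in>B'. scale (?r' b b') (f b'))"
      by (rule lin_on_sum_scale[OF subspace_span f(1) assms(3) inB'])
    finally have "?r (f b) b = ?r (\<Sum>b'\<in>B'. scale (?r' b b') (f b')) b" by simp
    also have "\<dots> = (\<Sum>b'\<in>B'. ?r (scale (?r' b b') (f b')) b)"
      by (subst representation_sum[OF assms(2)]) (use f(2) inB' span_scale in blast)+
    also have "\<dots> = (\<Sum>b'\<in>B'. ?r' b b' * ?r (f b') b)"
      by (intro sum.cong refl, subst representation_scale[OF assms(2)]) (use f(2) inB' in blast)+
    finally show ?thesis .
  qed
  have collect: "?r' (f b') b' = (\<Sum>b\<in>B. ?r (f b') b * ?r' b b')" if b': "b' \<in> B'" for b'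
  proof -
    have "f b' \<in> span B" using f(2) inB'[OF b'] by blast
    then have "?r' (f b') b' = ?r' (\<Sum>b\<in>B. scale (?r (f b') b) b) b'"
      using sum_representation_eq[OF assms(2) _ assms(1)] by simp
    also have "\<dots> = (\<Sum>b\<in>B. ?r' (scale (?r (f b') b) b) b')"
      by (subst representation_sum[OF assms(4)]) (use inB span_scale in blast)+
    also have "\<dots> = (\<Sum>b\<in>B. ?r (f b') b * ?r' b b')"
      by (intro sum.cong refl, subst representation_scale[OF assms(4)]) (use inB in blast)+
    finally show ?thesis .
  qed
  have "(\<Sum>b\<in>B. ?r (f b) b) = (\<Sum>b\<in>B. \<Sum>b'\<in>B'. ?r' b b' * ?r (f b') b)"
    using expand by simp
  also have "\<dots> = (\<Sum>b'\<in>B'. \<Sum>b\<in>B. ?r (f b') b * ?r' b b')"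
    by (subst sum.swap) (simp add: mult.commute)
  finally show ?thesis using collect by simp
qed

text \<open>
  In a basis that extends a basis of the image \<open>E\<close>, the diagonal entries of a projection are 1 at the
  basis vectors of \<open>E\<close>, which are fixed, and 0 at the others, whose images lie in \<open>E\<close>.
\<close>

lemma trace_projection:
  assumes B: "finite B" "independent B"
    and P: "lin_on scale (span B) P" "P ` span B \<subseteq> E"
    and E: "subspace E" "E \<subseteq> span B" "\<And>x. x \<in> E \<Longrightarrow> P x = x"
  shows "(\<Sum>b\<in>B. representation B (P b) b) = of_nat (dim E)"
proof -
  have "findim scale (span B)" using B(1) unfolding findim_def by blast
  then obtain D where D: "finite D" "independent D" "span D = E"
    using findim_basis findim_subspace[OF E(1,2)] by blast
  have "D \<subseteq> span B" using D(3) E(2) span_superset by blast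
  then obtain B' where B': "D \<subseteq> B'" "B' \<subseteq> span B" "independent B'" "span B \<subseteq> span B'"
    using maximal_independent_subset_extend[of D "span B"] D(2) by metis
  have "finite B'"
    using findim_independent_finite \<open>findim scale (span B)\<close> B'(2,3) by blast
  have span: "span B = span B'"
    using B' by (simp add: span_minimal subspace_span subset_antisym)
  have coeff: "representation B' (P b) b = (if b \<in> D then 1 else 0)" if b: "b \<in> B'" for b
  proof (cases "b \<in> D")
    case True
    then have "P b = b" using E(3) D(3) span_base by blast
    then show ?thesis using True b representation_basis[OF B'(3) b] by simp
  next
    case False
    have "P b \<in> span D" using P(2) b B'(2) D(3) by blast
    then have "representation B' (P b) = representation D (P b)"
      using representation_extend[OF B'(3) _ B'(1)] by metis
    then show ?thesis using False representation_ne_zero by metis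
  qed
  have "(\<Sum>b\<in>B. representation B (P b) b) = (\<Sum>b\<in>B'. representation B' (P b) b)"
    by (rule trace_basis_independent[OF B \<open>finite B'\<close> B'(3) span P(1)]) (use P(2) E(2) in blast)
  also have "\<dots> = (\<Sum>b\<in>B'. if b \<in> D then 1 else 0)" using coeff by simp
  also have "\<dots> = of_nat (card D)"
    using B'(1) \<open>finite B'\<close> by (simp add: sum.If_cases Int_absorb1)
  also have "card D = dim E" using D(2,3) by (metis dim_span_eq_card_independent)
  finally show ?thesis .
qed

text \<open>
  Bases of the spaces \<open>S g\<close> form a basis of \<open>\<Oplus> S g\<close>. The direct sum is given by maps \<open>L g\<close> into one ambient
  space such that \<open>\<xi> \<mapsto> \<Sum> L g (\<xi> g)\<close> is injective.
\<close>

lemma independent_direct_sum: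
  assumes K: "finite K"
    and sub: "\<And>g. g \<in> K \<Longrightarrow> subspace (S g)"
    and B: "\<And>g. g \<in> K \<Longrightarrow> finite (B g)" "\<And>g. g \<in> K \<Longrightarrow> independent (B g)"
      "\<And>g. g \<in> K \<Longrightarrow> span (B g) = S g"
    and L: "\<And>g. g \<in> K \<Longrightarrow> lin_on scale (S g) (L g)"
    and direct0: "\<forall>\<xi>. (\<forall>g\<in>K. \<xi> g \<in> S g) \<longrightarrow> (\<Sum>g\<in>K. L g (\<xi> g)) = 0 \<longrightarrow> (\<forall>g\<in>K. \<xi> g = 0)"
  defines "BB \<equiv> \<Union>g\<in>K. L g ` B g"
  shows "inj_on (\<lambda>(g, b). L g b) (Sigma K B)" (is ?inj)
    and "independent BB" (is ?ind)
    and "span BB = {\<Sum>g\<in>K. L g (\<xi> g) | \<xi>. \<forall>g\<in>K. \<xi> g \<in> S g}" (is ?span)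
    and "\<And>g k x b. g \<in> K \<Longrightarrow> k \<in> K \<Longrightarrow> x \<in> S g \<Longrightarrow> b \<in> B k \<Longrightarrow>
       representation BB (L g x) (L k b) = (if g = k then representation (B g) x b else 0)"
proof -
  have BS: "b \<in> S g" if "g \<in> K" "b \<in> B g" for g b
    using that B(3) span_base by blast
  have direct: "\<xi> g = 0" if "\<And>g. g \<in> K \<Longrightarrow> \<xi> g \<in> S g" "(\<Sum>g\<in>K. L g (\<xi> g)) = 0" "g \<in> K" for \<xi> g
    using direct0 that by blast
  have L0: "L g 0 = 0" if "g \<in> K" for g by (rule lin_on_zero[OF sub L]) (fact that)+
  have direct2: "\<xi> g = \<xi>' g"
    if "\<And>g. g \<in> K \<Longrightarrow> \<xi> g \<in> S g" "\<And>g. g \<in> K \<Longrightarrow> \<xi>' g \<in> S g"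
      "(\<Sum>g\<in>K. L g (\<xi> g)) = (\<Sum>g\<in>K. L g (\<xi>' g))" "g \<in> K" for \<xi> \<xi>' g
  proof -
    have diff: "L g (\<xi> g - \<xi>' g) = L g (\<xi> g) - L g (\<xi>' g)" if "g \<in> K" for g
    proof -
      have "\<xi> g - \<xi>' g \<in> S g" using that subspace_diff[OF sub] \<open>\<And>g. g \<in> K \<Longrightarrow> \<xi> g \<in> S g\<close>
          \<open>\<And>g. g \<in> K \<Longrightarrow> \<xi>' g \<in> S g\<close> by blast
      then have "L g ((\<xi> g - \<xi>' g) + \<xi>' g) = L g (\<xi> g - \<xi>' g) + L g (\<xi>' g)"
        using L[OF that] \<open>\<And>g. g \<in> K \<Longrightarrow> \<xi>' g \<in> S g\<close>[OF that] unfolding lin_on_def by blast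
      then show ?thesis by simp
    qed
    have "\<xi> g - \<xi>' g = 0"
    proof (rule direct[of "\<lambda>g. \<xi> g - \<xi>' g"])
      show "\<xi> g - \<xi>' g \<in> S g" if "g \<in> K" for g
        using that \<open>\<And>g. g \<in> K \<Longrightarrow> \<xi> g \<in> S g\<close> \<open>\<And>g. g \<in> K \<Longrightarrow> \<xi>' g \<in> S g\<close> subspace_diff[OF sub]
        by blast
      show "(\<Sum>g\<in>K. L g (\<xi> g - \<xi>' g)) = 0" using that(3) by (simp add: diff sum_subtractf)
    qed (fact that(4))
    then show ?thesis by simp
  qed
  \<comment> \<open>a vector of a single summand is a family supported at one index\<close>
  have delta: "(\<Sum>g\<in>K. L g (if g = k then x else 0)) = L k x" if "k \<in> K" for k x
  proof -
    have "(\<Sum>g\<in>K. L g (if g = k then x else 0)) = (\<Sum>g\<in>K. if g = k then L k x else 0)"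
      by (rule sum.cong) (auto simp: L0)
    then show ?thesis using K that by simp
  qed
  have S0: "0 \<in> S g" if "g \<in> K" for g using sub[OF that] subspace_0 by blast
  show inj: ?inj
  proof (rule inj_onI, clarsimp)
    fix g b k c
    assume gk: "g \<in> K" "k \<in> K" and bc: "b \<in> B g" "c \<in> B k" and eq: "L g b = L k c"
    have "(if h = g then b else 0) = (if h = k then c else 0)" if "h \<in> K" for h
      by (rule direct2[of "\<lambda>h. if h = g then b else 0" "\<lambda>h. if h = k then c else 0"])
        (use gk bc eq delta S0 BS that in auto)
    from this[OF gk(1)] have "g \<noteq> k \<Longrightarrow> b = 0" "g = k \<Longrightarrow> b = c" by auto
    moreover have "b \<noteq> 0" using B(2)[OF gk(1)] bc(1) dependent_zero by blast
    ultimately show "g = k \<and> b = c" by blast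
  qed
  have expand: "L g x = (\<Sum>b\<in>B g. scale (representation (B g) x b) (L g b))"
    if "g \<in> K" "x \<in> S g" for g x
  proof -
    have "L g x = L g (\<Sum>b\<in>B g. scale (representation (B g) x b) b)"
      using sum_representation_eq[of "B g" x "B g"] B[OF that(1)] that(2) by simp
    also have "\<dots> = (\<Sum>b\<in>B g. scale (representation (B g) x b) (L g b))"
      by (rule lin_on_sum_scale[OF sub L B(1)]) (use BS that(1) in auto)
    finally show ?thesis .
  qed
  show span: ?span
  proof (intro subset_antisym span_minimal subsetI)
    fix x assume "x \<in> BB"
    then obtain k b where "k \<in> K" "b \<in> B k" "x = L k b" unfolding BB_def by blast
    then show "x \<in> {\<Sum>g\<in>K. L g (\<xi> g) | \<xi>. \<forall>g\<in>K. \<xi> g \<in> S g}"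
      using delta[of k b] BS S0 by (intro CollectI exI[of _ "\<lambda>g. if g = k then b else 0"]) auto
  next
    show "subspace {\<Sum>g\<in>K. L g (\<xi> g) | \<xi>. \<forall>g\<in>K. \<xi> g \<in> S g}"
    proof (rule subspaceI)
      show "0 \<in> {\<Sum>g\<in>K. L g (\<xi> g) | \<xi>. \<forall>g\<in>K. \<xi> g \<in> S g}"
        using S0 L0 by (intro CollectI exI[of _ "\<lambda>_. 0"]) auto
    next
      fix x y assume "x \<in> {\<Sum>g\<in>K. L g (\<xi> g) | \<xi>. \<forall>g\<in>K. \<xi> g \<in> S g}"
        "y \<in> {\<Sum>g\<in>K. L g (\<xi> g) | \<xi>. \<forall>g\<in>K. \<xi> g \<in> S g}"
      then obtain \<xi> \<xi>' where "x = (\<Sum>g\<in>K. L g (\<xi> g))" "y = (\<Sum>g\<in>K. L g (\<xi>' g))"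
        and "\<forall>g\<in>K. \<xi> g \<in> S g" "\<forall>g\<in>K. \<xi>' g \<in> S g" by blast
      then show "x + y \<in> {\<Sum>g\<in>K. L g (\<xi> g) | \<xi>. \<forall>g\<in>K. \<xi> g \<in> S g}"
        using L sub
        by (intro CollectI exI[of _ "\<lambda>g. \<xi> g + \<xi>' g"])
          (auto simp: sum.distrib[symmetric] lin_on_def subspace_add intro!: sum.cong)
    next
      fix x c assume "x \<in> {\<Sum>g\<in>K. L g (\<xi> g) | \<xi>. \<forall>g\<in>K. \<xi> g \<in> S g}"
      then obtain \<xi> where "x = (\<Sum>g\<in>K. L g (\<xi> g))" and "\<forall>g\<in>K. \<xi> g \<in> S g" by blast
      then show "scale c x \<in> {\<Sum>g\<in>K. L g (\<xi> g) | \<xi>. \<forall>g\<in>K. \<xi> g \<in> S g}"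
        using L sub
        by (intro CollectI exI[of _ "\<lambda>g. scale c (\<xi> g)"])
          (auto simp: scale_sum_right lin_on_def subspace_scale intro!: sum.cong)
    qed
  next
    fix x assume "x \<in> {\<Sum>g\<in>K. L g (\<xi> g) | \<xi>. \<forall>g\<in>K. \<xi> g \<in> S g}"
    then obtain \<xi> where x: "x = (\<Sum>g\<in>K. L g (\<xi> g))" and \<xi>: "\<forall>g\<in>K. \<xi> g \<in> S g" by blast
    have "L g (\<xi> g) \<in> span BB" if "g \<in> K" for g
    proof -
      have "(\<Sum>b\<in>B g. scale (representation (B g) (\<xi> g) b) (L g b)) \<in> span BB"
        by (intro span_sum span_scale span_base) (use that BB_def in blast)
      then show ?thesis using expand[OF that] \<xi> that by simp
    qed
    then show "x \<in> span BB" unfolding x by (intro span_sum)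
  qed
  have finBB: "finite BB" unfolding BB_def using K B(1) by blast
  have sumBB: "(\<Sum>v\<in>BB. F v) = (\<Sum>g\<in>K. \<Sum>b\<in>B g. F (L g b))" for F :: "'b \<Rightarrow> 'b"
  proof -
    have "BB = (\<lambda>(g, b). L g b) ` Sigma K B" unfolding BB_def by force
    then have "(\<Sum>v\<in>BB. F v) = (\<Sum>(g, b)\<in>Sigma K B. F (L g b))"
      using sum.reindex[OF inj, of F] by (simp add: case_prod_unfold)
    then show ?thesis using sum.Sigma[of K B "\<lambda>g b. F (L g b)"] K B(1) by simp
  qed
  show ind: ?ind
  proof (rule independent_if_scalars_zero[OF finBB])
    fix f v assume sum0: "(\<Sum>v\<in>BB. scale (f v) v) = 0" and v: "v \<in> BB"
    have \<xi>: "(\<Sum>b\<in>B g. scale (f (L g b)) b) \<in> S g" if "g \<in> K" for g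
      using BS[OF that] sub[OF that] by (intro subspace_sum subspace_scale)
    have "(\<Sum>g\<in>K. L g (\<Sum>b\<in>B g. scale (f (L g b)) b)) = (\<Sum>v\<in>BB. scale (f v) v)"
      unfolding sumBB
      by (intro sum.cong refl lin_on_sum_scale[OF sub L]) (use B(1) BS in auto)
    also note sum0
    finally have \<xi>0: "(\<Sum>b\<in>B g. scale (f (L g b)) b) = 0" if "g \<in> K" for g
      using direct[OF \<xi>] that by blast
    obtain g b where "g \<in> K" "b \<in> B g" "v = L g b" using v unfolding BB_def by blast
    then show "f v = 0"
      using independentD[where u = "\<lambda>b. f (L g b)", OF B(2)[of g] B(1)[of g] subset_refl \<xi>0] by simp
  qed
  fix g k x b
  assume gk: "g \<in> K" "k \<in> K" and x: "x \<in> S g" and b: "b \<in> B k"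
  have spanL: "L g c \<in> BB" if "c \<in> B g" for c using that gk(1) BB_def by blast
  have "representation BB (L g x) (L k b)
      = (\<Sum>c\<in>B g. representation BB (scale (representation (B g) x c) (L g c)) (L k b))"
    unfolding expand[OF gk(1) x]
    by (subst representation_sum[OF ind]) (auto intro: span_scale span_base spanL)
  also have "\<dots> = (\<Sum>c\<in>B g. representation (B g) x c * (if L k b = L g c then 1 else 0))"
    by (intro sum.cong refl, subst representation_scale[OF ind])
      (auto intro: span_base spanL simp: representation_basis[OF ind spanL])
  also have "\<dots> = (\<Sum>c\<in>B g. if c = b \<and> g = k then representation (B g) x b else 0)"
  proof (intro sum.cong refl)
    fix c assume c: "c \<in> B g"
    have "L k b = L g c \<longleftrightarrow> c = b \<and> g = k"
      using inj_onD[OF inj, of "(k, b)" "(g, c)"] gk b c by auto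
    then show "representation (B g) x c * (if L k b = L g c then 1 else 0)
      = (if c = b \<and> g = k then representation (B g) x b else 0)" by auto
  qed
  also have "\<dots> = (if g = k then representation (B g) x b else 0)"
    using b B(1)[OF gk(1)] by auto
  finally show "representation BB (L g x) (L k b) = (if g = k then representation (B g) x b else 0)" .
qed

lemma trace_on_eq:
  assumes "independent B" "span B = S"
  obtains B' where "independent B'" "span B' = S"
    "\<And>f. trace_on scale S f = (\<Sum>b\<in>B'. representation B' (f b) b)"
proof -
  let ?B = "SOME B. independent B \<and> span B = S"
  have "independent ?B \<and> span ?B = S" by (rule someI[of _ B]) (use assms in blast)
  then show thesis by (intro that[of ?B]) (simp_all add: trace_on_def Let_def)
qed

text \<open>
  Averaging over \<open>G\<close> projects \<open>\<Oplus> S g\<close> onto the invariants, so the dimension of the invariants is the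
  average of the traces of the group elements. An element \<open>s\<close> maps the summand of \<open>g\<close> to the summand of
  \<open>s g s\<inverse>\<close>, hence only the summands of elements commuting with \<open>s\<close> meet the diagonal of its matrix, each
  with the trace of the restriction. The ambient space \<open>N\<close> on which \<open>G\<close> acts may be larger than the sum
  of the images of the \<open>L g\<close>, but the invariants of \<open>N\<close> are assumed to lie in that sum.
\<close>

lemma dim_invariants:
  fixes G :: "('g, 'z) monoid_scheme" (structure)
  assumes "group G" and fin: "finite (carrier G)"
    and char: "of_nat (card (carrier G)) \<noteq> (0::'a)"
    and sub: "\<And>g. g \<in> carrier G \<Longrightarrow> subspace (S g)"
    and fd: "\<And>g. g \<in> carrier G \<Longrightarrow> findim scale (S g)"
    and \<psi>: "\<And>s g x. s \<in> carrier G \<Longrightarrow> g \<in> carrier G \<Longrightarrow> x \<in> S g \<Longrightarrow>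
        \<psi> s g x \<in> S (s \<otimes> g \<otimes> inv s)"
    and L: "\<And>g. g \<in> carrier G \<Longrightarrow> lin_on scale (S g) (L g)"
    and direct: "\<forall>\<xi>. (\<forall>g\<in>carrier G. \<xi> g \<in> S g) \<longrightarrow> (\<Sum>g\<in>carrier G. L g (\<xi> g)) = 0
        \<longrightarrow> (\<forall>g\<in>carrier G. \<xi> g = 0)"
    and N: "subspace N" and LN: "\<And>g x. g \<in> carrier G \<Longrightarrow> x \<in> S g \<Longrightarrow> L g x \<in> N"
    and Ad: "\<And>s. s \<in> carrier G \<Longrightarrow> lin_on scale N (Ad s)"
      "\<And>s x. s \<in> carrier G \<Longrightarrow> x \<in> N \<Longrightarrow> Ad s x \<in> N"
      "\<And>s t x. s \<in> carrier G \<Longrightarrow> t \<in> carrier G \<Longrightarrow> x \<in> N \<Longrightarrow> Ad s (Ad t x) = Ad (s \<otimes> t) x"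
    and AdL: "\<And>s g x. s \<in> carrier G \<Longrightarrow> g \<in> carrier G \<Longrightarrow> x \<in> S g \<Longrightarrow>
        Ad s (L g x) = L (s \<otimes> g \<otimes> inv s) (\<psi> s g x)"
  defines "E \<equiv> {x \<in> N. \<forall>s\<in>carrier G. Ad s x = x}"
  assumes E: "\<And>x. x \<in> E \<Longrightarrow> \<exists>\<xi>. (\<forall>g\<in>carrier G. \<xi> g \<in> S g) \<and> x = (\<Sum>g\<in>carrier G. L g (\<xi> g))"
  shows "findim scale E" (is ?fin)
    and "of_nat (card (carrier G)) * of_nat (dim E) =
      (\<Sum>(g, h) \<in> {(g, h). g \<in> carrier G \<and> h \<in> carrier G \<and> g \<otimes> h = h \<otimes> g}.
         trace_on scale (S g) (\<psi> h g))" (is ?dim)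
proof -
  interpret group G by fact
  let ?K = "carrier G"
  have "\<exists>B. finite B \<and> independent B \<and> span B = S g
      \<and> (\<forall>f. trace_on scale (S g) f = (\<Sum>b\<in>B. representation B (f b) b))"
    if "g \<in> ?K" for g
  proof -
    obtain B where "independent B" "span B = S g" using findim_basis[OF fd] \<open>g \<in> ?K\<close> by metis
    then obtain B' where "independent B'" "span B' = S g"
      "\<And>f. trace_on scale (S g) f = (\<Sum>b\<in>B'. representation B' (f b) b)"
      using trace_on_eq by metis
    moreover from this have "finite B'"
      using findim_independent_finite[OF fd] \<open>g \<in> ?K\<close> span_superset by metis
    ultimately show ?thesis by blast
  qed
  then have "\<forall>g\<in>?K. \<exists>B. finite B \<and> independent B \<and> span B = S g
      \<and> (\<forall>f. trace_on scale (S g) f = (\<Sum>b\<in>B. representation B (f b) b))" by blast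
  from bchoice[OF this] obtain B where B: "\<And>g. g \<in> ?K \<Longrightarrow> finite (B g)"
      "\<And>g. g \<in> ?K \<Longrightarrow> independent (B g)" "\<And>g. g \<in> ?K \<Longrightarrow> span (B g) = S g"
    and tr: "\<And>g f. g \<in> ?K \<Longrightarrow>
        trace_on scale (S g) f = (\<Sum>b\<in>B g. representation (B g) (f b) b)"
    by blast
  define BB where "BB = (\<Union>g\<in>?K. L g ` B g)"
  note ds = independent_direct_sum[where K = ?K and S = S and B = B and L = L, OF fin sub B L direct, folded BB_def]
  have finBB: "finite BB" unfolding BB_def using fin B(1) by blast
  have indBB: "independent BB" by (rule ds(2))
  have spanBB: "span BB = {\<Sum>g\<in>?K. L g (\<xi> g) | \<xi>. \<forall>g\<in>?K. \<xi> g \<in> S g}"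
    by (rule ds(3))
  have rep: "representation BB (L g x) (L k b) = (if g = k then representation (B g) x b else 0)"
    if "g \<in> ?K" "k \<in> ?K" "x \<in> S g" "b \<in> B k" for g k x b
    by (rule ds(4)) (use that in auto)
  have BS: "b \<in> S g" if "g \<in> ?K" "b \<in> B g" for g b
    using that B(3) span_base by blast
  have subE: "subspace E"
  proof (rule subspaceI)
    show "0 \<in> E" using lin_on_zero[OF N Ad(1)] subspace_0[OF N] by (auto simp: E_def)
    show "x + y \<in> E" if "x \<in> E" "y \<in> E" for x y
      using that Ad(1) subspace_add[OF N] by (auto simp: E_def lin_on_def)
    show "scale c x \<in> E" if "x \<in> E" for c x
      using that Ad(1) subspace_scale[OF N] by (auto simp: E_def lin_on_def)
  qed
  have Espan: "E \<subseteq> span BB" unfolding spanBB using E by blast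
  have "findim scale (span BB)" using finBB unfolding findim_def by blast
  then show ?fin by (rule findim_subspace[OF subE Espan])
  have spanN: "span BB \<subseteq> N"
    by (intro span_minimal N) (use LN BS in \<open>auto simp: BB_def\<close>)
  let ?n = "of_nat (card ?K) :: 'a"
  define P where "P x = scale (1 / ?n) (\<Sum>s\<in>?K. Ad s x)" for x
  have P_lin: "lin_on scale (span BB) P"
    unfolding lin_on_def P_def
  proof (intro conjI ballI allI)
    fix x y assume "x \<in> span BB" "y \<in> span BB"
    then have "x \<in> N" "y \<in> N" using spanN by auto
    then have "(\<Sum>s\<in>?K. Ad s (x + y)) = (\<Sum>s\<in>?K. Ad s x) + (\<Sum>s\<in>?K. Ad s y)"
      using Ad(1) by (simp add: lin_on_def sum.distrib)
    then show "scale (1 / ?n) (\<Sum>s\<in>?K. Ad s (x + y))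
        = scale (1 / ?n) (\<Sum>s\<in>?K. Ad s x) + scale (1 / ?n) (\<Sum>s\<in>?K. Ad s y)"
      by (simp add: scale_right_distrib)
  next
    fix x c assume "x \<in> span BB"
    then have "x \<in> N" using spanN by auto
    then have "(\<Sum>s\<in>?K. Ad s (scale c x)) = scale c (\<Sum>s\<in>?K. Ad s x)"
      using Ad(1) by (simp add: lin_on_def scale_sum_right)
    then show "scale (1 / ?n) (\<Sum>s\<in>?K. Ad s (scale c x)) = scale c (scale (1 / ?n) (\<Sum>s\<in>?K. Ad s x))"
      by (simp add: mult.commute)
  qed
  have P_E: "P x \<in> E" if "x \<in> span BB" for x
  proof -
    have x: "x \<in> N" using that spanN by blast
    have sumN: "(\<Sum>s\<in>?K. Ad s x) \<in> N" using Ad(2) x by (intro subspace_sum[OF N])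
    have "Ad t (\<Sum>s\<in>?K. Ad s x) = (\<Sum>s\<in>?K. Ad s x)" if t: "t \<in> ?K" for t
    proof -
      have "Ad t (\<Sum>s\<in>?K. Ad s x) = (\<Sum>s\<in>?K. Ad t (Ad s x))"
        by (rule lin_on_sum[OF N Ad(1)[OF t] fin]) (use Ad(2) x in blast)
      also have "\<dots> = (\<Sum>s\<in>?K. Ad (t \<otimes> s) x)" using Ad(3) t x by simp
      also have "\<dots> = (\<Sum>s\<in>?K. Ad s x)"
        by (rule sum.reindex_bij_witness[of _ "\<lambda>s. inv t \<otimes> s" "\<lambda>s. t \<otimes> s"])
          (use t in \<open>auto simp: m_assoc[symmetric]\<close>)
      finally show ?thesis .
    qed
    then show ?thesis
      unfolding P_def E_def using sumN Ad(1) subspace_scale[OF N] by (auto simp: lin_on_def)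
  qed
  have P_id: "P x = x" if "x \<in> E" for x
  proof -
    have "(\<Sum>s\<in>?K. Ad s x) = (\<Sum>s\<in>?K. x)" using that by (intro sum.cong) (auto simp: E_def)
    then have "(\<Sum>s\<in>?K. Ad s x) = scale ?n x"
      by (simp add: sum_constant_scale)
    then show ?thesis unfolding P_def using char by simp
  qed
  have diag: "representation BB (Ad s (L g b)) (L g b)
      = (if s \<otimes> g = g \<otimes> s then representation (B g) (\<psi> s g b) b else 0)"
    if "s \<in> ?K" "g \<in> ?K" "b \<in> B g" for s g b
  proof -
    have "s \<otimes> g \<otimes> inv s = g \<longleftrightarrow> s \<otimes> g = g \<otimes> s"
      using that by (metis inv_solve_right m_closed)
    then show ?thesis
      using AdL[OF that(1,2) BS] rep[OF _ that(2) \<psi>[OF that(1,2) BS] that(3)] that by auto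
  qed
  have PL: "representation BB (P (L g b)) (L g b)
      = (1 / ?n) * (\<Sum>s\<in>?K. if s \<otimes> g = g \<otimes> s then representation (B g) (\<psi> s g b) b else 0)"
    if "g \<in> ?K" "b \<in> B g" for g b
  proof -
    have Adspan: "Ad s (L g b) \<in> span BB" if "s \<in> ?K" for s
    proof -
      have "L (s \<otimes> g \<otimes> inv s) (\<psi> s g b) \<in> span BB"
      proof -
        let ?c = "s \<otimes> g \<otimes> inv s" and ?\<xi> = "\<lambda>k. if k = s \<otimes> g \<otimes> inv s then \<psi> s g b else 0"
        have c: "?c \<in> ?K" using that \<open>g \<in> ?K\<close> by simp
        have "(\<Sum>k\<in>?K. L k (?\<xi> k)) = (\<Sum>k\<in>?K. if k = ?c then L ?c (\<psi> s g b) else 0)"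
          by (rule sum.cong) (auto simp: lin_on_zero[OF sub L])
        then have "L ?c (\<psi> s g b) = (\<Sum>k\<in>?K. L k (?\<xi> k))" using fin c by simp
        moreover have "\<forall>k\<in>?K. ?\<xi> k \<in> S k"
          using \<psi>[OF that \<open>g \<in> ?K\<close> BS] \<open>g \<in> ?K\<close> \<open>b \<in> B g\<close> subspace_0[OF sub] by simp
        ultimately show ?thesis unfolding spanBB by (intro CollectI exI[of _ ?\<xi>] conjI)
      qed
      then show ?thesis using AdL[OF that \<open>g \<in> ?K\<close> BS] \<open>g \<in> ?K\<close> \<open>b \<in> B g\<close> by simp
    qed
    have "representation BB (P (L g b)) (L g b)
        = (1 / ?n) * (\<Sum>s\<in>?K. representation BB (Ad s (L g b)) (L g b))"
      unfolding P_def
      by (subst representation_scale[OF indBB], rule span_sum, erule Adspan)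
        (subst representation_sum[OF indBB], use Adspan in auto)
    then show ?thesis using diag that by simp
  qed
  have inj: "inj_on (\<lambda>(g, b). L g b) (Sigma ?K B)" by (rule ds(1))
  have BBim: "BB = (\<lambda>(g, b). L g b) ` Sigma ?K B" unfolding BB_def by force
  have "of_nat (dim E) = (\<Sum>v\<in>BB. representation BB (P v) v)"
    by (rule trace_projection[OF finBB indBB P_lin _ subE Espan P_id, symmetric]) (use P_E in blast)
  also have "\<dots> = (\<Sum>(g, b)\<in>Sigma ?K B. representation BB (P (L g b)) (L g b))"
    unfolding BBim sum.reindex[OF inj] by (simp add: case_prod_unfold)
  also have "\<dots> = (\<Sum>g\<in>?K. \<Sum>b\<in>B g. representation BB (P (L g b)) (L g b))"
    by (rule sum.Sigma[symmetric]) (use fin B(1) in auto)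
  also have "\<dots> = (1 / ?n) * (\<Sum>g\<in>?K. \<Sum>b\<in>B g. \<Sum>s\<in>?K.
      if s \<otimes> g = g \<otimes> s then representation (B g) (\<psi> s g b) b else 0)"
    by (simp add: PL sum_distrib_left)
  also have "(\<Sum>g\<in>?K. \<Sum>b\<in>B g. \<Sum>s\<in>?K.
      if s \<otimes> g = g \<otimes> s then representation (B g) (\<psi> s g b) b else 0)
    = (\<Sum>g\<in>?K. \<Sum>s\<in>?K. if s \<otimes> g = g \<otimes> s then trace_on scale (S g) (\<psi> s g) else 0)"
    by (intro sum.cong refl, subst sum.swap) (auto simp: tr intro!: sum.cong)
  also have "\<dots> = (\<Sum>(g, s)\<in>?K \<times> ?K. if s \<otimes> g = g \<otimes> s then trace_on scale (S g) (\<psi> s g) else 0)"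
    by (simp add: sum.cartesian_product)
  also have "\<dots> = (\<Sum>(g, s)\<in>{(g, s). g \<in> ?K \<and> s \<in> ?K \<and> g \<otimes> s = s \<otimes> g}.
      trace_on scale (S g) (\<psi> s g))"
    by (rule sum.mono_neutral_cong_right) (use fin in \<open>auto split: if_splits\<close>)
  finally show ?dim using char by simp
qed

lemma dim_eq_of_bij:
  assumes D: "subspace D" and f: "lin_on scale D f" "inj_on f D"
    and E: "f ` D = E" "findim scale E"
  shows "findim scale D" "dim D = dim E"
proof -
  have f0: "f x = 0 \<Longrightarrow> x \<in> D \<Longrightarrow> x = 0" for x
    using inj_onD[OF f(2), of x 0] lin_on_zero[OF D f(1)] subspace_0[OF D] by simp
  have indep: "independent (f ` B)" if B: "B \<subseteq> D" "independent B" "finite B" for B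
  proof (rule independent_if_scalars_zero)
    show "finite (f ` B)" using B by simp
    fix u v assume sum0: "(\<Sum>v\<in>f ` B. scale (u v) v) = 0" and v: "v \<in> f ` B"
    have "f (\<Sum>b\<in>B. scale (u (f b)) b) = (\<Sum>b\<in>B. scale (u (f b)) (f b))"
      by (rule lin_on_sum_scale[OF D f(1)]) (use B in auto)
    also have "\<dots> = 0"
      using sum0 sum.reindex[OF inj_on_subset[OF f(2) B(1)], of "\<lambda>v. scale (u v) v"] by simp
    finally have "(\<Sum>b\<in>B. scale (u (f b)) b) = 0"
      by (rule f0) (use B(1) D in \<open>intro subspace_sum subspace_scale; blast\<close>)
    moreover obtain b where "b \<in> B" "v = f b" using v by blast
    ultimately show "u v = 0"
      using independentD[where u = "\<lambda>b. u (f b)", OF B(2,3) subset_refl] by blast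
  qed
  obtain B where B: "B \<subseteq> D" "independent B" "D \<subseteq> span B"
    using maximal_independent_subset[of D] by blast
  have "finite B"
  proof (rule ccontr)
    assume "infinite B"
    obtain F where F: "finite F" "span F = E" using E(2) unfolding findim_def by blast
    obtain B' where B': "B' \<subseteq> B" "finite B'" "card B' = Suc (card F)"
      using infinite_arbitrarily_large[OF \<open>infinite B\<close>] by blast
    have "independent (f ` B')" using indep[of B'] B' B(1,2) independent_mono by blast
    then have "card (f ` B') \<le> card F"
      using independent_span_bound[OF F(1), of "f ` B'"] B' B(1) E(1) F(2) by blast
    moreover have "card (f ` B') = card B'"
      using card_image inj_on_subset[OF f(2)] B'(1) B(1) by (metis subset_trans)
    ultimately show False using B'(3) by simp
  qed
  moreover have spanB: "span B = D" using B D span_minimal by blast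
  ultimately show "findim scale D" unfolding findim_def by blast
  have "span (f ` B) = E"
  proof (intro subset_antisym span_minimal)
    show "f ` B \<subseteq> E" using B(1) E(1) by blast
    show "subspace E" using E(2) unfolding findim_def by (metis subspace_span)
    show "E \<subseteq> span (f ` B)"
    proof
      fix y assume "y \<in> E"
      then obtain x where x: "x \<in> D" "y = f x" using E(1) by blast
      have "f x = f (\<Sum>b\<in>B. scale (representation B x b) b)"
        using sum_representation_eq[OF B(2) _ \<open>finite B\<close> subset_refl, of x] x spanB by simp
      also have "\<dots> = (\<Sum>b\<in>B. scale (representation B x b) (f b))"
        by (rule lin_on_sum_scale[OF D f(1) \<open>finite B\<close>]) (use B in auto)
      finally show "y \<in> span (f ` B)"
        using x by (auto intro!: span_sum span_scale intro: span_base)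
    qed
  qed
  then have "dim E = card (f ` B)"
    using indep[OF B(1,2) \<open>finite B\<close>] dim_span_eq_card_independent by metis
  also have "\<dots> = card B" using card_image inj_on_subset[OF f(2) B(1)] by blast
  finally show "dim D = dim E" using spanB dim_span_eq_card_independent[OF B(2)] by simp
qed

end

section \<open>The calculus of typed 2-cells\<close>

text \<open>
  The hom-spaces of a \<open>lin2cat\<close> may overlap, so a bare 2-cell determines neither its source nor its target.
  Recording them with the cell makes source and target of a composite computable, and the typing
  conditions of all laws become goals for the simplifier.
\<close>

datatype ('o, 'm) arr1 = Arr1 (src: 'o) (tgt: 'o) (mor: 'm)

datatype ('o, 'm, 'c) arr2 = Arr2 (dm: "('o, 'm) arr1") (cd: "('o, 'm) arr1") (cell: 'c)

lemma arr2_eqI: "dm a = dm b \<Longrightarrow> cd a = cd b \<Longrightarrow> cell a = cell b \<Longrightarrow> a = b"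
  by (cases a; cases b) simp

lemma Arr2_collapse [simp]: "dm a = f \<Longrightarrow> cd a = f' \<Longrightarrow> Arr2 f f' (cell a) = a"
  by (cases a) simp

context linear_2category
begin

definition wf1 :: "('o, 'm) arr1 \<Rightarrow> bool" where
  "wf1 f \<longleftrightarrow> src f \<in> Ob C \<and> tgt f \<in> Ob C \<and> mor f \<in> Mor C (src f) (tgt f)"

definition wf2 :: "('o, 'm, 'c) arr2 \<Rightarrow> bool" where
  "wf2 a \<longleftrightarrow> wf1 (dm a) \<and> wf1 (cd a) \<and> src (cd a) = src (dm a) \<and> tgt (cd a) = tgt (dm a) \<and>
     cell a \<in> Cell C (mor (dm a)) (mor (cd a))"

definition comp1 :: "('o, 'm) arr1 \<Rightarrow> ('o, 'm) arr1 \<Rightarrow> ('o, 'm) arr1" (infixr \<open>\<box>\<close> 78) where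
  "f \<box> g = Arr1 (src g) (tgt f) (mor f \<odot> mor g)"

definition id1 :: "'o \<Rightarrow> ('o, 'm) arr1" where
  "id1 A = Arr1 A A (idm C A)"

definition id2 :: "('o, 'm) arr1 \<Rightarrow> ('o, 'm, 'c) arr2" where
  "id2 f = Arr2 f f (\<iota> (mor f))"

definition vert :: "('o, 'm, 'c) arr2 \<Rightarrow> ('o, 'm, 'c) arr2 \<Rightarrow> ('o, 'm, 'c) arr2"
    (infixr \<open>\<bullet>\<close> 70) where
  "b \<bullet> a = Arr2 (dm a) (cd b) (cell b \<cdot> cell a)"

definition lwhisk :: "('o, 'm) arr1 \<Rightarrow> ('o, 'm, 'c) arr2 \<Rightarrow> ('o, 'm, 'c) arr2"
    (infixr \<open>\<rhd>\<close> 74) where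
  "f \<rhd> a = Arr2 (f \<box> dm a) (f \<box> cd a) (\<iota> (mor f) \<star> cell a)"

definition rwhisk :: "('o, 'm, 'c) arr2 \<Rightarrow> ('o, 'm) arr1 \<Rightarrow> ('o, 'm, 'c) arr2"
    (infixl \<open>\<lhd>\<close> 76) where
  "a \<lhd> f = Arr2 (dm a \<box> f) (cd a \<box> f) (cell a \<star> \<iota> (mor f))"

lemma sel1 [simp]:
  "src (f \<box> g) = src g" "tgt (f \<box> g) = tgt f" "src (id1 A) = A" "tgt (id1 A) = A"
  by (simp_all add: comp1_def id1_def)

lemma sel2 [simp]:
  "dm (id2 f) = f" "cd (id2 f) = f" "dm (b \<bullet> a) = dm a" "cd (b \<bullet> a) = cd b"
  "dm (f \<rhd> a) = f \<box> dm a" "cd (f \<rhd> a) = f \<box> cd a"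
  "dm (a \<lhd> f) = dm a \<box> f" "cd (a \<lhd> f) = cd a \<box> f"
  by (simp_all add: id2_def vert_def lwhisk_def rwhisk_def)

lemma mor_comp:
  "mor (f \<box> g) = mor f \<odot> mor g" "mor (id1 A) = idm C A"
  by (simp_all add: comp1_def id1_def)

lemma cell_comp:
  "cell (id2 f) = \<iota> (mor f)" "cell (b \<bullet> a) = cell b \<cdot> cell a"
  "cell (f \<rhd> a) = \<iota> (mor f) \<star> cell a" "cell (a \<lhd> f) = cell a \<star> \<iota> (mor f)"
  by (simp_all add: id2_def vert_def lwhisk_def rwhisk_def)

lemma wf1D: "wf1 f \<Longrightarrow> src f \<in> Ob C" "wf1 f \<Longrightarrow> tgt f \<in> Ob C"
  "wf1 f \<Longrightarrow> mor f \<in> Mor C (src f) (tgt f)"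
  by (simp_all add: wf1_def)

lemma wf2D:
  "wf2 a \<Longrightarrow> wf1 (dm a)" "wf2 a \<Longrightarrow> wf1 (cd a)"
  "wf2 a \<Longrightarrow> src (cd a) = src (dm a)" "wf2 a \<Longrightarrow> tgt (cd a) = tgt (dm a)"
  unfolding wf2_def by blast+

lemma wf2D': "wf2 a \<Longrightarrow> cell a \<in> Cell C (mor (dm a)) (mor (cd a))"
  unfolding wf2_def by blast

lemma wf_id1 [simp]: "A \<in> Ob C \<Longrightarrow> wf1 (id1 A)"
  by (simp add: wf1_def mor_comp idm_closed)

lemma wf_comp1 [simp]: "wf1 f \<Longrightarrow> wf1 g \<Longrightarrow> tgt g = src f \<Longrightarrow> wf1 (f \<box> g)"
  by (auto simp: wf1_def mor_comp intro: cmp_closed)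

text \<open>
  The rewrite rules of this section bring every composite into one normal form: 1-morphisms and vertical
  composites are bracketed to the right, and whiskerings are pushed inwards until they reach the
  generating cells, as in \<open>f \<rhd> a \<lhd> g\<close>. What remains for explicit steps is the exchange law.
\<close>

lemma comp1_assoc [simp]:
  "wf1 f \<Longrightarrow> wf1 g \<Longrightarrow> wf1 h \<Longrightarrow> tgt g = src f \<Longrightarrow> tgt h = src g \<Longrightarrow> (f \<box> g) \<box> h = f \<box> g \<box> h"
  by (auto simp: comp1_def wf1_def intro!: cmp_assoc[where A = "src h" and B = "src g" and D = "src f" and E = "tgt f"])

lemma comp1_id [simp]:
  assumes "wf1 f"
  shows "A = tgt f \<Longrightarrow> id1 A \<box> f = f" "A = src f \<Longrightarrow> f \<box> id1 A = f"
proof -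
  have "idm C (tgt f) \<odot> mor f = mor f" "mor f \<odot> idm C (src f) = mor f"
    using cmp_id_left cmp_id_right assms unfolding wf1_def by blast+
  then show "A = tgt f \<Longrightarrow> id1 A \<box> f = f" "A = src f \<Longrightarrow> f \<box> id1 A = f"
    by (simp_all add: comp1_def id1_def)
qed

lemma idc_mor:
  "src f \<in> Ob C \<Longrightarrow> tgt f \<in> Ob C \<Longrightarrow> mor f \<in> Mor C (src f) (tgt f)
    \<Longrightarrow> \<iota> (mor f) \<in> Cell C (mor f) (mor f)"
  by (rule idc_closed)

lemma wf_id2 [simp]: "wf1 f \<Longrightarrow> wf2 (id2 f)"
  unfolding wf2_def by (auto simp: wf1_def cell_comp intro: idc_mor)

lemma wf_vert [simp]: "wf2 b \<Longrightarrow> wf2 a \<Longrightarrow> cd a = dm b \<Longrightarrow> wf2 (b \<bullet> a)"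
  unfolding wf2_def wf1_def by (auto simp: cell_comp intro: vcmp_closed)

lemma wf_lwhisk [simp]: "wf1 f \<Longrightarrow> wf2 a \<Longrightarrow> tgt (dm a) = src f \<Longrightarrow> wf2 (f \<rhd> a)"
  unfolding wf2_def
  by (auto simp: cell_comp mor_comp wf1D intro!: hcmp_closed[of "src (dm a)" "src f" "tgt f"] idc_mor)
    (auto simp: wf1_def intro: idc_mor)

lemma wf_rwhisk [simp]: "wf1 f \<Longrightarrow> wf2 a \<Longrightarrow> src (dm a) = tgt f \<Longrightarrow> wf2 (a \<lhd> f)"
  unfolding wf2_def
  by (auto simp: cell_comp mor_comp wf1D intro!: hcmp_closed[of "src f" "tgt f" "tgt (dm a)"] idc_mor)
    (auto simp: wf1_def intro: idc_mor)

lemma vert_assoc [simp]: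
  "wf2 c \<Longrightarrow> wf2 b \<Longrightarrow> wf2 a \<Longrightarrow> cd b = dm c \<Longrightarrow> cd a = dm b \<Longrightarrow> (c \<bullet> b) \<bullet> a = c \<bullet> b \<bullet> a"
  unfolding vert_def wf2_def wf1_def
  by (auto intro!: vcmp_assoc[where A = "src (dm a)" and B = "tgt (dm a)" and F = "mor (dm a)"
      and F' = "mor (dm b)" and F'' = "mor (dm c)" and F''' = "mor (cd c)"])

lemma vert_id [simp]:
  "wf2 a \<Longrightarrow> f = cd a \<Longrightarrow> id2 f \<bullet> a = a" "wf2 a \<Longrightarrow> f = dm a \<Longrightarrow> a \<bullet> id2 f = a"
  by (rule arr2_eqI;
      auto simp: wf2_def wf1_def cell_comp
        intro!: vcmp_id_left[where A = "src (dm a)" and B = "tgt (dm a)" and F = "mor (dm a)"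
            and F' = "mor (cd a)"]
          vcmp_id_right[where A = "src (dm a)" and B = "tgt (dm a)" and F = "mor (dm a)"
            and F' = "mor (cd a)"])+

lemma lwhisk_vert [simp]:
  assumes "wf1 f" "wf2 b" "wf2 a" "cd a = dm b" "tgt (dm a) = src f"
  shows "f \<rhd> (b \<bullet> a) = (f \<rhd> b) \<bullet> (f \<rhd> a)"
proof (rule arr2_eqI)
  have id: "\<iota> (mor f) \<cdot> \<iota> (mor f) = \<iota> (mor f)"
    using assms(1) vcmp_id_left idc_closed unfolding wf1_def by blast
  have "(\<iota> (mor f) \<cdot> \<iota> (mor f)) \<star> (cell b \<cdot> cell a)
      = (\<iota> (mor f) \<star> cell b) \<cdot> (\<iota> (mor f) \<star> cell a)"
    by (rule interchange[where A = "src (dm a)" and B = "src f" and D = "tgt f"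
        and F = "mor (dm a)" and F' = "mor (dm b)" and F'' = "mor (cd b)"
        and G = "mor f" and G' = "mor f" and G'' = "mor f"])
      (use assms in \<open>auto simp: wf1_def wf2_def intro: idc_mor\<close>)
  then show "cell (f \<rhd> (b \<bullet> a)) = cell ((f \<rhd> b) \<bullet> (f \<rhd> a))"
    using id by (simp add: cell_comp)
qed simp_all

lemma rwhisk_vert [simp]:
  assumes "wf1 f" "wf2 b" "wf2 a" "cd a = dm b" "src (dm a) = tgt f"
  shows "(b \<bullet> a) \<lhd> f = (b \<lhd> f) \<bullet> (a \<lhd> f)"
proof (rule arr2_eqI)
  have id: "\<iota> (mor f) \<cdot> \<iota> (mor f) = \<iota> (mor f)"
    using assms(1) vcmp_id_left idc_closed unfolding wf1_def by blast
  have "(cell b \<cdot> cell a) \<star> (\<iota> (mor f) \<cdot> \<iota> (mor f))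
      = (cell b \<star> \<iota> (mor f)) \<cdot> (cell a \<star> \<iota> (mor f))"
    by (rule interchange[where A = "src f" and B = "tgt f" and D = "tgt (dm a)"
        and G = "mor (dm a)" and G' = "mor (dm b)" and G'' = "mor (cd b)"
        and F = "mor f" and F' = "mor f" and F'' = "mor f"])
      (use assms in \<open>auto simp: wf1_def wf2_def intro: idc_mor\<close>)
  then show "cell ((b \<bullet> a) \<lhd> f) = cell ((b \<lhd> f) \<bullet> (a \<lhd> f))"
    using id by (simp add: cell_comp)
qed simp_all

lemma whisk_id2 [simp]:
  "wf1 f \<Longrightarrow> wf1 g \<Longrightarrow> tgt g = src f \<Longrightarrow> f \<rhd> id2 g = id2 (f \<box> g)"
  "wf1 f \<Longrightarrow> wf1 g \<Longrightarrow> tgt g = src f \<Longrightarrow> id2 f \<lhd> g = id2 (f \<box> g)"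
  by (rule arr2_eqI; auto simp: cell_comp mor_comp wf1_def intro: hcmp_idc)+

lemma lwhisk_comp [simp]:
  assumes "wf1 f" "wf1 g" "wf2 a" "tgt g = src f" "tgt (dm a) = src g"
  shows "(f \<box> g) \<rhd> a = f \<rhd> g \<rhd> a"
proof (rule arr2_eqI)
  have "\<iota> (mor f \<odot> mor g) = \<iota> (mor f) \<star> \<iota> (mor g)"
    using hcmp_idc[of "src g" "src f" "tgt f" "mor g" "mor f"] assms by (simp add: wf1_def)
  moreover have "(\<iota> (mor f) \<star> \<iota> (mor g)) \<star> cell a = \<iota> (mor f) \<star> (\<iota> (mor g) \<star> cell a)"
    by (rule hcmp_assoc[where A = "src (dm a)" and B = "src g" and D = "src f" and E = "tgt f"
        and F = "mor (dm a)" and F' = "mor (cd a)" and G = "mor g" and G' = "mor g" and H = "mor f" and H' = "mor f"])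
      (use assms in \<open>auto simp: wf1_def wf2_def intro: idc_mor\<close>)
  ultimately show "cell ((f \<box> g) \<rhd> a) = cell (f \<rhd> g \<rhd> a)" by (simp add: cell_comp mor_comp)
qed (use assms in \<open>simp_all add: wf2_def\<close>)

lemma rwhisk_comp [simp]:
  assumes "wf1 f" "wf1 g" "wf2 a" "tgt g = src f" "src (dm a) = tgt f"
  shows "a \<lhd> (f \<box> g) = a \<lhd> f \<lhd> g"
proof (rule arr2_eqI)
  have "\<iota> (mor f \<odot> mor g) = \<iota> (mor f) \<star> \<iota> (mor g)"
    using hcmp_idc[of "src g" "src f" "tgt f" "mor g" "mor f"] assms by (simp add: wf1_def)
  moreover have "(cell a \<star> \<iota> (mor f)) \<star> \<iota> (mor g) = cell a \<star> (\<iota> (mor f) \<star> \<iota> (mor g))"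
    by (rule hcmp_assoc[where A = "src g" and B = "tgt g" and D = "tgt f" and E = "tgt (dm a)"
        and F = "mor g" and F' = "mor g" and G = "mor f" and G' = "mor f" and H = "mor (dm a)" and H' = "mor (cd a)"])
      (use assms in \<open>auto simp: wf1_def wf2_def intro: idc_mor\<close>)
  ultimately show "cell (a \<lhd> (f \<box> g)) = cell (a \<lhd> f \<lhd> g)" by (simp add: cell_comp mor_comp)
qed (use assms in \<open>simp_all add: wf2_def\<close>)

lemma lwhisk_rwhisk [simp]:
  assumes "wf1 f" "wf1 g" "wf2 a" "tgt g = src (dm a)" "tgt (dm a) = src f"
  shows "(f \<rhd> a) \<lhd> g = f \<rhd> a \<lhd> g"
proof (rule arr2_eqI)
  have "(\<iota> (mor f) \<star> cell a) \<star> \<iota> (mor g) = \<iota> (mor f) \<star> (cell a \<star> \<iota> (mor g))"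
    by (rule hcmp_assoc[where A = "src g" and B = "src (dm a)" and D = "src f" and E = "tgt f"
        and F = "mor g" and F' = "mor g" and G = "mor (dm a)" and G' = "mor (cd a)" and H = "mor f" and H' = "mor f"])
      (use assms in \<open>auto simp: wf1_def wf2_def intro: idc_mor\<close>)
  then show "cell ((f \<rhd> a) \<lhd> g) = cell (f \<rhd> a \<lhd> g)" by (simp add: cell_comp mor_comp)
qed (use assms in \<open>simp_all add: wf2_def\<close>)

lemma whisk_unit [simp]:
  "wf2 a \<Longrightarrow> A = tgt (dm a) \<Longrightarrow> id1 A \<rhd> a = a" "wf2 a \<Longrightarrow> A = src (dm a) \<Longrightarrow> a \<lhd> id1 A = a"
  by (rule arr2_eqI;
      auto simp: wf2_def wf1_def cell_comp mor_comp
        intro!: hcmp_id_left[where A = "src (dm a)" and B = "tgt (dm a)" and F = "mor (dm a)"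
            and F' = "mor (cd a)"]
          hcmp_id_right[where A = "src (dm a)" and B = "tgt (dm a)" and F = "mor (dm a)"
            and F' = "mor (cd a)"] comp1_id)+

text \<open>
  Both sides are the horizontal composite of \<open>b\<close> and \<open>a\<close>, once with \<open>a\<close> and once with \<open>b\<close> performed first.
\<close>

lemma exchange:
  assumes "wf2 a" "wf2 b" "src (dm b) = tgt (dm a)"
  shows "(b \<lhd> cd a) \<bullet> (dm b \<rhd> a) = (cd b \<rhd> a) \<bullet> (b \<lhd> dm a)"
proof (rule arr2_eqI)
  note [simp] = assms
  have "cell (id2 (cd a) \<bullet> a) = cell a" "cell (a \<bullet> id2 (dm a)) = cell a"
      "cell (id2 (cd b) \<bullet> b) = cell b" "cell (b \<bullet> id2 (dm b)) = cell b"
    by simp_all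
  then have id: "\<iota> (mor (cd a)) \<cdot> cell a = cell a" "cell a \<cdot> \<iota> (mor (dm a)) = cell a"
      "\<iota> (mor (cd b)) \<cdot> cell b = cell b" "cell b \<cdot> \<iota> (mor (dm b)) = cell b"
    unfolding cell_comp .
  have "(cell b \<cdot> \<iota> (mor (dm b))) \<star> (\<iota> (mor (cd a)) \<cdot> cell a)
      = (cell b \<star> \<iota> (mor (cd a))) \<cdot> (\<iota> (mor (dm b)) \<star> cell a)"
    by (rule interchange[where A = "src (dm a)" and B = "tgt (dm a)" and D = "tgt (dm b)"
        and F = "mor (dm a)" and F' = "mor (cd a)" and F'' = "mor (cd a)"
        and G = "mor (dm b)" and G' = "mor (dm b)" and G'' = "mor (cd b)"])
      (use assms in \<open>auto simp: wf1_def wf2_def intro: idc_mor\<close>)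
  moreover have "(\<iota> (mor (cd b)) \<cdot> cell b) \<star> (cell a \<cdot> \<iota> (mor (dm a)))
      = (\<iota> (mor (cd b)) \<star> cell a) \<cdot> (cell b \<star> \<iota> (mor (dm a)))"
    by (rule interchange[where A = "src (dm a)" and B = "tgt (dm a)" and D = "tgt (dm b)"
        and F = "mor (dm a)" and F' = "mor (dm a)" and F'' = "mor (cd a)"
        and G = "mor (dm b)" and G' = "mor (cd b)" and G'' = "mor (cd b)"])
      (use assms in \<open>auto simp: wf1_def wf2_def intro: idc_mor\<close>)
  ultimately show "cell ((b \<lhd> cd a) \<bullet> (dm b \<rhd> a)) = cell ((cd b \<rhd> a) \<bullet> (b \<lhd> dm a))"
    using id by (simp add: cell_comp)
qed (use assms in \<open>simp_all add: wf2_def\<close>)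

declare wf2D [simp]

definition isoc :: "('o, 'm, 'c) arr2 \<Rightarrow> bool" where
  "isoc a \<longleftrightarrow> wf2 a \<and> (\<exists>b. wf2 b \<and> dm b = cd a \<and> cd b = dm a \<and> b \<bullet> a = id2 (dm a) \<and> a \<bullet> b = id2 (cd a))"

definition Inv :: "('o, 'm, 'c) arr2 \<Rightarrow> ('o, 'm, 'c) arr2" where
  "Inv a = Arr2 (cd a) (dm a) (inv2 C (mor (dm a)) (mor (cd a)) (cell a))"

lemma sel_Inv [simp]: "dm (Inv a) = cd a" "cd (Inv a) = dm a"
  by (simp_all add: Inv_def)

lemma isoc_wf [simp]: "isoc a \<Longrightarrow> wf2 a"
  by (simp add: isoc_def)

lemma InvI:
  assumes wf: "wf2 a" "wf2 b" and "dm b = cd a" "cd b = dm a" "b \<bullet> a = id2 (dm a)" "a \<bullet> b = id2 (cd a)"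
  shows "isoc a" "Inv a = b"
proof -
  show "isoc a" using assms unfolding isoc_def by blast
  have eqs: "cell b \<cdot> cell a = \<iota> (mor (dm a))" "cell a \<cdot> cell b = \<iota> (mor (cd a))"
    using arg_cong[OF assms(5), of cell] arg_cong[OF assms(6), of cell] by (simp_all add: cell_comp)
  have "inv2 C (mor (dm a)) (mor (cd a)) (cell a) = cell b"
    unfolding inv2_def
  proof (rule the_equality)
    show "cell b \<in> Cell C (mor (cd a)) (mor (dm a)) \<and> cell b \<cdot> cell a = \<iota> (mor (dm a)) \<and>
        cell a \<cdot> cell b = \<iota> (mor (cd a))"
      using wf2D'[OF wf(2)] assms eqs by simp
    fix \<beta> assume \<beta>: "\<beta> \<in> Cell C (mor (cd a)) (mor (dm a)) \<and> \<beta> \<cdot> cell a = \<iota> (mor (dm a)) \<and>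
        cell a \<cdot> \<beta> = \<iota> (mor (cd a))"
    let ?b = "Arr2 (cd a) (dm a) \<beta>"
    have wfb: "wf2 ?b" using wf \<beta> by (simp add: wf2_def[of ?b])
    have "?b \<bullet> a = id2 (dm a)" using \<beta> by (intro arr2_eqI) (simp_all add: cell_comp)
    then have "(?b \<bullet> a) \<bullet> b = b" using assms by simp
    moreover have "(?b \<bullet> a) \<bullet> b = ?b" using assms wfb by simp
    ultimately have "?b = b" by simp
    from arg_cong[OF this, of cell] show "\<beta> = cell b" by simp
  qed
  then show "Inv a = b" unfolding Inv_def using assms by (intro arr2_eqI) simp_all
qed

lemma Inv_props [simp]:
  assumes "isoc a"
  shows "wf2 (Inv a)" "Inv a \<bullet> a = id2 (dm a)" "a \<bullet> Inv a = id2 (cd a)" "isoc (Inv a)" "Inv (Inv a) = a"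
proof -
  obtain b where b: "wf2 b" "dm b = cd a" "cd b = dm a" "b \<bullet> a = id2 (dm a)" "a \<bullet> b = id2 (cd a)"
    using assms unfolding isoc_def by blast
  have "Inv a = b" using InvI(2)[of a b] assms b by simp
  then show "wf2 (Inv a)" "Inv a \<bullet> a = id2 (dm a)" "a \<bullet> Inv a = id2 (cd a)" "isoc (Inv a)"
    "Inv (Inv a) = a"
    using b assms InvI[of b a] by simp_all
qed

lemma Inv_cancel [simp]:
  "isoc a \<Longrightarrow> wf2 x \<Longrightarrow> cd x = dm a \<Longrightarrow> Inv a \<bullet> a \<bullet> x = x"
  "isoc a \<Longrightarrow> wf2 x \<Longrightarrow> cd x = cd a \<Longrightarrow> a \<bullet> Inv a \<bullet> x = x"
  by (simp_all add: vert_assoc[symmetric] del: vert_assoc)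

lemma isoc_id2 [simp]: "wf1 f \<Longrightarrow> isoc (id2 f)" "wf1 f \<Longrightarrow> Inv (id2 f) = id2 f"
  by (auto intro: InvI[of _ "id2 f"])

lemma isoc_vert [simp]:
  assumes "isoc b" "isoc a" "cd a = dm b"
  shows "isoc (b \<bullet> a)" "Inv (b \<bullet> a) = Inv a \<bullet> Inv b"
  by (rule InvI[of _ "Inv a \<bullet> Inv b"]; use assms in simp)+

lemma isoc_lwhisk [simp]:
  assumes "isoc a" "wf1 f" "tgt (dm a) = src f"
  shows "isoc (f \<rhd> a)" "Inv (f \<rhd> a) = f \<rhd> Inv a"
  by (rule InvI[of _ "f \<rhd> Inv a"]; use assms in \<open>simp add: lwhisk_vert[symmetric] del: lwhisk_vert\<close>)+

lemma isoc_rwhisk [simp]: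
  assumes "isoc a" "wf1 f" "src (dm a) = tgt f"
  shows "isoc (a \<lhd> f)" "Inv (a \<lhd> f) = Inv a \<lhd> f"
  by (rule InvI[of _ "Inv a \<lhd> f"]; use assms in \<open>simp add: rwhisk_vert[symmetric] del: rwhisk_vert\<close>)+

lemma vert_left_cancel:
  assumes "isoc a" "wf2 x" "wf2 y" "cd x = dm a" "cd y = dm a" "a \<bullet> x = a \<bullet> y"
  shows "x = y"
  using assms by (metis Inv_cancel(1))

lemma vert_right_cancel:
  assumes "isoc a" "wf2 x" "wf2 y" "dm x = cd a" "dm y = cd a" "x \<bullet> a = y \<bullet> a"
  shows "x = y"
proof -
  have "(x \<bullet> a) \<bullet> Inv a = (y \<bullet> a) \<bullet> Inv a" using assms(6) by simp
  then show ?thesis using assms(1-5) by simp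
qed

lemma whisk_Inv_cancel [simp]:
  "isoc a \<Longrightarrow> wf1 f \<Longrightarrow> tgt (dm a) = src f \<Longrightarrow> (f \<rhd> Inv a) \<bullet> (f \<rhd> a) = id2 (f \<box> dm a)"
  "isoc a \<Longrightarrow> wf1 f \<Longrightarrow> tgt (dm a) = src f \<Longrightarrow> (f \<rhd> a) \<bullet> (f \<rhd> Inv a) = id2 (f \<box> cd a)"
  "isoc a \<Longrightarrow> wf1 f \<Longrightarrow> src (dm a) = tgt f \<Longrightarrow> (Inv a \<lhd> f) \<bullet> (a \<lhd> f) = id2 (dm a \<box> f)"
  "isoc a \<Longrightarrow> wf1 f \<Longrightarrow> src (dm a) = tgt f \<Longrightarrow> (a \<lhd> f) \<bullet> (Inv a \<lhd> f) = id2 (cd a \<box> f)"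
  by (simp_all add: lwhisk_vert[symmetric] rwhisk_vert[symmetric] del: lwhisk_vert rwhisk_vert)

lemma whisk_Inv_cancel' [simp]:
  "isoc a \<Longrightarrow> wf1 f \<Longrightarrow> tgt (dm a) = src f \<Longrightarrow> wf2 x \<Longrightarrow> cd x = f \<box> dm a \<Longrightarrow> (f \<rhd> Inv a) \<bullet> (f \<rhd> a) \<bullet> x = x"
  "isoc a \<Longrightarrow> wf1 f \<Longrightarrow> tgt (dm a) = src f \<Longrightarrow> wf2 x \<Longrightarrow> cd x = f \<box> cd a \<Longrightarrow> (f \<rhd> a) \<bullet> (f \<rhd> Inv a) \<bullet> x = x"
  "isoc a \<Longrightarrow> wf1 f \<Longrightarrow> src (dm a) = tgt f \<Longrightarrow> wf2 x \<Longrightarrow> cd x = dm a \<box> f \<Longrightarrow> (Inv a \<lhd> f) \<bullet> (a \<lhd> f) \<bullet> x = x"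
  "isoc a \<Longrightarrow> wf1 f \<Longrightarrow> src (dm a) = tgt f \<Longrightarrow> wf2 x \<Longrightarrow> cd x = cd a \<box> f \<Longrightarrow> (a \<lhd> f) \<bullet> (Inv a \<lhd> f) \<bullet> x = x"
  by (simp_all add: vert_assoc[symmetric] del: vert_assoc)

lemma cell_eq: "a = b \<Longrightarrow> cell a = cell b"
  by simp

lemma isoc_iff_iso2:
  assumes "wf1 (dm a)" "wf1 (cd a)" "src (cd a) = src (dm a)" "tgt (cd a) = tgt (dm a)"
  shows "isoc a \<longleftrightarrow> iso2 C (mor (dm a)) (mor (cd a)) (cell a)"
proof
  assume "isoc a"
  then obtain b where "wf2 b" "dm b = cd a" "cd b = dm a" "b \<bullet> a = id2 (dm a)" "a \<bullet> b = id2 (cd a)"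
    and "wf2 a"
    unfolding isoc_def by blast
  then have "cell a \<in> Cell C (mor (dm a)) (mor (cd a))" "cell b \<in> Cell C (mor (cd a)) (mor (dm a))"
    and "cell (b \<bullet> a) = cell (id2 (dm a))" "cell (a \<bullet> b) = cell (id2 (cd a))"
    using wf2D'[of a] wf2D'[of b] by metis+
  then show "iso2 C (mor (dm a)) (mor (cd a)) (cell a)"
    unfolding iso2_def cell_comp by blast
next
  assume iso: "iso2 C (mor (dm a)) (mor (cd a)) (cell a)"
  then obtain \<beta> where \<beta>: "\<beta> \<in> Cell C (mor (cd a)) (mor (dm a))" "\<beta> \<cdot> cell a = \<iota> (mor (dm a))"
    "cell a \<cdot> \<beta> = \<iota> (mor (cd a))" unfolding iso2_def by blast
  have "wf2 a" using iso assms unfolding wf2_def iso2_def by blast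
  moreover have "wf2 (Arr2 (cd a) (dm a) \<beta>)"
    using assms \<beta>(1) by (simp add: wf2_def[of "Arr2 (cd a) (dm a) \<beta>"])
  ultimately show "isoc a" using \<beta>
    by (intro InvI[of a "Arr2 (cd a) (dm a) \<beta>"]) (auto intro!: arr2_eqI simp: cell_comp)
qed

lemma id_id:
  assumes "W \<in> Ob C"
  shows "idm C W \<odot> idm C W = idm C W" "\<iota> (idm C W) \<cdot> \<iota> (idm C W) = \<iota> (idm C W)"
    "\<iota> (idm C W) \<star> \<iota> (idm C W) = \<iota> (idm C W)"
proof -
  have i: "idm C W \<in> Mor C W W" "\<iota> (idm C W) \<in> Cell C (idm C W) (idm C W)"
    using assms idm_closed idc_closed by auto
  show "idm C W \<odot> idm C W = idm C W" using cmp_id_left assms i by blast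
  show "\<iota> (idm C W) \<cdot> \<iota> (idm C W) = \<iota> (idm C W)" using vcmp_id_left assms i by blast
  show "\<iota> (idm C W) \<star> \<iota> (idm C W) = \<iota> (idm C W)" using hcmp_id_left assms i by blast
qed

lemma iso2_id: "W \<in> Ob C \<Longrightarrow> iso2 C (idm C W) (idm C W) (\<iota> (idm C W))"
  using isoc_iff_iso2[of "id2 (id1 W)"] by (simp add: cell_comp mor_comp)

lemma inv2_id: "W \<in> Ob C \<Longrightarrow> inv2 C (idm C W) (idm C W) (\<iota> (idm C W)) = \<iota> (idm C W)"
  using arg_cong[OF isoc_id2(2)[of "id1 W"], of cell] by (simp add: Inv_def cell_comp mor_comp)

lemma mor_id_right: "wf1 F \<Longrightarrow> src F = W \<Longrightarrow> mor F \<odot> idm C W = mor F"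
  using comp1_id(2)[of F W] by (metis mor_comp)

lemma cell_id_right: "wf2 a \<Longrightarrow> src (dm a) = W \<Longrightarrow> cell a \<star> \<iota> (idm C W) = cell a"
  using whisk_unit(2)[of a W] by (metis cell_comp(4) mor_comp(2))

definition triv_rep :: "'o \<Rightarrow> ('g, 'm, 'c) rep2" where
  "triv_rep W = \<lparr>act = \<lambda>_. idm C W, mulc = \<lambda>_ _. \<iota> (idm C W), unitc = \<iota> (idm C W)\<rparr>"

lemma act_triv_rep [simp]: "act (triv_rep W) g = idm C W" "mulc (triv_rep W) g h = \<iota> (idm C W)"
  "unitc (triv_rep W) = \<iota> (idm C W)"
  by (simp_all add: triv_rep_def)

section \<open>Finite direct sums of 1-morphisms\<close>

definition parallel :: "('o, 'm) arr1 \<Rightarrow> ('o, 'm) arr1 \<Rightarrow> bool" where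
  "parallel f f' \<longleftrightarrow> wf1 f \<and> wf1 f' \<and> src f' = src f \<and> tgt f' = tgt f"

definition hom2 :: "('o, 'm) arr1 \<Rightarrow> ('o, 'm) arr1 \<Rightarrow> ('o, 'm, 'c) arr2 set" where
  "hom2 f f' = {a. wf2 a \<and> dm a = f \<and> cd a = f'}"

lemma hom2D: "a \<in> hom2 f f' \<Longrightarrow> wf2 a" "a \<in> hom2 f f' \<Longrightarrow> dm a = f" "a \<in> hom2 f f' \<Longrightarrow> cd a = f'"
  by (simp_all add: hom2_def)

lemma hom2I: "wf2 a \<Longrightarrow> dm a = f \<Longrightarrow> cd a = f' \<Longrightarrow> a \<in> hom2 f f'"
  by (simp add: hom2_def)

lemma hom2_parallel: "a \<in> hom2 f f' \<Longrightarrow> parallel f f'"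
  unfolding hom2_def parallel_def by auto

lemma Arr2_hom2: "parallel f f' \<Longrightarrow> Arr2 f f' x \<in> hom2 f f' \<longleftrightarrow> x \<in> Cell C (mor f) (mor f')"
  unfolding hom2_def parallel_def by (simp add: wf2_def[of "Arr2 f f' x"])

lemma cell_hom2: "a \<in> hom2 f f' \<Longrightarrow> cell a \<in> Cell C (mor f) (mor f')"
  using wf2D'[of a] by (simp add: hom2_def)

lemma subspace_Cell: "parallel f f' \<Longrightarrow> subspace (Cell C (mor f) (mor f'))"
  unfolding parallel_def wf1_def by (auto intro!: cell_subspace[of "src f" "tgt f"])

lemma lin_vert_left:
  assumes "wf2 b" "parallel f (dm b)"
  shows "lin_on (smul C) (Cell C (mor f) (mor (dm b))) (\<lambda>x. cell b \<cdot> x)"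
proof -
  have b: "cell b \<in> Cell C (mor (dm b)) (mor (cd b))" and "src f \<in> Ob C" "tgt f \<in> Ob C"
    "mor f \<in> Mor C (src f) (tgt f)" "mor (dm b) \<in> Mor C (src f) (tgt f)" "mor (cd b) \<in> Mor C (src f) (tgt f)"
    using assms unfolding wf2_def parallel_def wf1_def by auto
  then show ?thesis
    unfolding lin_on_def using vcmp_add_right[of "src f" "tgt f" "mor f" "mor (dm b)" "mor (cd b)"]
      vcmp_scale_right[of "src f" "tgt f" "mor f" "mor (dm b)" "mor (cd b)"] by blast
qed

lemma lin_vert_right:
  assumes "wf2 a" "parallel (cd a) f"
  shows "lin_on (smul C) (Cell C (mor (cd a)) (mor f)) (\<lambda>x. x \<cdot> cell a)"
proof -
  have "cell a \<in> Cell C (mor (dm a)) (mor (cd a))" and "src f \<in> Ob C" "tgt f \<in> Ob C"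
    "mor f \<in> Mor C (src f) (tgt f)" "mor (dm a) \<in> Mor C (src f) (tgt f)" "mor (cd a) \<in> Mor C (src f) (tgt f)"
    using assms unfolding wf2_def parallel_def wf1_def by auto
  then show ?thesis
    unfolding lin_on_def using vcmp_add_left[of "src f" "tgt f" "mor (dm a)" "mor (cd a)" "mor f"]
      vcmp_scale_left[of "src f" "tgt f" "mor (dm a)" "mor (cd a)" "mor f"] by blast
qed

lemma lin_lwhisk:
  assumes "wf1 g" "parallel f f'" "tgt f = src g"
  shows "lin_on (smul C) (Cell C (mor f) (mor f')) (\<lambda>x. \<iota> (mor g) \<star> x)"
proof -
  have ob: "src f \<in> Ob C" "src g \<in> Ob C" "tgt g \<in> Ob C" "mor f \<in> Mor C (src f) (src g)"
    "mor f' \<in> Mor C (src f) (src g)" "mor g \<in> Mor C (src g) (tgt g)"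
    using assms unfolding parallel_def wf1_def by auto
  then have "\<iota> (mor g) \<in> Cell C (mor g) (mor g)" using idc_closed by blast
  with ob show ?thesis
    unfolding lin_on_def using hcmp_add_right[of "src f" "src g" "tgt g" "mor f" "mor f'" "mor g" "mor g"]
      hcmp_scale_right[of "src f" "src g" "tgt g" "mor f" "mor f'" "mor g" "mor g"] by blast
qed

lemma lin_rwhisk:
  assumes "wf1 g" "parallel f f'" "src f = tgt g"
  shows "lin_on (smul C) (Cell C (mor f) (mor f')) (\<lambda>x. x \<star> \<iota> (mor g))"
proof -
  have ob: "tgt f \<in> Ob C" "src g \<in> Ob C" "tgt g \<in> Ob C" "mor f \<in> Mor C (tgt g) (tgt f)"
    "mor f' \<in> Mor C (tgt g) (tgt f)" "mor g \<in> Mor C (src g) (tgt g)"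
    using assms unfolding parallel_def wf1_def by auto
  then have "\<iota> (mor g) \<in> Cell C (mor g) (mor g)" using idc_closed by blast
  with ob show ?thesis
    unfolding lin_on_def using hcmp_add_left[of "src g" "tgt g" "tgt f" "mor g" "mor g" "mor f" "mor f'"]
      hcmp_scale_left[of "src g" "tgt g" "tgt f" "mor g" "mor g" "mor f" "mor f'"] by blast
qed

definition sum2 :: "('o, 'm) arr1 \<Rightarrow> ('o, 'm) arr1 \<Rightarrow> 'i set \<Rightarrow> ('i \<Rightarrow> ('o, 'm, 'c) arr2) \<Rightarrow> ('o, 'm, 'c) arr2"
  where "sum2 f f' K x = Arr2 f f' (\<Sum>i\<in>K. cell (x i))"

definition zero2 :: "('o, 'm) arr1 \<Rightarrow> ('o, 'm) arr1 \<Rightarrow> ('o, 'm, 'c) arr2" where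
  "zero2 f f' = Arr2 f f' 0"

lemma sum2_sel [simp]: "dm (sum2 f f' K x) = f" "cd (sum2 f f' K x) = f'"
  "dm (zero2 f f') = f" "cd (zero2 f f') = f'"
  by (simp_all add: sum2_def zero2_def)

lemma sum2_hom2:
  assumes "parallel f f'" "\<And>i. i \<in> K \<Longrightarrow> x i \<in> hom2 f f'"
  shows "sum2 f f' K x \<in> hom2 f f'"
  unfolding sum2_def Arr2_hom2[OF assms(1)]
  by (intro subspace_sum[OF subspace_Cell[OF assms(1)]] cell_hom2 assms(2))

lemma sum2_cong: "(\<And>i. i \<in> K \<Longrightarrow> x i = y i) \<Longrightarrow> sum2 f f' K x = sum2 f f' K y"
  unfolding sum2_def by simp

lemma sum2_delta:
  assumes "finite K" "k \<in> K" "y \<in> hom2 f f'"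
  shows "sum2 f f' K (\<lambda>i. if i = k then y else zero2 f f') = y"
proof -
  have "(\<Sum>i\<in>K. cell (if i = k then y else zero2 f f')) = (\<Sum>i\<in>K. if i = k then cell y else 0)"
    by (rule sum.cong) (auto simp: zero2_def)
  then show ?thesis unfolding sum2_def using assms hom2D[OF assms(3)] by (intro arr2_eqI) simp_all
qed

lemma vert_sum2:
  assumes "finite K" "\<And>i. i \<in> K \<Longrightarrow> x i \<in> hom2 f f'" "parallel f f'" "wf2 b" "dm b = f'"
  shows "b \<bullet> sum2 f f' K x = sum2 f (cd b) K (\<lambda>i. b \<bullet> x i)"
proof (rule arr2_eqI)
  have "cell b \<cdot> (\<Sum>i\<in>K. cell (x i)) = (\<Sum>i\<in>K. cell b \<cdot> cell (x i))"
    by (rule lin_on_sum[OF subspace_Cell lin_vert_left]) (use assms(1,3-5) cell_hom2[OF assms(2)] in auto)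
  then show "cell (b \<bullet> sum2 f f' K x) = cell (sum2 f (cd b) K (\<lambda>i. b \<bullet> x i))"
    by (simp add: cell_comp sum2_def)
qed simp_all

lemma sum2_vert:
  assumes "finite K" "\<And>i. i \<in> K \<Longrightarrow> x i \<in> hom2 f f'" "parallel f f'" "wf2 a" "cd a = f"
  shows "sum2 f f' K x \<bullet> a = sum2 (dm a) f' K (\<lambda>i. x i \<bullet> a)"
proof (rule arr2_eqI)
  have "(\<Sum>i\<in>K. cell (x i)) \<cdot> cell a = (\<Sum>i\<in>K. cell (x i) \<cdot> cell a)"
    by (rule lin_on_sum[OF subspace_Cell lin_vert_right]) (use assms(1,3-5) cell_hom2[OF assms(2)] in auto)
  then show "cell (sum2 f f' K x \<bullet> a) = cell (sum2 (dm a) f' K (\<lambda>i. x i \<bullet> a))"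
    by (simp add: cell_comp sum2_def)
qed simp_all

lemma lwhisk_sum2:
  assumes "finite K" "\<And>i. i \<in> K \<Longrightarrow> x i \<in> hom2 f f'" "parallel f f'" "wf1 g" "tgt f = src g"
  shows "g \<rhd> sum2 f f' K x = sum2 (g \<box> f) (g \<box> f') K (\<lambda>i. g \<rhd> x i)"
proof (rule arr2_eqI)
  have "\<iota> (mor g) \<star> (\<Sum>i\<in>K. cell (x i)) = (\<Sum>i\<in>K. \<iota> (mor g) \<star> cell (x i))"
    by (rule lin_on_sum[OF subspace_Cell lin_lwhisk]) (use assms(1,3-5) cell_hom2[OF assms(2)] in auto)
  then show "cell (g \<rhd> sum2 f f' K x) = cell (sum2 (g \<box> f) (g \<box> f') K (\<lambda>i. g \<rhd> x i))"
    by (simp add: cell_comp sum2_def)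
qed simp_all

lemma rwhisk_sum2:
  assumes "finite K" "\<And>i. i \<in> K \<Longrightarrow> x i \<in> hom2 f f'" "parallel f f'" "wf1 g" "src f = tgt g"
  shows "sum2 f f' K x \<lhd> g = sum2 (f \<box> g) (f' \<box> g) K (\<lambda>i. x i \<lhd> g)"
proof (rule arr2_eqI)
  have "(\<Sum>i\<in>K. cell (x i)) \<star> \<iota> (mor g) = (\<Sum>i\<in>K. cell (x i) \<star> \<iota> (mor g))"
    by (rule lin_on_sum[OF subspace_Cell lin_rwhisk]) (use assms(1,3-5) cell_hom2[OF assms(2)] in auto)
  then show "cell (sum2 f f' K x \<lhd> g) = cell (sum2 (f \<box> g) (f' \<box> g) K (\<lambda>i. x i \<lhd> g))"
    by (simp add: cell_comp sum2_def)
qed simp_all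

lemma zero2_comp:
  assumes "parallel f f'"
  shows "wf2 b \<Longrightarrow> dm b = f' \<Longrightarrow> b \<bullet> zero2 f f' = zero2 f (cd b)"
    "wf2 a \<Longrightarrow> cd a = f \<Longrightarrow> zero2 f f' \<bullet> a = zero2 (dm a) f'"
    "wf1 g \<Longrightarrow> tgt f = src g \<Longrightarrow> g \<rhd> zero2 f f' = zero2 (g \<box> f) (g \<box> f')"
    "wf1 g \<Longrightarrow> src f = tgt g \<Longrightarrow> zero2 f f' \<lhd> g = zero2 (f \<box> g) (f' \<box> g)"
  using assms vert_sum2[where K = "{} :: nat set"] sum2_vert[where K = "{} :: nat set"]
    lwhisk_sum2[where K = "{} :: nat set"] rwhisk_sum2[where K = "{} :: nat set"]
  by (simp_all add: sum2_def zero2_def)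

text \<open>
  The summands \<open>f h\<close> with injections \<open>j h\<close> and projections \<open>p h\<close> are part of the structure: as they are
  defined by equations, whiskering carries a direct sum to a direct sum.
\<close>

definition is_biproduct where
  "is_biproduct K f A j p \<longleftrightarrow> finite K \<and> wf1 A \<and>
     (\<forall>h\<in>K. j h \<in> hom2 (f h) A \<and> p h \<in> hom2 A (f h)) \<and>
     (\<forall>h\<in>K. \<forall>k\<in>K. p k \<bullet> j h = (if h = k then id2 (f k) else zero2 (f h) (f k))) \<and>
     sum2 A A K (\<lambda>h. j h \<bullet> p h) = id2 A"

lemma is_biproductD:
  assumes "is_biproduct K f A j p"
  shows "finite K" "wf1 A" "\<And>h. h \<in> K \<Longrightarrow> j h \<in> hom2 (f h) A" "\<And>h. h \<in> K \<Longrightarrow> p h \<in> hom2 A (f h)"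
    "\<And>h k. h \<in> K \<Longrightarrow> k \<in> K \<Longrightarrow> p k \<bullet> j h = (if h = k then id2 (f k) else zero2 (f h) (f k))"
    "sum2 A A K (\<lambda>h. j h \<bullet> p h) = id2 A"
    "\<And>h. h \<in> K \<Longrightarrow> parallel (f h) A" "\<And>h. h \<in> K \<Longrightarrow> wf1 (f h)"
    "\<And>h. h \<in> K \<Longrightarrow> src (f h) = src A" "\<And>h. h \<in> K \<Longrightarrow> tgt (f h) = tgt A"
  using assms hom2_parallel unfolding is_biproduct_def by (blast | (simp add: parallel_def; metis parallel_def))+

lemma parallel_refl: "wf1 f \<Longrightarrow> parallel f f"
  by (simp add: parallel_def)

lemma parallel_trans: "parallel f g \<Longrightarrow> parallel g h \<Longrightarrow> parallel f h"
  by (simp add: parallel_def)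

lemma parallel_sym: "parallel f g \<Longrightarrow> parallel g f"
  by (simp add: parallel_def)

lemma vert_hom2: "b \<in> hom2 g h \<Longrightarrow> a \<in> hom2 f g \<Longrightarrow> b \<bullet> a \<in> hom2 f h"
  by (simp add: hom2_def)

lemma biproduct_expand:
  assumes bp: "is_biproduct K f A j p" and y: "y \<in> hom2 B A"
  shows "y = sum2 B A K (\<lambda>h. j h \<bullet> p h \<bullet> y)"
proof -
  note [simp] = is_biproductD(1,2)[OF bp] y[THEN hom2D(1)] y[THEN hom2D(2)] y[THEN hom2D(3)]
  have "y = sum2 A A K (\<lambda>h. j h \<bullet> p h) \<bullet> y" by (simp add: is_biproductD(6)[OF bp])
  also have "\<dots> = sum2 (dm y) A K (\<lambda>h. (j h \<bullet> p h) \<bullet> y)"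
    by (rule sum2_vert) (auto intro: vert_hom2 is_biproductD[OF bp] parallel_refl)
  also have "\<dots> = sum2 B A K (\<lambda>h. j h \<bullet> p h \<bullet> y)"
    by (simp, rule sum2_cong) (use is_biproductD(3,4)[OF bp] in \<open>simp add: hom2_def\<close>)
  finally show ?thesis .
qed

text \<open>
  A 2-cell out of a direct sum is determined by its restrictions to the summands, as
  \<open>x = \<Sum> (x \<cdot> j\<^sub>h) \<cdot> p\<^sub>h\<close>.
\<close>

lemma biproduct_eqI:
  assumes bp: "is_biproduct K f A j p" and xy: "x \<in> hom2 A B" "y \<in> hom2 A B"
    and eq: "\<And>h. h \<in> K \<Longrightarrow> x \<bullet> j h = y \<bullet> j h"
  shows "x = y"
proof -
  note D = is_biproductD[OF bp]
  have expand: "z = sum2 A B K (\<lambda>h. (z \<bullet> j h) \<bullet> p h)" if z: "z \<in> hom2 A B" for z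
  proof -
    note [simp] = D(1,2) z[THEN hom2D(1)] z[THEN hom2D(2)] z[THEN hom2D(3)]
    have "z = z \<bullet> sum2 A A K (\<lambda>h. j h \<bullet> p h)" by (simp add: D(6))
    also have "\<dots> = sum2 A (cd z) K (\<lambda>h. z \<bullet> j h \<bullet> p h)"
      by (rule vert_sum2) (auto intro: vert_hom2 D parallel_refl)
    also have "\<dots> = sum2 A B K (\<lambda>h. (z \<bullet> j h) \<bullet> p h)"
      by (simp, rule sum2_cong) (use D(3,4) in \<open>simp add: hom2_def\<close>)
    finally show ?thesis .
  qed
  have "sum2 A B K (\<lambda>h. (x \<bullet> j h) \<bullet> p h) = sum2 A B K (\<lambda>h. (y \<bullet> j h) \<bullet> p h)"
    by (rule sum2_cong) (simp add: eq)
  then show ?thesis using expand[OF xy(1)] expand[OF xy(2)] by simp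
qed

lemma biproduct_copair:
  assumes bp: "is_biproduct K f A j p" and x: "\<And>h. h \<in> K \<Longrightarrow> x h \<in> hom2 (f h) B"
    and AB: "parallel A B"
  obtains m where "m \<in> hom2 A B" "\<And>h. h \<in> K \<Longrightarrow> m \<bullet> j h = x h"
proof
  note D = is_biproductD[OF bp]
  let ?m = "sum2 A B K (\<lambda>h. x h \<bullet> p h)"
  show m: "?m \<in> hom2 A B" by (rule sum2_hom2[OF AB]) (auto intro: vert_hom2 x D)
  fix k assume k: "k \<in> K"
  have "?m \<bullet> j k = sum2 (dm (j k)) B K (\<lambda>h. (x h \<bullet> p h) \<bullet> j k)"
    by (rule sum2_vert) (use D k AB hom2D[OF D(3)[OF k]] in \<open>auto intro: vert_hom2 x D\<close>)
  also have "\<dots> = sum2 (f k) B K (\<lambda>h. if h = k then x k else zero2 (f k) B)"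
  proof -
    have "(x h \<bullet> p h) \<bullet> j k = (if h = k then x k else zero2 (f k) B)" if h: "h \<in> K" for h
    proof -
      have "(x h \<bullet> p h) \<bullet> j k = x h \<bullet> p h \<bullet> j k"
        using x[OF h] D(3)[OF k] D(4)[OF h] by (simp add: hom2_def)
      moreover have "parallel (f k) (f h)"
        using D(7)[OF h] D(7)[OF k] parallel_trans parallel_sym by blast
      ultimately show ?thesis
        using D(5)[OF k h] x[OF h] zero2_comp(1)[of "f k" "f h" "x h"] by (auto simp: hom2_def)
    qed
    then show ?thesis unfolding hom2D(2)[OF D(3)[OF k]] by (rule sum2_cong)
  qed
  also have "\<dots> = x k" by (rule sum2_delta[OF D(1) k x[OF k]])
  finally show "?m \<bullet> j k = x k" .
qed

lemma biproduct_lwhisk: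
  assumes bp: "is_biproduct K f A j p" and g: "wf1 g" "tgt A = src g"
  shows "is_biproduct K (\<lambda>h. g \<box> f h) (g \<box> A) (\<lambda>h. g \<rhd> j h) (\<lambda>h. g \<rhd> p h)"
proof -
  note D = is_biproductD[OF bp]
  have hom: "g \<rhd> j h \<in> hom2 (g \<box> f h) (g \<box> A)" "g \<rhd> p h \<in> hom2 (g \<box> A) (g \<box> f h)" if "h \<in> K" for h
    using D(3,4,10)[OF that] g D(2) by (simp_all add: hom2_def)
  have delta: "(g \<rhd> p k) \<bullet> (g \<rhd> j h) = (if h = k then id2 (g \<box> f k) else zero2 (g \<box> f h) (g \<box> f k))"
    if hk: "h \<in> K" "k \<in> K" for h k
  proof -
    have "(g \<rhd> p k) \<bullet> (g \<rhd> j h) = g \<rhd> (p k \<bullet> j h)"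
      using D(3,10)[OF hk(1)] D(4)[OF hk(2)] g by (simp add: hom2_def)
    moreover have "parallel (f h) (f k)"
      using D(7)[OF hk(1)] D(7)[OF hk(2)] parallel_trans parallel_sym by blast
    ultimately show ?thesis
      using D(5)[OF hk] D(8,10)[OF hk(2)] D(10)[OF hk(1)] g zero2_comp(3) by (simp add: hom2_def)
  qed
  have "sum2 (g \<box> A) (g \<box> A) K (\<lambda>h. (g \<rhd> j h) \<bullet> (g \<rhd> p h)) = sum2 (g \<box> A) (g \<box> A) K (\<lambda>h. g \<rhd> (j h \<bullet> p h))"
    by (rule sum2_cong) (use D(3,4,10) g D(2) in \<open>simp add: hom2_def\<close>)
  also have "\<dots> = g \<rhd> sum2 A A K (\<lambda>h. j h \<bullet> p h)"
    by (rule lwhisk_sum2[symmetric]) (use D g in \<open>auto intro: vert_hom2 parallel_refl\<close>)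
  also have "\<dots> = id2 (g \<box> A)" using D(2,6) g by simp
  finally show ?thesis unfolding is_biproduct_def using hom delta D(1,2) g by simp
qed

lemma biproduct_rwhisk:
  assumes bp: "is_biproduct K f A j p" and g: "wf1 g" "src A = tgt g"
  shows "is_biproduct K (\<lambda>h. f h \<box> g) (A \<box> g) (\<lambda>h. j h \<lhd> g) (\<lambda>h. p h \<lhd> g)"
proof -
  note D = is_biproductD[OF bp]
  have hom: "j h \<lhd> g \<in> hom2 (f h \<box> g) (A \<box> g)" "p h \<lhd> g \<in> hom2 (A \<box> g) (f h \<box> g)" if "h \<in> K" for h
    using D(3,4,9)[OF that] g D(2) by (simp_all add: hom2_def)
  have delta: "(p k \<lhd> g) \<bullet> (j h \<lhd> g) = (if h = k then id2 (f k \<box> g) else zero2 (f h \<box> g) (f k \<box> g))"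
    if hk: "h \<in> K" "k \<in> K" for h k
  proof -
    have "(p k \<lhd> g) \<bullet> (j h \<lhd> g) = (p k \<bullet> j h) \<lhd> g"
      using D(3,9)[OF hk(1)] D(4)[OF hk(2)] g by (simp add: hom2_def)
    moreover have "parallel (f h) (f k)"
      using D(7)[OF hk(1)] D(7)[OF hk(2)] parallel_trans parallel_sym by blast
    ultimately show ?thesis
      using D(5)[OF hk] D(8,9)[OF hk(2)] D(9)[OF hk(1)] g zero2_comp(4) by (simp add: hom2_def)
  qed
  have "sum2 (A \<box> g) (A \<box> g) K (\<lambda>h. (j h \<lhd> g) \<bullet> (p h \<lhd> g)) = sum2 (A \<box> g) (A \<box> g) K (\<lambda>h. (j h \<bullet> p h) \<lhd> g)"
    by (rule sum2_cong) (use D(3,4,9) g D(2) in \<open>simp add: hom2_def\<close>)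
  also have "\<dots> = sum2 A A K (\<lambda>h. j h \<bullet> p h) \<lhd> g"
    by (rule rwhisk_sum2[symmetric]) (use D g in \<open>auto intro: vert_hom2 parallel_refl\<close>)
  also have "\<dots> = id2 (A \<box> g)" using D(2,6) g by simp
  finally show ?thesis unfolding is_biproduct_def using hom delta D(1,2) g by simp
qed

lemma biproduct_iso:
  assumes bp: "is_biproduct K f A j p" and \<kappa>: "isoc \<kappa>" "cd \<kappa> = A"
  shows "is_biproduct K f (dm \<kappa>) (\<lambda>h. Inv \<kappa> \<bullet> j h) (\<lambda>h. p h \<bullet> \<kappa>)"
proof -
  note D = is_biproductD[OF bp]
  note [simp] = \<kappa>
  have hom: "Inv \<kappa> \<bullet> j h \<in> hom2 (f h) (dm \<kappa>)" "p h \<bullet> \<kappa> \<in> hom2 (dm \<kappa>) (f h)" if "h \<in> K" for h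
    using D(3,4)[OF that] by (simp_all add: hom2_def)
  have delta: "(p k \<bullet> \<kappa>) \<bullet> (Inv \<kappa> \<bullet> j h) = p k \<bullet> j h" if "h \<in> K" "k \<in> K" for h k
    using D(3)[OF that(1)] D(4)[OF that(2)] by (simp add: hom2_def)
  have par: "parallel (dm \<kappa>) A" using hom2_parallel[of \<kappa> "dm \<kappa>" A] by (simp add: hom2_def)
  have "Inv \<kappa> \<bullet> \<kappa> = Inv \<kappa> \<bullet> sum2 (dm \<kappa>) A K (\<lambda>h. j h \<bullet> p h \<bullet> \<kappa>)"
    using biproduct_expand[OF bp, of \<kappa> "dm \<kappa>"] by (simp add: hom2_def)
  also have "\<dots> = sum2 (dm \<kappa>) (cd (Inv \<kappa>)) K (\<lambda>h. Inv \<kappa> \<bullet> j h \<bullet> p h \<bullet> \<kappa>)"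
    by (rule vert_sum2) (use D par \<kappa> in \<open>simp_all add: hom2_def\<close>)
  also have "\<dots> = sum2 (dm \<kappa>) (dm \<kappa>) K (\<lambda>h. (Inv \<kappa> \<bullet> j h) \<bullet> (p h \<bullet> \<kappa>))"
    by (simp, rule sum2_cong) (use D(3,4) in \<open>simp add: hom2_def\<close>)
  finally show ?thesis unfolding is_biproduct_def using hom delta D(1,5) by simp
qed

text \<open>
  The empty sum is a zero object, and a further summand \<open>f k\<close> is added to the direct sum \<open>D\<close> of the others
  by a binary biproduct \<open>S\<close> of \<open>f k\<close> and \<open>D\<close>.
\<close>

lemma exists_biproduct:
  assumes "finite K" "A \<in> Ob C" "B \<in> Ob C" "\<And>h. h \<in> K \<Longrightarrow> wf1 (f h) \<and> src (f h) = A \<and> tgt (f h) = B"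
  shows "\<exists>D j p. is_biproduct K f D j p \<and> src D = A \<and> tgt D = B"
  using assms(1,4)
proof (induction K rule: finite_induct)
  case empty
  obtain Z where Z: "Z \<in> Mor C A B" "Cell C Z Z = {0}" using zero_object[OF assms(2,3)] by blast
  then have "wf1 (Arr1 A B Z)" using assms unfolding wf1_def by simp
  moreover have "\<iota> Z = 0" using Z idc_closed assms by blast
  then have "sum2 (Arr1 A B Z) (Arr1 A B Z) {} undefined = id2 (Arr1 A B Z)"
    by (simp add: sum2_def id2_def)
  ultimately show ?case unfolding is_biproduct_def by (intro exI[of _ "Arr1 A B Z"]) (auto simp: sum2_def)
next
  case (insert k K)
  then obtain D j p where bp: "is_biproduct K f D j p" and DA: "src D = A" "tgt D = B" by blast
  note BD = is_biproductD[OF bp]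
  have fk: "wf1 (f k)" "src (f k) = A" "tgt (f k) = B" using insert by auto
  have "mor (f k) \<in> Mor C A B" "mor D \<in> Mor C A B" using fk BD(2) DA wf1D(3) by fastforce+
  then obtain S i1 i2 p1 p2 where S: "S \<in> Mor C A B" "i1 \<in> Cell C (mor (f k)) S" "i2 \<in> Cell C (mor D) S"
    "p1 \<in> Cell C S (mor (f k))" "p2 \<in> Cell C S (mor D)"
    and eqs: "p1 \<cdot> i1 = \<iota> (mor (f k))" "p2 \<cdot> i2 = \<iota> (mor D)" "p1 \<cdot> i2 = 0" "p2 \<cdot> i1 = 0"
    "i1 \<cdot> p1 + i2 \<cdot> p2 = \<iota> S"
    using biproduct[OF assms(2,3)] by metis
  let ?S = "Arr1 A B S"
  have wfS: "wf1 ?S" using S(1) assms unfolding wf1_def by simp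
  have par: "parallel (f k) ?S" "parallel D ?S" "parallel ?S (f k)" "parallel ?S D" "parallel ?S ?S"
      "parallel (f k) D" "parallel D (f k)"
    using wfS fk BD(2) DA unfolding parallel_def by simp_all
  define I1 I2 P1 P2 where "I1 = Arr2 (f k) ?S i1" and "I2 = Arr2 D ?S i2"
    and "P1 = Arr2 ?S (f k) p1" and "P2 = Arr2 ?S D p2"
  have hom: "I1 \<in> hom2 (f k) ?S" "I2 \<in> hom2 D ?S" "P1 \<in> hom2 ?S (f k)" "P2 \<in> hom2 ?S D"
    unfolding I1_def I2_def P1_def P2_def using S par by (simp_all add: Arr2_hom2)
  have cells: "cell I1 = i1" "cell I2 = i2" "cell P1 = p1" "cell P2 = p2"
    unfolding I1_def I2_def P1_def P2_def by simp_all
  note [simp] = hom[THEN hom2D(1)] hom[THEN hom2D(2)] hom[THEN hom2D(3)]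
  have E: "P1 \<bullet> I1 = id2 (f k)" "P2 \<bullet> I2 = id2 D" "P1 \<bullet> I2 = zero2 D (f k)" "P2 \<bullet> I1 = zero2 (f k) D"
    using eqs by (auto intro!: arr2_eqI simp: cell_comp cells zero2_def)
  let ?j = "\<lambda>h. if h = k then I1 else I2 \<bullet> j h" and ?p = "\<lambda>h. if h = k then P1 else p h \<bullet> P2"
  have "?j h \<in> hom2 (f h) ?S \<and> ?p h \<in> hom2 ?S (f h)" if "h \<in> insert k K" for h
    using that hom BD(3,4) by (auto intro: vert_hom2)
  moreover have "?p l \<bullet> ?j h = (if h = l then id2 (f l) else zero2 (f h) (f l))"
    if hl: "h \<in> insert k K" "l \<in> insert k K" for h l
  proof (cases "h = k")
    case True
    show ?thesis
    proof (cases "l = k")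
      case True then show ?thesis using \<open>h = k\<close> E by simp
    next
      case False
      then have l: "l \<in> K" using hl by simp
      have "?p l \<bullet> ?j h = p l \<bullet> zero2 (f k) D" using True False BD(4)[OF l] E by (simp add: hom2_def)
      then show ?thesis using True False BD(4)[OF l] zero2_comp(1)[OF par(6), of "p l"] by (simp add: hom2_def)
    qed
  next
    case False
    then have h: "h \<in> K" using hl by simp
    show ?thesis
    proof (cases "l = k")
      case True
      have "?p l \<bullet> ?j h = (P1 \<bullet> I2) \<bullet> j h" using True False BD(3)[OF h] by (simp add: hom2_def)
      also have "\<dots> = zero2 (f h) (f l)" unfolding E(3)
        using zero2_comp(2)[OF par(7), of "j h"] BD(3)[OF h] True by (simp add: hom2_def)
      finally show ?thesis using True False by (simp add: hom2_def)
    next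
      case False
      then have l: "l \<in> K" using hl by simp
      have "?p l \<bullet> ?j h = p l \<bullet> (P2 \<bullet> I2) \<bullet> j h"
        using \<open>h \<noteq> k\<close> False BD(3)[OF h] BD(4)[OF l] by (simp add: hom2_def)
      also have "\<dots> = p l \<bullet> j h" unfolding E using BD(3)[OF h] by (simp add: hom2_def)
      finally show ?thesis using BD(5)[OF h l] by (simp add: hom2_def)
    qed
  qed
  moreover have "sum2 ?S ?S (insert k K) (\<lambda>h. ?j h \<bullet> ?p h) = id2 ?S"
  proof -
    have "I2 \<bullet> sum2 D D K (\<lambda>h. j h \<bullet> p h) = sum2 D (cd I2) K (\<lambda>h. I2 \<bullet> j h \<bullet> p h)"
      by (rule vert_sum2) (use BD in \<open>auto intro: vert_hom2 parallel_refl\<close>)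
    then have "I2 = sum2 D ?S K (\<lambda>h. I2 \<bullet> j h \<bullet> p h)" using BD(2,6) by (simp add: hom2_def)
    then have "I2 \<bullet> P2 = sum2 D ?S K (\<lambda>h. I2 \<bullet> j h \<bullet> p h) \<bullet> P2" by simp
    also have "\<dots> = sum2 (dm P2) ?S K (\<lambda>h. (I2 \<bullet> j h \<bullet> p h) \<bullet> P2)"
      by (rule sum2_vert) (use BD par hom in \<open>auto intro!: vert_hom2\<close>)
    also have "\<dots> = sum2 ?S ?S K (\<lambda>h. ?j h \<bullet> ?p h)"
      by (simp, rule sum2_cong) (use BD(3,4) insert(2) in \<open>auto simp: hom2_def\<close>)
    finally have "cell (I2 \<bullet> P2) = (\<Sum>h\<in>K. cell (?j h \<bullet> ?p h))" by (simp add: sum2_def)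
    then have "(\<Sum>h\<in>insert k K. cell (?j h \<bullet> ?p h)) = i1 \<cdot> p1 + i2 \<cdot> p2"
      using insert(1,2) by (simp add: cell_comp cells)
    then show ?thesis unfolding sum2_def id2_def using eqs by simp
  qed
  ultimately show ?case
    unfolding is_biproduct_def using insert(1) wfS
    by (intro exI[of _ ?S] exI[of _ ?j] exI[of _ ?p]) simp
qed

end

section \<open>Equivalences are fully faithful and essentially surjective\<close>

text \<open>
  Nothing forces the records compared by \<open>is_equivalence\<close> to satisfy the axioms of a category; they are
  stated here for arrows between objects.
\<close>

definition is_category :: "('a, 'b) cat \<Rightarrow> bool" where
  "is_category \<A> \<longleftrightarrow>
     (\<forall>a\<in>Obj \<A>. \<forall>b\<in>Obj \<A>. \<forall>c\<in>Obj \<A>. \<forall>f\<in>Arr \<A> a b. \<forall>g\<in>Arr \<A> b c. comp \<A> g f \<in> Arr \<A> a c) \<and>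
     (\<forall>a\<in>Obj \<A>. \<forall>b\<in>Obj \<A>. \<forall>c\<in>Obj \<A>. \<forall>d\<in>Obj \<A>. \<forall>f\<in>Arr \<A> a b. \<forall>g\<in>Arr \<A> b c. \<forall>h\<in>Arr \<A> c d.
        comp \<A> (comp \<A> h g) f = comp \<A> h (comp \<A> g f)) \<and>
     (\<forall>a\<in>Obj \<A>. \<forall>b\<in>Obj \<A>. \<forall>f\<in>Arr \<A> a b. comp \<A> (ident \<A> b) f = f \<and> comp \<A> f (ident \<A> a) = f)"

lemma is_categoryD:
  assumes "is_category \<A>"
  shows "\<And>a b c f g. \<lbrakk>a \<in> Obj \<A>; b \<in> Obj \<A>; c \<in> Obj \<A>; f \<in> Arr \<A> a b; g \<in> Arr \<A> b c\<rbrakk>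
      \<Longrightarrow> comp \<A> g f \<in> Arr \<A> a c"
    and "\<And>a b c d f g h. \<lbrakk>a \<in> Obj \<A>; b \<in> Obj \<A>; c \<in> Obj \<A>; d \<in> Obj \<A>; f \<in> Arr \<A> a b; g \<in> Arr \<A> b c; h \<in> Arr \<A> c d\<rbrakk>
      \<Longrightarrow> comp \<A> (comp \<A> h g) f = comp \<A> h (comp \<A> g f)"
    and "\<And>a b f. \<lbrakk>a \<in> Obj \<A>; b \<in> Obj \<A>; f \<in> Arr \<A> a b\<rbrakk> \<Longrightarrow> comp \<A> (ident \<A> b) f = f"
    and "\<And>a b f. \<lbrakk>a \<in> Obj \<A>; b \<in> Obj \<A>; f \<in> Arr \<A> a b\<rbrakk> \<Longrightarrow> comp \<A> f (ident \<A> a) = f"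
  using assms unfolding is_category_def by blast+

lemma is_functorD:
  assumes "is_functor \<A> \<B> \<Phi> \<Phi>'"
  shows "\<And>a. a \<in> Obj \<A> \<Longrightarrow> \<Phi> a \<in> Obj \<B>"
    and "\<And>a b f. \<lbrakk>a \<in> Obj \<A>; b \<in> Obj \<A>; f \<in> Arr \<A> a b\<rbrakk> \<Longrightarrow> \<Phi>' a b f \<in> Arr \<B> (\<Phi> a) (\<Phi> b)"
  using assms unfolding is_functor_def by blast+

lemma cat_iso_cancel:
  assumes A: "is_category \<A>" and ob: "a \<in> Obj \<A>" "b \<in> Obj \<A>" "c \<in> Obj \<A>"
    and e: "cat_iso \<A> a b e" and f: "f \<in> Arr \<A> b c" "g \<in> Arr \<A> b c"
    and eq: "comp \<A> f e = comp \<A> g e"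
  shows "f = g"
proof -
  obtain e' where e': "e' \<in> Arr \<A> b a" "comp \<A> e e' = ident \<A> b" and "e \<in> Arr \<A> a b"
    using e unfolding cat_iso_def by blast
  have "f = comp \<A> (comp \<A> f e) e'" if "f \<in> Arr \<A> b c" for f
    using is_categoryD(2)[OF A ob(2,1,2,3) e'(1) \<open>e \<in> Arr \<A> a b\<close> that] is_categoryD(4)[OF A ob(2,3) that] e'(2)
    by simp
  then show ?thesis using f eq by metis
qed

text \<open>
  If \<open>\<Psi> \<Phi>\<close> is isomorphic to the identity by \<open>\<eta>\<close>, then \<open>f \<cdot> \<eta>\<^sub>a = \<eta>\<^sub>b \<cdot> \<Psi> \<Phi> f\<close> determines \<open>f\<close> from \<open>\<Phi> f\<close>.
\<close>

lemma nat_iso_faithful: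
  assumes A: "is_category \<A>"
    and iso: "nat_isomorphic \<A> \<A> (\<lambda>a. \<Psi> (\<Phi> a)) (\<lambda>a b f. \<Psi>' (\<Phi> a) (\<Phi> b) (\<Phi>' a b f)) (\<lambda>a. a) (\<lambda>a b f. f)"
    and F: "is_functor \<A> \<B> \<Phi> \<Phi>'" and G: "is_functor \<B> \<A> \<Psi> \<Psi>'"
    and ob: "a \<in> Obj \<A>" "b \<in> Obj \<A>" and f: "f \<in> Arr \<A> a b" "g \<in> Arr \<A> a b"
    and eq: "\<Phi>' a b f = \<Phi>' a b g"
  shows "f = g"
proof -
  obtain \<eta> where \<eta>: "\<And>a. a \<in> Obj \<A> \<Longrightarrow> cat_iso \<A> (\<Psi> (\<Phi> a)) a (\<eta> a)"
    and nat: "\<And>a b f. \<lbrakk>a \<in> Obj \<A>; b \<in> Obj \<A>; f \<in> Arr \<A> a b\<rbrakk>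
      \<Longrightarrow> comp \<A> (\<eta> b) (\<Psi>' (\<Phi> a) (\<Phi> b) (\<Phi>' a b f)) = comp \<A> f (\<eta> a)"
    using iso unfolding nat_isomorphic_def by blast
  have ob': "\<Psi> (\<Phi> a) \<in> Obj \<A>" using ob is_functorD(1)[OF F] is_functorD(1)[OF G] by blast
  have "comp \<A> f (\<eta> a) = comp \<A> g (\<eta> a)" using nat[OF ob f(1)] nat[OF ob f(2)] eq by simp
  then show ?thesis using cat_iso_cancel[OF A ob' ob \<eta>[OF ob(1)] f] by blast
qed

lemma equivalence_faithful:
  assumes "is_category \<A>" "is_equivalence \<A> \<B> \<Phi> \<Phi>'"
    and "a \<in> Obj \<A>" "b \<in> Obj \<A>" "f \<in> Arr \<A> a b" "g \<in> Arr \<A> a b" "\<Phi>' a b f = \<Phi>' a b g"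
  shows "f = g"
proof -
  obtain \<Psi> \<Psi>' where "is_functor \<A> \<B> \<Phi> \<Phi>'" "is_functor \<B> \<A> \<Psi> \<Psi>'"
    "nat_isomorphic \<A> \<A> (\<lambda>a. \<Psi> (\<Phi> a)) (\<lambda>a b f. \<Psi>' (\<Phi> a) (\<Phi> b) (\<Phi>' a b f)) (\<lambda>a. a) (\<lambda>a b f. f)"
    using assms(2) unfolding is_equivalence_def by blast
  from nat_iso_faithful[OF assms(1) this(3,1,2) assms(3-7)] show ?thesis .
qed

text \<open>
  The preimage of \<open>h\<close> is \<open>\<eta>\<^sub>b \<cdot> \<Psi> h \<cdot> \<eta>\<^sub>a\<inverse>\<close>; its image under \<open>\<Psi> \<Phi>\<close> is \<open>\<Psi> h\<close> by naturality, and \<open>\<Psi>\<close> is faithful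
  because \<open>\<Phi> \<Psi>\<close> is isomorphic to the identity.
\<close>

lemma equivalence_full:
  assumes A: "is_category \<A>" and B: "is_category \<B>" and eqv: "is_equivalence \<A> \<B> \<Phi> \<Phi>'"
    and ob: "a \<in> Obj \<A>" "b \<in> Obj \<A>" and h: "h \<in> Arr \<B> (\<Phi> a) (\<Phi> b)"
  shows "\<exists>f\<in>Arr \<A> a b. \<Phi>' a b f = h"
proof -
  obtain \<Psi> \<Psi>' where F: "is_functor \<A> \<B> \<Phi> \<Phi>'" and G: "is_functor \<B> \<A> \<Psi> \<Psi>'"
    and iso: "nat_isomorphic \<A> \<A> (\<lambda>a. \<Psi> (\<Phi> a)) (\<lambda>a b f. \<Psi>' (\<Phi> a) (\<Phi> b) (\<Phi>' a b f))
          (\<lambda>a. a) (\<lambda>a b f. f)"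
    and iso': "nat_isomorphic \<B> \<B> (\<lambda>a. \<Phi> (\<Psi> a)) (\<lambda>a b f. \<Phi>' (\<Psi> a) (\<Psi> b) (\<Psi>' a b f))
          (\<lambda>a. a) (\<lambda>a b f. f)"
    using eqv unfolding is_equivalence_def by blast
  obtain \<eta> where \<eta>: "\<And>a. a \<in> Obj \<A> \<Longrightarrow> cat_iso \<A> (\<Psi> (\<Phi> a)) a (\<eta> a)"
    and nat: "\<And>a b f. \<lbrakk>a \<in> Obj \<A>; b \<in> Obj \<A>; f \<in> Arr \<A> a b\<rbrakk>
      \<Longrightarrow> comp \<A> (\<eta> b) (\<Psi>' (\<Phi> a) (\<Phi> b) (\<Phi>' a b f)) = comp \<A> f (\<eta> a)"
    using iso unfolding nat_isomorphic_def by blast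
  let ?a = "\<Psi> (\<Phi> a)" and ?b = "\<Psi> (\<Phi> b)"
  have obB: "\<Phi> a \<in> Obj \<B>" "\<Phi> b \<in> Obj \<B>" using ob is_functorD(1)[OF F] by auto
  have obA: "?a \<in> Obj \<A>" "?b \<in> Obj \<A>" using obB is_functorD(1)[OF G] by auto
  obtain \<alpha> where \<alpha>: "\<alpha> \<in> Arr \<A> a ?a" "comp \<A> \<alpha> (\<eta> a) = ident \<A> ?a" and \<eta>a: "\<eta> a \<in> Arr \<A> ?a a"
    using \<eta>[OF ob(1)] unfolding cat_iso_def by blast
  obtain \<beta> where \<beta>: "\<beta> \<in> Arr \<A> b ?b" "comp \<A> \<beta> (\<eta> b) = ident \<A> ?b" and \<eta>b: "\<eta> b \<in> Arr \<A> ?b b"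
    using \<eta>[OF ob(2)] unfolding cat_iso_def by blast
  let ?h = "\<Psi>' (\<Phi> a) (\<Phi> b) h"
  have h': "?h \<in> Arr \<A> ?a ?b" using is_functorD(2)[OF G obB h] .
  \<comment> \<open>\<open>\<alpha>\<close> is the inverse of \<open>\<eta> a\<close>\<close>
  let ?f = "comp \<A> (comp \<A> (\<eta> b) ?h) \<alpha>"
  have \<eta>h: "comp \<A> (\<eta> b) ?h \<in> Arr \<A> ?a b" using is_categoryD(1)[OF A obA(1,2) ob(2) h' \<eta>b] .
  then have f: "?f \<in> Arr \<A> a b" using is_categoryD(1)[OF A ob(1) obA(1) ob(2) \<alpha>(1)] by blast
  have \<Phi>f: "\<Phi>' a b ?f \<in> Arr \<B> (\<Phi> a) (\<Phi> b)" using is_functorD(2)[OF F ob f] .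
  let ?k = "\<Psi>' (\<Phi> a) (\<Phi> b) (\<Phi>' a b ?f)"
  have k: "?k \<in> Arr \<A> ?a ?b" using is_functorD(2)[OF G obB \<Phi>f] .
  have "comp \<A> (\<eta> b) ?k = comp \<A> ?f (\<eta> a)" using nat[OF ob f] .
  also have "\<dots> = comp \<A> (comp \<A> (\<eta> b) ?h) (comp \<A> \<alpha> (\<eta> a))"
    using is_categoryD(2)[OF A obA(1) ob(1) obA(1) ob(2) \<eta>a \<alpha>(1) \<eta>h] .
  also have "\<dots> = comp \<A> (\<eta> b) ?h" using \<alpha>(2) is_categoryD(4)[OF A obA(1) ob(2) \<eta>h] by simp
  finally have eq: "comp \<A> \<beta> (comp \<A> (\<eta> b) ?k) = comp \<A> \<beta> (comp \<A> (\<eta> b) ?h)" by simp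
  have "comp \<A> \<beta> (comp \<A> (\<eta> b) x) = x" if "x \<in> Arr \<A> ?a ?b" for x
    using is_categoryD(2)[OF A obA(1,2) ob(2) obA(2) that \<eta>b \<beta>(1)] \<beta>(2)
      is_categoryD(3)[OF A obA that] by simp
  then have "?k = ?h" using eq h' k by simp
  then have "\<Phi>' a b ?f = h" using nat_iso_faithful[OF B iso' G F obB \<Phi>f h] by blast
  then show ?thesis using f by blast
qed

lemma equivalence_ess_surj:
  assumes "is_equivalence \<A> \<B> \<Phi> \<Phi>'" "b \<in> Obj \<B>"
  shows "\<exists>a\<in>Obj \<A>. \<exists>f. cat_iso \<B> (\<Phi> a) b f"
  using assms unfolding is_equivalence_def nat_isomorphic_def is_functor_def by metis

section \<open>Actions of a 2-representation on 1-morphisms\<close>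

locale two_rep = linear_2category C + group G
  for C :: "('k::field, 'o, 'm, 'c::ab_group_add) lin2cat" (structure)
    and G :: "('g, 'z) monoid_scheme" +
  fixes V :: 'o and R :: "('g, 'm, 'c) rep2"
  assumes rep: "is_rep2 C G V R"
begin

definition rho :: "'g \<Rightarrow> ('o, 'm) arr1" where
  "rho g = Arr1 V V (act R g)"

definition Phi :: "'g \<Rightarrow> 'g \<Rightarrow> ('o, 'm, 'c) arr2" where
  "Phi g h = Arr2 (rho g \<box> rho h) (rho (g \<otimes>\<^bsub>G\<^esub> h)) (mulc R g h)"

definition phi1 :: "('o, 'm, 'c) arr2" where
  "phi1 = Arr2 (rho \<one>\<^bsub>G\<^esub>) (id1 V) (unitc R)"

lemma rep_sel [simp]:
  "src (rho g) = V" "tgt (rho g) = V" "dm (Phi g h) = rho g \<box> rho h" "cd (Phi g h) = rho (g \<otimes>\<^bsub>G\<^esub> h)"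
  "dm phi1 = rho \<one>\<^bsub>G\<^esub>" "cd phi1 = id1 V"
  by (simp_all add: rho_def Phi_def phi1_def)

lemma rep_cell: "mor (rho g) = act R g" "cell (Phi g h) = mulc R g h" "cell phi1 = unitc R"
  by (simp_all add: rho_def Phi_def phi1_def)

lemma V_ob [simp]: "V \<in> Ob C"
  using rep unfolding is_rep2_def by blast

lemma wf_rho [simp]: "g \<in> carrier G \<Longrightarrow> wf1 (rho g)"
  using rep unfolding is_rep2_def wf1_def by (simp add: rho_def)

lemma isoc_Phi [simp]: "g \<in> carrier G \<Longrightarrow> h \<in> carrier G \<Longrightarrow> isoc (Phi g h)"
  using rep unfolding is_rep2_def by (subst isoc_iff_iso2) (simp_all add: rep_cell mor_comp)

lemma isoc_phi1 [simp]: "isoc phi1"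
  using rep unfolding is_rep2_def by (subst isoc_iff_iso2) (simp_all add: rep_cell mor_comp)

lemma Phi_assoc:
  assumes "g \<in> carrier G" "h \<in> carrier G" "k \<in> carrier G"
  shows "Phi (g \<otimes>\<^bsub>G\<^esub> h) k \<bullet> (Phi g h \<lhd> rho k) = Phi g (h \<otimes>\<^bsub>G\<^esub> k) \<bullet> (rho g \<rhd> Phi h k)"
  using rep assms unfolding is_rep2_def
  by (intro arr2_eqI) (simp_all add: rep_cell mor_comp cell_comp m_assoc)

lemma Phi_unit:
  assumes "g \<in> carrier G"
  shows "Phi \<one>\<^bsub>G\<^esub> g = phi1 \<lhd> rho g" "Phi g \<one>\<^bsub>G\<^esub> = rho g \<rhd> phi1"
  using rep assms unfolding is_rep2_def
  by (auto intro!: arr2_eqI simp: rep_cell mor_comp cell_comp)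

text \<open>
  A coherent family of 2-isomorphisms \<open>\<rho>(g) F \<Rightarrow> F\<close>; on an object \<open>F\<close> of a linear category it is an
  equivariant structure. With the trivial 2-representation on the source of \<open>F\<close>, an action amounts to flips
  together with a trivialization inverse to them.
\<close>

definition action :: "('o, 'm) arr1 \<Rightarrow> ('g \<Rightarrow> ('o, 'm, 'c) arr2) \<Rightarrow> bool" where
  "action F a \<longleftrightarrow> wf1 F \<and> tgt F = V \<and>
     (\<forall>g\<in>carrier G. isoc (a g) \<and> dm (a g) = rho g \<box> F \<and> cd (a g) = F) \<and>
     (\<forall>g\<in>carrier G. \<forall>h\<in>carrier G. a (g \<otimes>\<^bsub>G\<^esub> h) \<bullet> (Phi g h \<lhd> F) = a g \<bullet> (rho g \<rhd> a h))"

lemma actionD: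
  assumes "action F a"
  shows "wf1 F" "tgt F = V"
    "\<And>g. g \<in> carrier G \<Longrightarrow> isoc (a g)" "\<And>g. g \<in> carrier G \<Longrightarrow> dm (a g) = rho g \<box> F"
    "\<And>g. g \<in> carrier G \<Longrightarrow> cd (a g) = F"
    "\<And>g h. g \<in> carrier G \<Longrightarrow> h \<in> carrier G \<Longrightarrow>
      a (g \<otimes>\<^bsub>G\<^esub> h) \<bullet> (Phi g h \<lhd> F) = a g \<bullet> (rho g \<rhd> a h)"
  using assms unfolding action_def by blast+

text \<open>
  For \<open>g = h = 1\<close> the cocycle condition gives \<open>\<rho>(1) a\<^sub>1 = \<rho>(1) \<phi>\<^sub>1 F\<close>, and \<open>\<rho>(1)\<close> is removed by conjugating with
  the isomorphism \<open>\<phi>\<^sub>1 : \<rho>(1) \<Rightarrow> id\<close>.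
\<close>

lemma action_unit:
  assumes "action F a"
  shows "a \<one>\<^bsub>G\<^esub> = phi1 \<lhd> F"
proof -
  note [simp] = actionD(1-5)[OF assms]
  let ?r = "rho \<one>\<^bsub>G\<^esub>" and ?a = "a \<one>\<^bsub>G\<^esub>"
  have "?a \<bullet> (?r \<rhd> phi1 \<lhd> F) = ?a \<bullet> (?r \<rhd> ?a)"
    using actionD(6)[OF assms, of "\<one>\<^bsub>G\<^esub>" "\<one>\<^bsub>G\<^esub>"] Phi_unit(2)[of "\<one>\<^bsub>G\<^esub>"] by simp
  then have *: "?r \<rhd> phi1 \<lhd> F = ?r \<rhd> ?a"
    by (rule vert_left_cancel[of ?a, rotated -1]) simp_all
  have "?a \<bullet> (phi1 \<lhd> ?r \<lhd> F) = (phi1 \<lhd> F) \<bullet> (?r \<rhd> ?a)"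
    using exchange[of ?a phi1] by simp
  also have "\<dots> = (phi1 \<lhd> F) \<bullet> (?r \<rhd> phi1 \<lhd> F)" using * by simp
  also have "\<dots> = (phi1 \<lhd> F) \<bullet> (phi1 \<lhd> ?r \<lhd> F)"
    using exchange[of "phi1 \<lhd> F" phi1] by simp
  finally show ?thesis
    by (rule vert_right_cancel[of "phi1 \<lhd> ?r \<lhd> F", rotated -1]) simp_all
qed

lemma action_comp:
  assumes "action F a" "wf1 H" "tgt H = src F"
  shows "action (F \<box> H) (\<lambda>g. a g \<lhd> H)"
proof -
  note [simp] = actionD(1-5)[OF assms(1)]
  have "(a (g \<otimes>\<^bsub>G\<^esub> h) \<lhd> H) \<bullet> (Phi g h \<lhd> F \<lhd> H) = (a g \<lhd> H) \<bullet> (rho g \<rhd> a h \<lhd> H)"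
    if "g \<in> carrier G" "h \<in> carrier G" for g h
    using arg_cong[OF actionD(6)[OF assms(1) that], of "\<lambda>x. x \<lhd> H"] assms(2,3) that by simp
  then show ?thesis unfolding action_def using assms(2,3) by simp
qed

lemma is_rep2_triv_rep: "W \<in> Ob C \<Longrightarrow> is_rep2 C G W (triv_rep W)"
  unfolding is_rep2_def triv_rep_def by (auto simp: id_id iso2_id idm_closed)

lemma cocycle_Inv:
  assumes "action F a" "g \<in> carrier G" "h \<in> carrier G"
  shows "(Phi g h \<lhd> F) \<bullet> (rho g \<rhd> Inv (a h)) \<bullet> Inv (a g) = Inv (a (g \<otimes>\<^bsub>G\<^esub> h))"
proof -
  note [simp] = actionD(1-5)[OF assms(1)] assms(2,3)
  have "Inv (a (g \<otimes>\<^bsub>G\<^esub> h) \<bullet> (Phi g h \<lhd> F)) = Inv (a g \<bullet> (rho g \<rhd> a h))"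
    using actionD(6)[OF assms] by simp
  then have "(Inv (Phi g h) \<lhd> F) \<bullet> Inv (a (g \<otimes>\<^bsub>G\<^esub> h)) = (rho g \<rhd> Inv (a h)) \<bullet> Inv (a g)"
    by simp
  then have "(Phi g h \<lhd> F) \<bullet> (Inv (Phi g h) \<lhd> F) \<bullet> Inv (a (g \<otimes>\<^bsub>G\<^esub> h))
      = (Phi g h \<lhd> F) \<bullet> (rho g \<rhd> Inv (a h)) \<bullet> Inv (a g)" by simp
  then show ?thesis by simp
qed

lemma action_equivariant:
  assumes "action F a" "src F = W"
  shows "is_equivariant C G W (triv_rep W) V R (mor F) (\<lambda>g. cell (a g))"
proof -
  note [simp] = actionD(1-5)[OF assms(1)] assms(2)
  have W [simp]: "W \<in> Ob C" using wf1D(1)[OF actionD(1)[OF assms(1)]] by simp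
  have "iso2 C (act R g \<odot> mor F) (mor F \<odot> idm C W) (cell (a g))" if "g \<in> carrier G" for g
    using isoc_iff_iso2[of "a g"] that by (simp add: mor_id_right mor_comp rep_cell)
  moreover have "cell (a (g \<otimes>\<^bsub>G\<^esub> h)) \<cdot> (mulc R g h \<star> \<iota> (mor F)) =
      (\<iota> (mor F) \<star> \<iota> (idm C W)) \<cdot> (cell (a g) \<star> \<iota> (idm C W)) \<cdot> (\<iota> (act R g) \<star> cell (a h))"
    if "g \<in> carrier G" "h \<in> carrier G" for g h
  proof -
    have "a (g \<otimes>\<^bsub>G\<^esub> h) \<bullet> (Phi g h \<lhd> F) = ((id2 F \<lhd> id1 W) \<bullet> (a g \<lhd> id1 W)) \<bullet> (rho g \<rhd> a h)"
      using actionD(6)[OF assms(1) that] that by simp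
    from cell_eq[OF this] show ?thesis by (simp only: cell_comp mor_comp rep_cell)
  qed
  moreover have "cell (a \<one>\<^bsub>G\<^esub>) = (\<iota> (mor F) \<star> inv2 C (idm C W) (idm C W) (\<iota> (idm C W))) \<cdot> (unitc R \<star> \<iota> (mor F))"
  proof -
    have "a \<one>\<^bsub>G\<^esub> = (id2 F \<lhd> id1 W) \<bullet> (phi1 \<lhd> F)" using action_unit[OF assms(1)] by simp
    from cell_eq[OF this] show ?thesis by (simp only: inv2_id[OF W] cell_comp mor_comp rep_cell)
  qed
  ultimately show ?thesis
    using wf1D(3)[OF actionD(1)[OF assms(1)]] unfolding is_equivariant_def by simp
qed

text \<open>
  The compatibility of trivialization and flips holds since, by the inverted cocycle condition, its sides
  are the inverses of \<open>a\<^sub>s\<^sub>g\<close> and of \<open>a\<^sub>c\<^sub>s\<close>, where \<open>c = s g s\<inverse>\<close> and therefore \<open>c s = s g\<close>.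
\<close>

lemma action_trivialization:
  assumes "action F a" "src F = W"
  shows "is_trivialization C G W (triv_rep W) V R (mor F) (\<lambda>g. cell (a g)) (\<lambda>g. cell (Inv (a g)))"
proof -
  note [simp] = actionD(1-5)[OF assms(1)] assms(2)
  have W [simp]: "W \<in> Ob C" using wf1D(1)[OF actionD(1)[OF assms(1)]] by simp
  have "iso2 C (mor F) (act R g \<odot> mor F) (cell (Inv (a g)))" if "g \<in> carrier G" for g
    using isoc_iff_iso2[of "Inv (a g)"] that by (simp add: mor_comp rep_cell)
  moreover have "(mulc R g h \<star> \<iota> (mor F)) \<cdot> (\<iota> (act R g) \<star> cell (Inv (a h))) \<cdot> cell (Inv (a g))
      = cell (Inv (a (g \<otimes>\<^bsub>G\<^esub> h)))" if "g \<in> carrier G" "h \<in> carrier G" for g h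
  proof -
    have "((Phi g h \<lhd> F) \<bullet> (rho g \<rhd> Inv (a h))) \<bullet> Inv (a g) = Inv (a (g \<otimes>\<^bsub>G\<^esub> h))"
      using cocycle_Inv[OF assms(1) that] that by simp
    from cell_eq[OF this] show ?thesis by (simp only: cell_comp mor_comp rep_cell)
  qed
  moreover have "(mulc R s g \<star> \<iota> (mor F)) \<cdot> (\<iota> (act R s) \<star> cell (Inv (a g))) \<cdot>
        inv2 C (act R s \<odot> mor F) (mor F \<odot> idm C W) (cell (a s)) =
      (mulc R (s \<otimes>\<^bsub>G\<^esub> g \<otimes>\<^bsub>G\<^esub> inv\<^bsub>G\<^esub> s) s \<star> \<iota> (mor F)) \<cdot>
        (\<iota> (act R (s \<otimes>\<^bsub>G\<^esub> g \<otimes>\<^bsub>G\<^esub> inv\<^bsub>G\<^esub> s)) \<star>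
          inv2 C (act R s \<odot> mor F) (mor F \<odot> idm C W) (cell (a s))) \<cdot>
        (cell (Inv (a (s \<otimes>\<^bsub>G\<^esub> g \<otimes>\<^bsub>G\<^esub> inv\<^bsub>G\<^esub> s))) \<star> \<iota> (idm C W))"
    if sg: "s \<in> carrier G" "g \<in> carrier G" for s g
  proof -
    let ?c = "s \<otimes>\<^bsub>G\<^esub> g \<otimes>\<^bsub>G\<^esub> inv\<^bsub>G\<^esub> s"
    have c: "?c \<in> carrier G" "?c \<otimes>\<^bsub>G\<^esub> s = s \<otimes>\<^bsub>G\<^esub> g" using sg by (simp_all add: m_assoc)
    have inv: "inv2 C (act R s \<odot> mor F) (mor F \<odot> idm C W) (cell (a s)) = cell (Inv (a s))"
      using sg by (simp add: Inv_def mor_comp rep_cell mor_id_right)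
    have "((Phi s g \<lhd> F) \<bullet> (rho s \<rhd> Inv (a g))) \<bullet> Inv (a s)
        = ((Phi ?c s \<lhd> F) \<bullet> (rho ?c \<rhd> Inv (a s))) \<bullet> (Inv (a ?c) \<lhd> id1 W)"
      using cocycle_Inv[OF assms(1) sg] cocycle_Inv[OF assms(1) c(1) sg(1)] c sg by simp
    from cell_eq[OF this] show ?thesis unfolding inv by (simp only: cell_comp mor_comp rep_cell)
  qed
  ultimately show ?thesis unfolding is_trivialization_def by (simp add: Let_def)
qed

lemma eqv_arr_iff:
  assumes F: "wf1 F" "src F = W" "tgt F = V" and F': "wf1 F'" "src F' = W" "tgt F' = V"
  shows "\<beta> \<in> Arr (eqv_cat C G W (triv_rep W) V R) (mor F, \<tau>) (mor F', \<tau>') \<longleftrightarrow>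
    wf2 (Arr2 F F' \<beta>) \<and> (\<forall>g\<in>carrier G. Arr2 (rho g \<box> F') F' (\<tau>' g) \<bullet> (rho g \<rhd> Arr2 F F' \<beta>) =
      Arr2 F F' \<beta> \<bullet> Arr2 (rho g \<box> F) F (\<tau> g))"
proof -
  let ?B = "Arr2 F F' \<beta>"
  have W: "W \<in> Ob C" using wf1D(1)[OF F(1)] F(2) by simp
  have wf: "wf2 ?B \<longleftrightarrow> \<beta> \<in> Cell C (mor F) (mor F')" using F F' by (simp add: wf2_def[of ?B])
  have "\<tau>' g \<cdot> (\<iota> (act R g) \<star> \<beta>) = (\<beta> \<star> \<iota> (idm C W)) \<cdot> \<tau> g \<longleftrightarrow>
      Arr2 (rho g \<box> F') F' (\<tau>' g) \<bullet> (rho g \<rhd> ?B) = ?B \<bullet> Arr2 (rho g \<box> F) F (\<tau> g)"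
    if "wf2 ?B" for g
    using cell_id_right[OF that] F(2) by (auto intro: arr2_eqI dest: cell_eq simp: cell_comp rep_cell)
  then show ?thesis unfolding eqv_cat_def using wf by auto
qed

lemma triv_arr_iff:
  assumes F: "wf1 F" "src F = W" "tgt F = V" and F': "wf1 F'" "src F' = W" "tgt F' = V"
  shows "\<beta> \<in> Arr (triv_cat C G W (triv_rep W) V R) (mor F, \<tau>, \<epsilon>) (mor F', \<tau>', \<epsilon>') \<longleftrightarrow>
    wf2 (Arr2 F F' \<beta>) \<and> (\<forall>g\<in>carrier G. Arr2 (rho g \<box> F') F' (\<tau>' g) \<bullet> (rho g \<rhd> Arr2 F F' \<beta>) =
      Arr2 F F' \<beta> \<bullet> Arr2 (rho g \<box> F) F (\<tau> g)) \<and>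
      (\<forall>g\<in>carrier G. Arr2 F' (rho g \<box> F') (\<epsilon>' g) \<bullet> Arr2 F F' \<beta> =
        (rho g \<rhd> Arr2 F F' \<beta>) \<bullet> Arr2 F (rho g \<box> F) (\<epsilon> g))"
proof -
  let ?B = "Arr2 F F' \<beta>"
  have "\<epsilon>' g \<cdot> \<beta> = (\<iota> (act R g) \<star> \<beta>) \<cdot> \<epsilon> g \<longleftrightarrow>
      Arr2 F' (rho g \<box> F') (\<epsilon>' g) \<bullet> ?B = (rho g \<rhd> ?B) \<bullet> Arr2 F (rho g \<box> F) (\<epsilon> g)" for g
    by (auto intro: arr2_eqI dest: cell_eq simp: cell_comp rep_cell)
  moreover have "\<beta> \<in> Arr (triv_cat C G W (triv_rep W) V R) (mor F, \<tau>, \<epsilon>) (mor F', \<tau>', \<epsilon>') \<longleftrightarrow>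
      \<beta> \<in> Arr (eqv_cat C G W (triv_rep W) V R) (mor F, \<tau>) (mor F', \<tau>') \<and>
      (\<forall>g\<in>carrier G. \<epsilon>' g \<cdot> \<beta> = (\<iota> (act R g) \<star> \<beta>) \<cdot> \<epsilon> g)"
    unfolding triv_cat_def eqv_cat_def by auto
  ultimately show ?thesis using eqv_arr_iff[OF assms] by auto
qed

lemma equivariantD:
  assumes "is_equivariant C G W (triv_rep W) V R F \<tau>" "W \<in> Ob C"
  shows "wf1 (Arr1 W V F)" "\<And>g. g \<in> carrier G \<Longrightarrow> wf2 (Arr2 (rho g \<box> Arr1 W V F) (Arr1 W V F) (\<tau> g))"
proof -
  show wf: "wf1 (Arr1 W V F)" using assms unfolding is_equivariant_def wf1_def by simp
  fix g assume g: "g \<in> carrier G"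
  have "\<tau> g \<in> Cell C (act R g \<odot> F) (F \<odot> idm C W)"
    using assms(1) g unfolding is_equivariant_def iso2_def by simp
  then show "wf2 (Arr2 (rho g \<box> Arr1 W V F) (Arr1 W V F) (\<tau> g))"
    using wf g mor_id_right[OF wf, of W] unfolding wf2_def by (simp add: mor_comp rep_cell)
qed

text \<open>
  The converse: the first coherence condition of a trivialization is the inverted cocycle condition of
  an action.
\<close>

lemma trivializationD:
  assumes "is_trivialization C G W Q V R F \<tau> \<epsilon>" "W \<in> Ob C" "wf1 (Arr1 W V F)"
  shows "\<And>g. g \<in> carrier G \<Longrightarrow> isoc (Arr2 (Arr1 W V F) (rho g \<box> Arr1 W V F) (\<epsilon> g))"
    and "action (Arr1 W V F) (\<lambda>g. Inv (Arr2 (Arr1 W V F) (rho g \<box> Arr1 W V F) (\<epsilon> g)))"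
proof -
  let ?F = "Arr1 W V F"
  let ?e = "\<lambda>g. Arr2 ?F (rho g \<box> ?F) (\<epsilon> g)"
  note [simp] = assms(3)
  show iso [simp]: "isoc (?e g)" if "g \<in> carrier G" for g
    using assms(1) that unfolding is_trivialization_def by (simp add: isoc_iff_iso2 mor_comp rep_cell)
  have "Inv (?e (g \<otimes>\<^bsub>G\<^esub> h)) \<bullet> (Phi g h \<lhd> ?F) = Inv (?e g) \<bullet> (rho g \<rhd> Inv (?e h))"
    if gh: "g \<in> carrier G" "h \<in> carrier G" for g h
  proof -
    have "((Phi g h \<lhd> ?F) \<bullet> (rho g \<rhd> ?e h)) \<bullet> ?e g = ?e (g \<otimes>\<^bsub>G\<^esub> h)"
      using assms(1) gh unfolding is_trivialization_def
      by (intro arr2_eqI) (simp_all add: cell_comp rep_cell del: vert_assoc)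
    then have "Inv (?e (g \<otimes>\<^bsub>G\<^esub> h)) = Inv ((Phi g h \<lhd> ?F) \<bullet> (rho g \<rhd> ?e h) \<bullet> ?e g)"
      using gh by simp
    then show ?thesis using gh by simp
  qed
  then show "action ?F (\<lambda>g. Inv (?e g))" unfolding action_def by simp
qed

lemma is_category_eqv:
  assumes "W \<in> Ob C"
  shows "is_category (eqv_cat C G W (triv_rep W) V R)"
proof -
  let ?A = "eqv_cat C G W (triv_rep W) V R"
  have obj: "\<exists>F \<tau>. x = (mor F, \<tau>) \<and> wf1 F \<and> src F = W \<and> tgt F = V \<and>
      (\<forall>g\<in>carrier G. wf2 (Arr2 (rho g \<box> F) F (\<tau> g)))" if x: "x \<in> Obj ?A" for x
  proof -
    obtain F \<tau> where "x = (F, \<tau>)" "is_equivariant C G W (triv_rep W) V R F \<tau>"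
      using x unfolding eqv_cat_def by auto
    then show ?thesis using equivariantD[OF _ assms, of F \<tau>]
      by (intro exI[of _ "Arr1 W V F"] exI[of _ \<tau>]) simp
  qed
  have comp: "comp ?A = (\<cdot>)" by (simp add: eqv_cat_def)
  have ident: "ident ?A (F, \<tau>) = \<iota> F" for F \<tau> by (simp add: eqv_cat_def)
  show ?thesis unfolding is_category_def comp
  proof (intro conjI ballI)
    fix x y z f g assume "x \<in> Obj ?A" "y \<in> Obj ?A" "z \<in> Obj ?A"
      and fg: "f \<in> Arr ?A x y" "g \<in> Arr ?A y z"
    then obtain F \<tau> F' \<tau>' F'' \<tau>''
      where x: "x = (mor F, \<tau>)" "wf1 F" "src F = W" "tgt F = V" "\<forall>g\<in>carrier G. wf2 (Arr2 (rho g \<box> F) F (\<tau> g))"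
      and y: "y = (mor F', \<tau>')" "wf1 F'" "src F' = W" "tgt F' = V" "\<forall>g\<in>carrier G. wf2 (Arr2 (rho g \<box> F') F' (\<tau>' g))"
      and z: "z = (mor F'', \<tau>'')" "wf1 F''" "src F'' = W" "tgt F'' = V" "\<forall>g\<in>carrier G. wf2 (Arr2 (rho g \<box> F'') F'' (\<tau>'' g))"
      using obj by metis
    let ?f = "Arr2 F F' f" and ?g = "Arr2 F' F'' g"
    let ?t = "\<lambda>h. Arr2 (rho h \<box> F) F (\<tau> h)" and ?t' = "\<lambda>h. Arr2 (rho h \<box> F') F' (\<tau>' h)"
      and ?t'' = "\<lambda>h. Arr2 (rho h \<box> F'') F'' (\<tau>'' h)"
    have f: "wf2 ?f" "\<And>h. h \<in> carrier G \<Longrightarrow> ?t' h \<bullet> (rho h \<rhd> ?f) = ?f \<bullet> ?t h"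
      using fg(1) eqv_arr_iff[OF x(2-4) y(2-4)] unfolding x(1) y(1) by auto
    have g: "wf2 ?g" "\<And>h. h \<in> carrier G \<Longrightarrow> ?t'' h \<bullet> (rho h \<rhd> ?g) = ?g \<bullet> ?t' h"
      using fg(2) eqv_arr_iff[OF y(2-4) z(2-4)] unfolding z(1) y(1) by auto
    have gf: "?g \<bullet> ?f = Arr2 F F'' (g \<cdot> f)" by (rule arr2_eqI) (simp_all add: cell_comp)
    have "?t'' h \<bullet> (rho h \<rhd> (?g \<bullet> ?f)) = (?g \<bullet> ?f) \<bullet> ?t h" if h: "h \<in> carrier G" for h
    proof -
      have "?t'' h \<bullet> (rho h \<rhd> (?g \<bullet> ?f)) = (?t'' h \<bullet> (rho h \<rhd> ?g)) \<bullet> (rho h \<rhd> ?f)"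
        using f(1) g(1) h x y z by simp
      also have "\<dots> = ?g \<bullet> (?t' h \<bullet> (rho h \<rhd> ?f))" unfolding g(2)[OF h] using f(1) g(1) h x y z by simp
      also have "\<dots> = (?g \<bullet> ?f) \<bullet> ?t h" unfolding f(2)[OF h] using f(1) g(1) h x y z by simp
      finally show ?thesis .
    qed
    moreover have "wf2 (?g \<bullet> ?f)" using f(1) g(1) by simp
    ultimately show "g \<cdot> f \<in> Arr ?A x z"
      unfolding x(1) z(1) eqv_arr_iff[OF x(2-4) z(2-4)] gf by blast
  next
    fix w x y z f g h assume "w \<in> Obj ?A" "x \<in> Obj ?A" "y \<in> Obj ?A" "z \<in> Obj ?A"
      and fgh: "f \<in> Arr ?A w x" "g \<in> Arr ?A x y" "h \<in> Arr ?A y z"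
    then obtain D \<sigma> F \<tau> F' \<tau>' F'' \<tau>''
      where w: "w = (mor D, \<sigma>)" "wf1 D" "src D = W" "tgt D = V"
      and x: "x = (mor F, \<tau>)" "wf1 F" "src F = W" "tgt F = V"
      and y: "y = (mor F', \<tau>')" "wf1 F'" "src F' = W" "tgt F' = V"
      and z: "z = (mor F'', \<tau>'')" "wf1 F''" "src F'' = W" "tgt F'' = V"
      using obj by metis
    have "wf2 (Arr2 D F f)" "wf2 (Arr2 F F' g)" "wf2 (Arr2 F' F'' h)"
      using fgh eqv_arr_iff[OF w(2-4) x(2-4)] eqv_arr_iff[OF x(2-4) y(2-4)] eqv_arr_iff[OF y(2-4) z(2-4)]
      unfolding w(1) x(1) y(1) z(1) by auto
    from cell_eq[OF vert_assoc[OF this(3,2,1)]] show "(h \<cdot> g) \<cdot> f = h \<cdot> (g \<cdot> f)"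
      by (simp add: cell_comp)
  next
    fix x y f assume "x \<in> Obj ?A" "y \<in> Obj ?A" and f: "f \<in> Arr ?A x y"
    then obtain F \<tau> F' \<tau>'
      where x: "x = (mor F, \<tau>)" "wf1 F" "src F = W" "tgt F = V"
      and y: "y = (mor F', \<tau>')" "wf1 F'" "src F' = W" "tgt F' = V"
      using obj by metis
    have "wf2 (Arr2 F F' f)"
      using f eqv_arr_iff[OF x(2-4) y(2-4)] unfolding x(1) y(1) by auto
    from cell_eq[OF vert_id(1)[OF this]] cell_eq[OF vert_id(2)[OF this]]
    show "ident ?A y \<cdot> f = f" "f \<cdot> ident ?A x = f"
      unfolding x(1) y(1) ident by (simp_all add: cell_comp)
  qed
qed

lemma triv_arr_subset:
  "\<beta> \<in> Arr (triv_cat C G W Q V R) (F, \<tau>, \<epsilon>) (F', \<tau>', \<epsilon>') \<longleftrightarrow>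
    \<beta> \<in> Arr (eqv_cat C G W Q V R) (F, \<tau>) (F', \<tau>') \<and>
    (\<forall>g\<in>carrier G. \<epsilon>' g \<cdot> \<beta> = (\<iota> (act R g) \<star> \<beta>) \<cdot> \<epsilon> g)"
  unfolding triv_cat_def eqv_cat_def by auto

lemma is_category_triv:
  assumes W: "W \<in> Ob C"
  shows "is_category (triv_cat C G W (triv_rep W) V R)"
proof -
  let ?A = "eqv_cat C G W (triv_rep W) V R" and ?B = "triv_cat C G W (triv_rep W) V R"
  note A = is_category_eqv[OF W]
  have objA: "(F, \<tau>) \<in> Obj ?A" if "(F, \<tau>, \<epsilon>) \<in> Obj ?B" for F \<tau> \<epsilon>
    using that unfolding eqv_cat_def triv_cat_def by auto
  have comp: "comp ?A = (\<cdot>)" "comp ?B = (\<cdot>)" by (simp_all add: eqv_cat_def triv_cat_def)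
  have ident: "ident ?B (F, \<tau>, \<epsilon>) = ident ?A (F, \<tau>)" for F \<tau> \<epsilon>
    by (simp add: eqv_cat_def triv_cat_def)
  have wf: "wf1 (Arr1 W V F)" "\<And>g. g \<in> carrier G \<Longrightarrow> isoc (Arr2 (Arr1 W V F) (rho g \<box> Arr1 W V F) (\<epsilon> g))"
    if "(F, \<tau>, \<epsilon>) \<in> Obj ?B" for F \<tau> \<epsilon>
  proof -
    have "is_equivariant C G W (triv_rep W) V R F \<tau>"
      and triv: "is_trivialization C G W (triv_rep W) V R F \<tau> \<epsilon>"
      using that unfolding triv_cat_def by auto
    then show wf: "wf1 (Arr1 W V F)" using equivariantD(1) W by blast
    show "\<And>g. g \<in> carrier G \<Longrightarrow> isoc (Arr2 (Arr1 W V F) (rho g \<box> Arr1 W V F) (\<epsilon> g))"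
      using trivializationD(1)[OF triv W wf] .
  qed
  show ?thesis unfolding is_category_def comp
  proof (intro conjI ballI)
    fix x y z f g assume ob: "x \<in> Obj ?B" "y \<in> Obj ?B" "z \<in> Obj ?B"
      and fg: "f \<in> Arr ?B x y" "g \<in> Arr ?B y z"
    obtain F \<tau> \<epsilon> F' \<tau>' \<epsilon>' F'' \<tau>'' \<epsilon>'' where xyz: "x = (F, \<tau>, \<epsilon>)" "y = (F', \<tau>', \<epsilon>')" "z = (F'', \<tau>'', \<epsilon>'')"
      by (cases x; cases y; cases z) auto
    let ?F = "Arr1 W V F" and ?F' = "Arr1 W V F'" and ?F'' = "Arr1 W V F''"
    let ?f = "Arr2 ?F ?F' f" and ?g = "Arr2 ?F' ?F'' g"
    note [simp] = wf[OF ob(1)[unfolded xyz]] wf[OF ob(2)[unfolded xyz]] wf[OF ob(3)[unfolded xyz]]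
    let ?e = "\<lambda>h. Arr2 ?F (rho h \<box> ?F) (\<epsilon> h)" and ?e' = "\<lambda>h. Arr2 ?F' (rho h \<box> ?F') (\<epsilon>' h)"
      and ?e'' = "\<lambda>h. Arr2 ?F'' (rho h \<box> ?F'') (\<epsilon>'' h)"
    have f [simp]: "wf2 ?f" and fe: "\<And>h. h \<in> carrier G \<Longrightarrow> ?e' h \<bullet> ?f = (rho h \<rhd> ?f) \<bullet> ?e h"
      using fg(1) triv_arr_iff[of ?F W ?F' f \<tau> \<epsilon> \<tau>' \<epsilon>'] unfolding xyz by auto
    have g [simp]: "wf2 ?g" and ge: "\<And>h. h \<in> carrier G \<Longrightarrow> ?e'' h \<bullet> ?g = (rho h \<rhd> ?g) \<bullet> ?e' h"
      using fg(2) triv_arr_iff[of ?F' W ?F'' g \<tau>' \<epsilon>' \<tau>'' \<epsilon>''] unfolding xyz by auto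
    have gf: "cell (?g \<bullet> ?f) = g \<cdot> f" by (simp add: cell_comp)
    have "\<epsilon>'' h \<cdot> (g \<cdot> f) = (\<iota> (act R h) \<star> (g \<cdot> f)) \<cdot> \<epsilon> h" if h: "h \<in> carrier G" for h
    proof -
      have "?e'' h \<bullet> (?g \<bullet> ?f) = (?e'' h \<bullet> ?g) \<bullet> ?f" using h by simp
      also have "\<dots> = (rho h \<rhd> ?g) \<bullet> (?e' h \<bullet> ?f)" unfolding ge[OF h] using h by simp
      also have "\<dots> = (rho h \<rhd> (?g \<bullet> ?f)) \<bullet> ?e h" unfolding fe[OF h] using h by simp
      finally have "?e'' h \<bullet> (?g \<bullet> ?f) = (rho h \<rhd> (?g \<bullet> ?f)) \<bullet> ?e h" .
      from cell_eq[OF this] show ?thesis by (simp only: cell_comp rep_cell arr2.sel)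
    qed
    moreover have "g \<cdot> f \<in> Arr ?A (F, \<tau>) (F'', \<tau>'')"
      using is_categoryD(1)[OF A objA[OF ob(1)[unfolded xyz]] objA[OF ob(2)[unfolded xyz]]
          objA[OF ob(3)[unfolded xyz]], of f g] fg triv_arr_subset unfolding xyz comp by blast
    ultimately show "g \<cdot> f \<in> Arr ?B x z" unfolding xyz triv_arr_subset by blast
  next
    fix w x y z f g h assume ob: "w \<in> Obj ?B" "x \<in> Obj ?B" "y \<in> Obj ?B" "z \<in> Obj ?B"
      and fgh: "f \<in> Arr ?B w x" "g \<in> Arr ?B x y" "h \<in> Arr ?B y z"
    obtain D \<sigma> \<delta> F \<tau> \<epsilon> F' \<tau>' \<epsilon>' F'' \<tau>'' \<epsilon>'' where wxyz: "w = (D, \<sigma>, \<delta>)" "x = (F, \<tau>, \<epsilon>)"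
      "y = (F', \<tau>', \<epsilon>')" "z = (F'', \<tau>'', \<epsilon>'')"
      by (cases w; cases x; cases y; cases z) auto
    show "(h \<cdot> g) \<cdot> f = h \<cdot> (g \<cdot> f)"
      using is_categoryD(2)[OF A objA[OF ob(1)[unfolded wxyz]] objA[OF ob(2)[unfolded wxyz]]
          objA[OF ob(3)[unfolded wxyz]] objA[OF ob(4)[unfolded wxyz]], of f g h] fgh triv_arr_subset
      unfolding wxyz comp by blast
  next
    fix x y f assume ob: "x \<in> Obj ?B" "y \<in> Obj ?B" and f: "f \<in> Arr ?B x y"
    obtain F \<tau> \<epsilon> F' \<tau>' \<epsilon>' where xy: "x = (F, \<tau>, \<epsilon>)" "y = (F', \<tau>', \<epsilon>')"
      by (cases x; cases y) auto
    show "ident ?B y \<cdot> f = f" "f \<cdot> ident ?B x = f"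
      using is_categoryD(3,4)[OF A objA[OF ob(1)[unfolded xy]] objA[OF ob(2)[unfolded xy]], of f]
        f triv_arr_subset unfolding xy comp ident by blast+
  qed
qed

section \<open>Conjugation by an action, and the regular action\<close>

text \<open>
  The equation \<open>\<phi>\<^sub>c\<^sub>,\<^sub>s \<cdot> \<psi>\<^sub>s(\<xi>) \<rho>(s) = \<phi>\<^sub>s\<^sub>,\<^sub>g \<cdot> \<rho>(s) \<xi>\<close> says that \<open>\<psi>\<^sub>s\<close> moves \<open>\<xi>\<close> from the right of \<open>\<rho>(s)\<close> to its left. It
  replaces the definition of \<open>\<psi>\<^sub>s\<close> in all later arguments, as it contains no inverses.
\<close>

lemma psi_intertwines:
  assumes s [simp]: "s \<in> carrier G" and g [simp]: "g \<in> carrier G" and \<xi>: "\<xi> \<in> hom2 (id1 V) (rho g)"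
  defines "c \<equiv> s \<otimes>\<^bsub>G\<^esub> g \<otimes>\<^bsub>G\<^esub> inv\<^bsub>G\<^esub> s"
  obtains \<psi> where "\<psi> \<in> hom2 (id1 V) (rho c)" "cell \<psi> = psi C G V R s g (cell \<xi>)"
    "Phi c s \<bullet> (\<psi> \<lhd> rho s) = Phi s g \<bullet> (rho s \<rhd> \<xi>)"
proof
  note [simp] = hom2D[OF \<xi>]
  let ?t = "inv\<^bsub>G\<^esub> s" and ?one = "\<one>\<^bsub>G\<^esub>"
  \<comment> \<open>the counit \<open>\<rho>(s\<inverse>) \<rho>(s) \<Rightarrow> id\<close> of the adjunction between \<open>\<rho>(s\<inverse>)\<close> and \<open>\<rho>(s)\<close>\<close>
  define w where "w = phi1 \<bullet> Phi ?t s"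
  have c [simp]: "c \<in> carrier G" unfolding c_def by simp
  have w [simp]: "wf2 w" "dm w = rho ?t \<box> rho s" "cd w = id1 V" unfolding w_def by simp_all
  let ?\<psi> = "Phi (s \<otimes>\<^bsub>G\<^esub> g) ?t \<bullet> (Phi s g \<lhd> rho ?t) \<bullet> (rho s \<rhd> \<xi> \<lhd> rho ?t) \<bullet> Inv (Phi s ?t) \<bullet> Inv phi1"
  show hom: "?\<psi> \<in> hom2 (id1 V) (rho c)" by (intro hom2I) (simp_all add: c_def)
  have "?\<psi> = (((Phi (s \<otimes>\<^bsub>G\<^esub> g) ?t \<bullet> (Phi s g \<lhd> rho ?t)) \<bullet> ((rho s \<rhd> \<xi>) \<lhd> rho ?t)) \<bullet> Inv (Phi s ?t)) \<bullet> Inv phi1"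
    by simp
  from cell_eq[OF this] show "cell ?\<psi> = psi C G V R s g (cell \<xi>)"
    unfolding psi_def Let_def by (simp only: cell_comp rep_cell Inv_def[of phi1] Inv_def[of "Phi _ _"]
        rep_sel arr2.sel mor_comp r_inv s)
  \<comment> \<open>the triangle identity, relating \<open>w\<close> to the isomorphism \<open>\<rho>(s) \<rho>(s\<inverse>) \<Rightarrow> id\<close> inverted in \<open>\<psi>\<^sub>s\<close>\<close>
  have w_triangle: "rho s \<rhd> w = (phi1 \<lhd> rho s) \<bullet> (Phi s ?t \<lhd> rho s)"
  proof -
    have "rho s \<rhd> w = Phi s ?one \<bullet> (rho s \<rhd> Phi ?t s)" unfolding w_def by (simp add: Phi_unit)
    also have "\<dots> = Phi ?one s \<bullet> (Phi s ?t \<lhd> rho s)" using Phi_assoc[of s ?t s] by simp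
    finally show ?thesis by (simp add: Phi_unit)
  qed
  have "Phi c s \<bullet> (Phi (s \<otimes>\<^bsub>G\<^esub> g) ?t \<lhd> rho s) = Phi (s \<otimes>\<^bsub>G\<^esub> g) ?one \<bullet> (rho (s \<otimes>\<^bsub>G\<^esub> g) \<rhd> Phi ?t s)"
    using Phi_assoc[of "s \<otimes>\<^bsub>G\<^esub> g" ?t s] by (simp add: c_def)
  then have 1: "Phi c s \<bullet> (Phi (s \<otimes>\<^bsub>G\<^esub> g) ?t \<lhd> rho s) = rho (s \<otimes>\<^bsub>G\<^esub> g) \<rhd> w"
    unfolding w_def by (simp add: Phi_unit)
  have 2: "(rho (s \<otimes>\<^bsub>G\<^esub> g) \<rhd> w) \<bullet> (Phi s g \<lhd> rho ?t \<lhd> rho s) = Phi s g \<bullet> (rho s \<rhd> rho g \<rhd> w)"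
    using exchange[of w "Phi s g"] by simp
  have 3: "(rho g \<rhd> w) \<bullet> (\<xi> \<lhd> rho ?t \<lhd> rho s) = \<xi> \<bullet> w"
    using exchange[of w \<xi>] by simp
  let ?rest = "(Inv (Phi s ?t) \<lhd> rho s) \<bullet> (Inv phi1 \<lhd> rho s)"
  have "Phi c s \<bullet> (?\<psi> \<lhd> rho s) = (Phi c s \<bullet> (Phi (s \<otimes>\<^bsub>G\<^esub> g) ?t \<lhd> rho s)) \<bullet>
      (Phi s g \<lhd> rho ?t \<lhd> rho s) \<bullet> (rho s \<rhd> \<xi> \<lhd> rho ?t \<lhd> rho s) \<bullet> ?rest"
    by (simp add: c_def m_assoc)
  also have "\<dots> = ((rho (s \<otimes>\<^bsub>G\<^esub> g) \<rhd> w) \<bullet> (Phi s g \<lhd> rho ?t \<lhd> rho s)) \<bullet>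
      (rho s \<rhd> \<xi> \<lhd> rho ?t \<lhd> rho s) \<bullet> ?rest"
    unfolding 1 by simp
  also have "\<dots> = Phi s g \<bullet> (rho s \<rhd> ((rho g \<rhd> w) \<bullet> (\<xi> \<lhd> rho ?t \<lhd> rho s))) \<bullet> ?rest"
    unfolding 2 by simp
  also have "\<dots> = Phi s g \<bullet> (rho s \<rhd> \<xi>) \<bullet> (rho s \<rhd> w) \<bullet> ?rest"
    unfolding 3 by simp
  also have "\<dots> = Phi s g \<bullet> (rho s \<rhd> \<xi>)"
    unfolding w_triangle by simp
  finally show "Phi c s \<bullet> (?\<psi> \<lhd> rho s) = Phi s g \<bullet> (rho s \<rhd> \<xi>)" .
qed

text \<open>
  For an action of an actual group on a vector space this is \<open>x \<mapsto> s x s\<inverse>\<close>; its fixed points are the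
  endomorphisms of \<open>F\<close> that commute with the action.
\<close>

definition conj_act :: "('g \<Rightarrow> ('o, 'm, 'c) arr2) \<Rightarrow> 'g \<Rightarrow> ('o, 'm, 'c) arr2 \<Rightarrow> ('o, 'm, 'c) arr2" where
  "conj_act a s x = a s \<bullet> (rho s \<rhd> x) \<bullet> Inv (a s)"

lemma conj_act_hom2:
  assumes "action F a" "s \<in> carrier G" "x \<in> hom2 F F"
  shows "conj_act a s x \<in> hom2 F F"
  unfolding conj_act_def using actionD(1-5)[OF assms(1)] assms(2) hom2D[OF assms(3)]
  by (intro hom2I) simp_all

lemma conj_act_mult:
  assumes a: "action F a" and s [simp]: "s \<in> carrier G" and t [simp]: "t \<in> carrier G"
    and x: "x \<in> hom2 F F"
  shows "conj_act a s (conj_act a t x) = conj_act a (s \<otimes>\<^bsub>G\<^esub> t) x"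
proof -
  note [simp] = actionD(1-5)[OF a] hom2D[OF x]
  let ?P = "Phi s t \<lhd> F" and ?iP = "Inv (Phi s t) \<lhd> F" and ?st = "s \<otimes>\<^bsub>G\<^esub> t"
  have "a ?st = (a ?st \<bullet> ?P) \<bullet> ?iP" by simp
  then have st: "a ?st = a s \<bullet> (rho s \<rhd> a t) \<bullet> ?iP" using actionD(6)[OF a s t] by simp
  have "?iP \<bullet> (rho ?st \<rhd> x) = (rho s \<rhd> rho t \<rhd> x) \<bullet> ?iP"
    using exchange[of x "Inv (Phi s t)"] by simp
  then have ex: "?iP \<bullet> (rho ?st \<rhd> x) \<bullet> ?P = rho s \<rhd> rho t \<rhd> x"
    by (simp add: vert_assoc[symmetric] del: vert_assoc) simp
  have "conj_act a ?st x = a s \<bullet> (rho s \<rhd> a t) \<bullet> (?iP \<bullet> (rho ?st \<rhd> x) \<bullet> ?P) \<bullet>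
      (rho s \<rhd> Inv (a t)) \<bullet> Inv (a s)"
    unfolding conj_act_def st by simp
  also have "\<dots> = conj_act a s (conj_act a t x)"
    unfolding ex conj_act_def by simp
  finally show ?thesis by simp
qed

lemma conj_act_fixed_iff:
  assumes a: "action F a" and s [simp]: "s \<in> carrier G" and x: "x \<in> hom2 F F"
  shows "conj_act a s x = x \<longleftrightarrow> x \<bullet> a s = a s \<bullet> (rho s \<rhd> x)"
proof -
  note [simp] = actionD(1-5)[OF a] hom2D[OF x]
  have "x \<bullet> a s = a s \<bullet> (rho s \<rhd> x)" if "conj_act a s x = x"
  proof -
    have "conj_act a s x \<bullet> a s = a s \<bullet> (rho s \<rhd> x)" unfolding conj_act_def by simp
    then show ?thesis using that by simp
  qed
  moreover have "conj_act a s x = x" if "x \<bullet> a s = a s \<bullet> (rho s \<rhd> x)"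
  proof -
    have "conj_act a s x = (x \<bullet> a s) \<bullet> Inv (a s)" unfolding that conj_act_def by simp
    then show ?thesis by simp
  qed
  ultimately show ?thesis by blast
qed

text \<open>
  In \<open>a\<^sub>s \<cdot> \<rho>(s) a\<^sub>g = a\<^sub>s\<^sub>g \<cdot> \<phi>\<^sub>s\<^sub>,\<^sub>g F\<close> the last factor meets \<open>\<rho>(s) \<xi>\<close>, and \<open>\<phi>\<^sub>s\<^sub>,\<^sub>g \<cdot> \<rho>(s) \<xi>\<close> is \<open>\<phi>\<^sub>c\<^sub>,\<^sub>s \<cdot> \<psi> \<rho>(s)\<close>. Reading the
  cocycle condition backwards for \<open>c s = s g\<close> leaves \<open>a\<^sub>c \<cdot> \<psi> F\<close>.
\<close>

lemma conj_act_psi: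
  assumes a: "action F a" and s [simp]: "s \<in> carrier G" and g [simp]: "g \<in> carrier G"
    and \<xi>: "\<xi> \<in> hom2 (id1 V) (rho g)"
  defines "c \<equiv> s \<otimes>\<^bsub>G\<^esub> g \<otimes>\<^bsub>G\<^esub> inv\<^bsub>G\<^esub> s"
  assumes \<psi>: "\<psi> \<in> hom2 (id1 V) (rho c)" "Phi c s \<bullet> (\<psi> \<lhd> rho s) = Phi s g \<bullet> (rho s \<rhd> \<xi>)"
  shows "conj_act a s (a g \<bullet> (\<xi> \<lhd> F)) = a c \<bullet> (\<psi> \<lhd> F)"
proof -
  note [simp] = actionD(1-5)[OF a] hom2D[OF \<xi>] hom2D[OF \<psi>(1)]
  have c [simp]: "c \<in> carrier G" unfolding c_def by simp
  have cs: "c \<otimes>\<^bsub>G\<^esub> s = s \<otimes>\<^bsub>G\<^esub> g" unfolding c_def by (simp add: m_assoc)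
  have "conj_act a s (a g \<bullet> (\<xi> \<lhd> F)) = (a s \<bullet> (rho s \<rhd> a g)) \<bullet> (rho s \<rhd> \<xi> \<lhd> F) \<bullet> Inv (a s)"
    unfolding conj_act_def by simp
  also have "\<dots> = a (s \<otimes>\<^bsub>G\<^esub> g) \<bullet> ((Phi s g \<bullet> (rho s \<rhd> \<xi>)) \<lhd> F) \<bullet> Inv (a s)"
    unfolding actionD(6)[OF a s g, symmetric] by simp
  also have "\<dots> = (a (c \<otimes>\<^bsub>G\<^esub> s) \<bullet> (Phi c s \<lhd> F)) \<bullet> (\<psi> \<lhd> rho s \<lhd> F) \<bullet> Inv (a s)"
    unfolding \<psi>(2)[symmetric] cs[symmetric] by simp
  also have "\<dots> = a c \<bullet> ((rho c \<rhd> a s) \<bullet> (\<psi> \<lhd> rho s \<lhd> F)) \<bullet> Inv (a s)"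
    unfolding actionD(6)[OF a c s] by simp
  also have "(rho c \<rhd> a s) \<bullet> (\<psi> \<lhd> rho s \<lhd> F) = (\<psi> \<lhd> F) \<bullet> a s"
    using exchange[of "a s" \<psi>] by simp
  finally show ?thesis by simp
qed

text \<open>
  The analogue of the regular representation: on \<open>A = \<Oplus>\<^sub>h \<rho>(h)\<close> the action of \<open>g\<close> maps the summand \<open>\<rho>(g) \<rho>(h)\<close> of
  \<open>\<rho>(g) A\<close> to the summand \<open>\<rho>(g h)\<close> by \<open>\<phi>\<^sub>g\<^sub>,\<^sub>h\<close>.
\<close>

lemma regular_action:
  assumes fin: "finite (carrier G)"
  obtains A j p m where "is_biproduct (carrier G) rho A j p" "src A = V" "action A m"
    "\<And>g h. g \<in> carrier G \<Longrightarrow> h \<in> carrier G \<Longrightarrow> m g \<bullet> (rho g \<rhd> j h) = j (g \<otimes>\<^bsub>G\<^esub> h) \<bullet> Phi g h"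
proof -
  let ?K = "carrier G"
  obtain A j p where bp: "is_biproduct ?K rho A j p" and A_sel [simp]: "src A = V" "tgt A = V"
    using exists_biproduct[OF fin V_ob V_ob, of rho] by auto
  note BD = is_biproductD[OF bp]
  note [simp] = BD(2)
  have j [simp]: "wf2 (j h)" "dm (j h) = rho h" "cd (j h) = A" if "h \<in> ?K" for h
    using hom2D[OF BD(3)[OF that]] .
  have bpl: "is_biproduct ?K (\<lambda>h. rho g \<box> rho h) (rho g \<box> A) (\<lambda>h. rho g \<rhd> j h) (\<lambda>h. rho g \<rhd> p h)"
    if "g \<in> ?K" for g
    by (rule biproduct_lwhisk[OF bp]) (use that in simp_all)
  have "\<exists>m. m \<in> hom2 (rho g \<box> A) A \<and> (\<forall>h\<in>?K. m \<bullet> (rho g \<rhd> j h) = j (g \<otimes>\<^bsub>G\<^esub> h) \<bullet> Phi g h)"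
    if g: "g \<in> ?K" for g
  proof -
    obtain m where "m \<in> hom2 (rho g \<box> A) A"
      "\<And>h. h \<in> ?K \<Longrightarrow> m \<bullet> (rho g \<rhd> j h) = j (g \<otimes>\<^bsub>G\<^esub> h) \<bullet> Phi g h"
      by (rule biproduct_copair[OF bpl[OF g], of "\<lambda>h. j (g \<otimes>\<^bsub>G\<^esub> h) \<bullet> Phi g h" A])
        (use g in \<open>simp_all add: hom2_def parallel_def\<close>)
    then show ?thesis by blast
  qed
  then have "\<forall>g\<in>?K. \<exists>m. m \<in> hom2 (rho g \<box> A) A \<and> (\<forall>h\<in>?K. m \<bullet> (rho g \<rhd> j h) = j (g \<otimes>\<^bsub>G\<^esub> h) \<bullet> Phi g h)"
    by blast
  from bchoice[OF this] obtain m where m_hom: "\<And>g. g \<in> ?K \<Longrightarrow> m g \<in> hom2 (rho g \<box> A) A"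
    and m_j: "\<And>g h. g \<in> ?K \<Longrightarrow> h \<in> ?K \<Longrightarrow> m g \<bullet> (rho g \<rhd> j h) = j (g \<otimes>\<^bsub>G\<^esub> h) \<bullet> Phi g h"
    by blast
  have m [simp]: "wf2 (m g)" "dm (m g) = rho g \<box> A" "cd (m g) = A" if "g \<in> ?K" for g
    using hom2D[OF m_hom[OF that]] .
  have m_j': "m g \<bullet> (rho g \<rhd> j h) \<bullet> x = j (g \<otimes>\<^bsub>G\<^esub> h) \<bullet> Phi g h \<bullet> x"
    if "g \<in> ?K" "h \<in> ?K" "wf2 x" "cd x = rho g \<box> rho h" for g h x
    using arg_cong[OF m_j[OF that(1,2)], of "\<lambda>y. y \<bullet> x"] that by simp
  have iso: "isoc (m g)" if g [simp]: "g \<in> ?K" for g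
  proof -
    let ?l = "\<lambda>k. inv\<^bsub>G\<^esub> g \<otimes>\<^bsub>G\<^esub> k"
    have gl [simp]: "g \<otimes>\<^bsub>G\<^esub> ?l k = k" if "k \<in> ?K" for k
      using that by (simp add: m_assoc[symmetric])
    \<comment> \<open>translation back: the summand at \<open>k\<close> comes from \<open>\<rho>(g)\<close> applied to the summand at \<open>g\<inverse> k\<close>\<close>
    obtain n where n: "n \<in> hom2 A (rho g \<box> A)"
      and n_j: "\<And>k. k \<in> ?K \<Longrightarrow> n \<bullet> j k = (rho g \<rhd> j (?l k)) \<bullet> Inv (Phi g (?l k))"
      by (rule biproduct_copair[OF bp, of "\<lambda>k. (rho g \<rhd> j (?l k)) \<bullet> Inv (Phi g (?l k))" "rho g \<box> A"])
        (simp_all add: hom2_def parallel_def)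
    note [simp] = hom2D[OF n]
    have "m g \<bullet> n = id2 A"
    proof (rule biproduct_eqI[OF bp])
      show "(m g \<bullet> n) \<bullet> j k = id2 A \<bullet> j k" if [simp]: "k \<in> ?K" for k
        by (simp add: n_j m_j')
    qed (simp_all add: hom2_def)
    moreover have "n \<bullet> m g = id2 (rho g \<box> A)"
    proof (rule biproduct_eqI[OF bpl[OF g]])
      fix h assume [simp]: "h \<in> ?K"
      have [simp]: "inv\<^bsub>G\<^esub> g \<otimes>\<^bsub>G\<^esub> (g \<otimes>\<^bsub>G\<^esub> h) = h" by (simp add: m_assoc[symmetric])
      have "(n \<bullet> m g) \<bullet> (rho g \<rhd> j h) = (n \<bullet> j (g \<otimes>\<^bsub>G\<^esub> h)) \<bullet> Phi g h" by (simp add: m_j)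
      also have "\<dots> = id2 (rho g \<box> A) \<bullet> (rho g \<rhd> j h)" by (simp add: n_j)
      finally show "(n \<bullet> m g) \<bullet> (rho g \<rhd> j h) = id2 (rho g \<box> A) \<bullet> (rho g \<rhd> j h)" .
    qed (simp_all add: hom2_def)
    ultimately show ?thesis by (intro InvI[of "m g" n]) simp_all
  qed
  have cocycle: "m (g \<otimes>\<^bsub>G\<^esub> h) \<bullet> (Phi g h \<lhd> A) = m g \<bullet> (rho g \<rhd> m h)"
    if g [simp]: "g \<in> ?K" and h [simp]: "h \<in> ?K" for g h
  proof (rule biproduct_eqI)
    show "is_biproduct ?K (\<lambda>k. (rho g \<box> rho h) \<box> rho k) ((rho g \<box> rho h) \<box> A)
        (\<lambda>k. (rho g \<box> rho h) \<rhd> j k) (\<lambda>k. (rho g \<box> rho h) \<rhd> p k)"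
      by (rule biproduct_lwhisk[OF bp]) simp_all
    fix k assume [simp]: "k \<in> ?K"
    have "(m (g \<otimes>\<^bsub>G\<^esub> h) \<bullet> (Phi g h \<lhd> A)) \<bullet> ((rho g \<box> rho h) \<rhd> j k)
        = m (g \<otimes>\<^bsub>G\<^esub> h) \<bullet> (rho (g \<otimes>\<^bsub>G\<^esub> h) \<rhd> j k) \<bullet> (Phi g h \<lhd> rho k)"
      using exchange[of "j k" "Phi g h"] by simp
    also have "\<dots> = j (g \<otimes>\<^bsub>G\<^esub> h \<otimes>\<^bsub>G\<^esub> k) \<bullet> Phi (g \<otimes>\<^bsub>G\<^esub> h) k \<bullet> (Phi g h \<lhd> rho k)"
      by (simp add: m_j')
    also have "\<dots> = j (g \<otimes>\<^bsub>G\<^esub> (h \<otimes>\<^bsub>G\<^esub> k)) \<bullet> Phi g (h \<otimes>\<^bsub>G\<^esub> k) \<bullet> (rho g \<rhd> Phi h k)"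
      using Phi_assoc[OF g h, of k] by (simp add: m_assoc)
    also have "\<dots> = m g \<bullet> (rho g \<rhd> (j (h \<otimes>\<^bsub>G\<^esub> k) \<bullet> Phi h k))" by (simp add: m_j')
    also have "\<dots> = (m g \<bullet> (rho g \<rhd> m h)) \<bullet> ((rho g \<box> rho h) \<rhd> j k)"
      unfolding m_j[OF h \<open>k \<in> ?K\<close>, symmetric] by simp
    finally show "(m (g \<otimes>\<^bsub>G\<^esub> h) \<bullet> (Phi g h \<lhd> A)) \<bullet> ((rho g \<box> rho h) \<rhd> j k)
        = (m g \<bullet> (rho g \<rhd> m h)) \<bullet> ((rho g \<box> rho h) \<rhd> j k)" .
  qed (simp_all add: hom2_def)
  have "action A m" unfolding action_def using iso cocycle by simp
  then show thesis using that[OF bp A_sel(1)] m_j by blast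
qed

end

section \<open>The universal property of the fixed object\<close>

locale fixed_object = linear_2category C + group G + V: two_rep C G V R + X: two_rep C G X S
  for C :: "('k::field, 'o, 'm, 'c::ab_group_add) lin2cat" (structure)
    and G :: "('g, 'z) monoid_scheme" and V R X S +
  fixes \<epsilon> :: "'g \<Rightarrow> 'c" and Um :: 'm and \<tau>U :: "'g \<Rightarrow> 'c"
  assumes fixed: "is_fixed_object C G V R X S \<epsilon> Um \<tau>U"
begin

definition U :: "('o, 'm) arr1" where "U = Arr1 X V Um"

definition flip :: "'g \<Rightarrow> ('o, 'm, 'c) arr2" where
  "flip g = Arr2 (V.rho g \<box> U) (U \<box> X.rho g) (\<tau>U g)"

definition eps :: "'g \<Rightarrow> ('o, 'm, 'c) arr2" where
  "eps g = Arr2 (id1 X) (X.rho g) (\<epsilon> g)"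

text \<open>
  The inverse of the trivialization of \<open>U\<close> that is induced by the trivialization of the identity of \<open>X\<close>.
\<close>

definition u :: "'g \<Rightarrow> ('o, 'm, 'c) arr2" where
  "u g = (U \<rhd> Inv (eps g)) \<bullet> flip g"

lemma sel_U [simp]: "src U = X" "tgt U = V" "dm (flip g) = V.rho g \<box> U" "cd (flip g) = U \<box> X.rho g"
  "dm (eps g) = id1 X" "cd (eps g) = X.rho g"
  by (simp_all add: U_def flip_def eps_def)

lemma cell_U: "mor U = Um" "cell (flip g) = \<tau>U g" "cell (eps g) = \<epsilon> g"
  by (simp_all add: U_def flip_def eps_def)

lemma wf_U [simp]: "wf1 U"
  using fixed unfolding is_fixed_object_def is_equivariant_def wf1_def by (simp add: U_def)

lemma isoc_flip [simp]: "g \<in> carrier G \<Longrightarrow> isoc (flip g)"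
  using fixed unfolding is_fixed_object_def is_equivariant_def
  by (subst isoc_iff_iso2) (simp_all add: cell_U mor_comp V.rep_cell X.rep_cell)

lemma eps_action: "X.action (id1 X) (\<lambda>g. Inv (eps g))" "\<And>g. g \<in> carrier G \<Longrightarrow> isoc (eps g)"
proof -
  have triv: "is_trivialization C G X S X S (idm C X) (\<lambda>g. \<iota> (act S g)) \<epsilon>"
    using fixed unfolding is_fixed_object_def by blast
  have id: "Arr1 X X (idm C X) = id1 X" by (simp add: id1_def)
  have "Arr2 (id1 X) (X.rho g \<box> id1 X) (\<epsilon> g) = eps g" if "g \<in> carrier G" for g
    using that by (simp add: eps_def)
  note D = X.trivializationD[OF triv X.V_ob, unfolded id] and eq = this
  show "\<And>g. g \<in> carrier G \<Longrightarrow> isoc (eps g)" using D(1) eq by simp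
  show "X.action (id1 X) (\<lambda>g. Inv (eps g))" using D(2) eq unfolding X.action_def by simp
qed

lemmas isoc_eps [simp] = eps_action(2)

lemma u_sel [simp]: "g \<in> carrier G \<Longrightarrow> dm (u g) = V.rho g \<box> U" "g \<in> carrier G \<Longrightarrow> cd (u g) = U"
  "g \<in> carrier G \<Longrightarrow> isoc (u g)"
  by (simp_all add: u_def)

text \<open>
  The object part of the functor in the universal property.
\<close>

definition UF where
  "UF = (\<lambda>(F, \<sigma>).
             (Um \<odot> F,
              \<lambda>g. (\<iota> Um \<star> \<sigma> g) \<cdot> (\<tau>U g \<star> \<iota> F),
              \<lambda>g. (inv2 C (act R g \<odot> Um) (Um \<odot> act S g) (\<tau>U g) \<star> \<iota> F) \<cdot> (\<iota> Um \<star> \<epsilon> g \<star> \<iota> F)))"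

lemma equivalence:
  assumes "W \<in> Ob C"
  shows "is_equivalence (eqv_cat C G W (triv_rep W) X S) (triv_cat C G W (triv_rep W) V R)
     UF (\<lambda>_ _ \<eta>. \<iota> Um \<star> \<eta>)"
  using fixed V.is_rep2_triv_rep[OF assms] unfolding is_fixed_object_def UF_def by blast

text \<open>
  Every 1-morphism \<open>F : W \<rightarrow> X\<close> becomes equivariant for the trivial 2-representation on \<open>W\<close>, because the
  trivialization of the identity of \<open>X\<close> gives an action on \<open>F\<close>.
\<close>

definition lift_obj :: "('o, 'm) arr1 \<Rightarrow> 'm \<times> ('g \<Rightarrow> 'c)" where
  "lift_obj F = (mor F, \<lambda>g. cell (Inv (eps g) \<lhd> F))"

lemma lift_action:
  assumes "wf1 F" "tgt F = X"
  shows "X.action F (\<lambda>g. Inv (eps g) \<lhd> F)"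
  using X.action_comp[OF eps_action(1) assms(1)] assms by simp

lemma lift_obj:
  assumes "wf1 F" "tgt F = X"
  shows "lift_obj F \<in> Obj (eqv_cat C G (src F) (triv_rep (src F)) X S)"
  unfolding lift_obj_def eqv_cat_def using X.action_equivariant[OF lift_action[OF assms] refl] by simp

lemma UF_lift:
  assumes F: "wf1 F" "tgt F = X"
  shows "\<exists>\<tau> \<epsilon>'. UF (lift_obj F) = (mor (U \<box> F), \<tau>, \<epsilon>') \<and>
    (\<forall>g\<in>carrier G. \<tau> g = cell (u g \<lhd> F) \<and> \<epsilon>' g = cell (Inv (u g) \<lhd> F))"
proof (intro exI conjI ballI)
  show "UF (lift_obj F) = (mor (U \<box> F), \<lambda>g. (\<iota> Um \<star> cell (Inv (eps g) \<lhd> F)) \<cdot> (\<tau>U g \<star> \<iota> (mor F)),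
    \<lambda>g. (inv2 C (act R g \<odot> Um) (Um \<odot> act S g) (\<tau>U g) \<star> \<iota> (mor F)) \<cdot> (\<iota> Um \<star> \<epsilon> g \<star> \<iota> (mor F)))"
    unfolding UF_def lift_obj_def by (simp add: mor_comp cell_U)
  fix g assume g: "g \<in> carrier G"
  have "(U \<rhd> Inv (eps g) \<lhd> F) \<bullet> (flip g \<lhd> F) = u g \<lhd> F"
    using g F by (simp add: u_def)
  from cell_eq[OF this] show "(\<iota> Um \<star> cell (Inv (eps g) \<lhd> F)) \<cdot> (\<tau>U g \<star> \<iota> (mor F)) = cell (u g \<lhd> F)"
    by (simp only: cell_comp cell_U)
  have "(Inv (flip g) \<lhd> F) \<bullet> ((U \<rhd> eps g) \<lhd> F) = Inv (u g) \<lhd> F"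
    using g F by (simp add: u_def)
  from cell_eq[OF this]
  show "(inv2 C (act R g \<odot> Um) (Um \<odot> act S g) (\<tau>U g) \<star> \<iota> (mor F)) \<cdot> (\<iota> Um \<star> \<epsilon> g \<star> \<iota> (mor F))
      = cell (Inv (u g) \<lhd> F)"
    by (simp only: cell_comp cell_U Inv_def[of "flip g"] sel_U mor_comp V.rep_cell X.rep_cell arr2.sel)
qed

text \<open>
  The functor of the universal property maps the identity of \<open>X\<close> to a trivialized 1-morphism, whose
  trivialization is inverse to \<open>u\<close>.
\<close>

lemma u_action: "V.action U u"
proof -
  obtain \<tau> \<epsilon>' where UF: "UF (lift_obj (id1 X)) = (mor (U \<box> id1 X), \<tau>, \<epsilon>')"
    and \<epsilon>': "\<And>g. g \<in> carrier G \<Longrightarrow> \<epsilon>' g = cell (Inv (u g) \<lhd> id1 X)"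
    using UF_lift[OF wf_id1[OF X.V_ob]] by auto
  have "UF (lift_obj (id1 X)) \<in> Obj (triv_cat C G X (triv_rep X) V R)"
    using lift_obj[of "id1 X"] equivalence[OF X.V_ob]
    unfolding is_equivalence_def using is_functorD(1) by fastforce
  then have "is_trivialization C G X (triv_rep X) V R (mor U) \<tau> \<epsilon>'"
    unfolding UF triv_cat_def by simp
  from V.trivializationD(2)[OF this] have "V.action U (\<lambda>g. Inv (Arr2 U (V.rho g \<box> U) (\<epsilon>' g)))"
    by (simp add: U_def[symmetric] cell_U)
  moreover have "Inv (Arr2 U (V.rho g \<box> U) (\<epsilon>' g)) = u g" if "g \<in> carrier G" for g
    using \<epsilon>'[OF that] that by simp
  ultimately show ?thesis unfolding V.action_def by simp
qed

text \<open>
  By the exchange law every 2-cell between 1-morphisms into \<open>X\<close> commutes with the actions of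
  \<open>lift_action\<close>, so it is an arrow of the equivariant category.
\<close>

lemma U_faithful:
  assumes \<zeta>: "wf2 \<zeta>" "wf2 \<zeta>'" "dm \<zeta>' = dm \<zeta>" "cd \<zeta>' = cd \<zeta>" "tgt (dm \<zeta>) = X"
    and eq: "U \<rhd> \<zeta> = U \<rhd> \<zeta>'"
  shows "\<zeta> = \<zeta>'"
proof -
  let ?F = "dm \<zeta>" and ?F' = "cd \<zeta>"
  have F [simp]: "wf1 ?F" "wf1 ?F'" "src ?F' = src ?F" "tgt ?F = X" "tgt ?F' = X"
    using \<zeta> by simp_all
  have W: "src ?F \<in> Ob C" using F(1) by (rule wf1D)
  have arr: "cell \<xi> \<in> Arr (eqv_cat C G (src ?F) (triv_rep (src ?F)) X S) (lift_obj ?F) (lift_obj ?F')"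
    if \<xi>: "wf2 \<xi>" "dm \<xi> = ?F" "cd \<xi> = ?F'" for \<xi>
  proof -
    have "(Inv (eps g) \<lhd> ?F') \<bullet> (X.rho g \<rhd> \<xi>) = \<xi> \<bullet> (Inv (eps g) \<lhd> ?F)" if "g \<in> carrier G" for g
      using exchange[of \<xi> "Inv (eps g)"] \<xi> that by simp
    then show ?thesis unfolding lift_obj_def
      by (subst X.eqv_arr_iff) (use \<xi> in simp_all)
  qed
  have "cell \<zeta> = cell \<zeta>'"
  proof (rule equivalence_faithful[OF X.is_category_eqv[OF W] equivalence[OF W]])
    show "lift_obj ?F \<in> Obj (eqv_cat C G (src ?F) (triv_rep (src ?F)) X S)"
      "lift_obj ?F' \<in> Obj (eqv_cat C G (src ?F) (triv_rep (src ?F)) X S)"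
      using lift_obj[of ?F] lift_obj[of ?F'] by simp_all
    show "\<iota> Um \<star> cell \<zeta> = \<iota> Um \<star> cell \<zeta>'" using cell_eq[OF eq] by (simp add: cell_comp cell_U)
  qed (use arr \<zeta> in simp_all)
  then show ?thesis using \<zeta> by (intro arr2_eqI) simp_all
qed

lemma U_full:
  assumes F: "wf1 F" "tgt F = X" and F': "wf1 F'" "tgt F' = X" and src: "src F' = src F"
    and \<eta>: "wf2 \<eta>" "dm \<eta> = U \<box> F" "cd \<eta> = U \<box> F'"
    and equiv: "\<And>g. g \<in> carrier G \<Longrightarrow> \<eta> \<bullet> (u g \<lhd> F) = (u g \<lhd> F') \<bullet> (V.rho g \<rhd> \<eta>)"
  obtains \<zeta> where "wf2 \<zeta>" "dm \<zeta> = F" "cd \<zeta> = F'" "U \<rhd> \<zeta> = \<eta>"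
proof -
  let ?W = "src F"
  note [simp] = F F' src \<eta>
  have W: "?W \<in> Ob C" using F(1) by (rule wf1D)
  obtain \<tau> \<epsilon>F where UF: "UF (lift_obj F) = (mor (U \<box> F), \<tau>, \<epsilon>F)"
    "\<And>g. g \<in> carrier G \<Longrightarrow> \<tau> g = cell (u g \<lhd> F)" "\<And>g. g \<in> carrier G \<Longrightarrow> \<epsilon>F g = cell (Inv (u g) \<lhd> F)"
    using UF_lift[OF F] by blast
  obtain \<tau>' \<epsilon>F' where UF': "UF (lift_obj F') = (mor (U \<box> F'), \<tau>', \<epsilon>F')"
    "\<And>g. g \<in> carrier G \<Longrightarrow> \<tau>' g = cell (u g \<lhd> F')" "\<And>g. g \<in> carrier G \<Longrightarrow> \<epsilon>F' g = cell (Inv (u g) \<lhd> F')"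
    using UF_lift[OF F'] by blast
  \<comment> \<open>commuting with the trivializations is the same as commuting with the actions inverse to them\<close>
  have equiv': "(Inv (u g) \<lhd> F') \<bullet> \<eta> = (V.rho g \<rhd> \<eta>) \<bullet> (Inv (u g) \<lhd> F)" if g: "g \<in> carrier G" for g
  proof -
    have "(Inv (u g) \<lhd> F') \<bullet> \<eta> = (Inv (u g) \<lhd> F') \<bullet> (\<eta> \<bullet> (u g \<lhd> F)) \<bullet> (Inv (u g) \<lhd> F)"
      using g by simp
    then show ?thesis unfolding equiv[OF g] using g by simp
  qed
  have "cell \<eta> \<in> Arr (triv_cat C G ?W (triv_rep ?W) V R) (UF (lift_obj F)) (UF (lift_obj F'))"
    unfolding UF(1) UF'(1)
    by (subst V.triv_arr_iff) (use equiv equiv' in \<open>simp_all add: UF UF'\<close>)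
  moreover have "lift_obj F \<in> Obj (eqv_cat C G ?W (triv_rep ?W) X S)"
      "lift_obj F' \<in> Obj (eqv_cat C G ?W (triv_rep ?W) X S)"
      using lift_obj[OF F] lift_obj[OF F'] by simp_all
  ultimately obtain \<beta> where \<beta>: "\<beta> \<in> Arr (eqv_cat C G ?W (triv_rep ?W) X S) (lift_obj F) (lift_obj F')"
    "\<iota> Um \<star> \<beta> = cell \<eta>"
    using equivalence_full[OF X.is_category_eqv[OF W] V.is_category_triv[OF W] equivalence[OF W]]
    by blast
  have "wf2 (Arr2 F F' \<beta>)"
    using \<beta>(1) X.eqv_arr_iff[of F ?W F' \<beta>] unfolding lift_obj_def by auto
  then show thesis
    by (rule that) (use \<beta>(2) in \<open>auto intro!: arr2_eqI simp: cell_comp cell_U\<close>)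
qed

text \<open>
  Essential surjectivity of the functor in the universal property, for the trivialized 1-morphism that
  belongs to the action.
\<close>

lemma action_realized:
  assumes act: "V.action A m"
  obtains I \<kappa> where "wf1 I" "src I = src A" "tgt I = X" "isoc \<kappa>" "dm \<kappa> = U \<box> I" "cd \<kappa> = A"
    "\<And>g. g \<in> carrier G \<Longrightarrow> \<kappa> \<bullet> (u g \<lhd> I) = m g \<bullet> (V.rho g \<rhd> \<kappa>)"
proof -
  let ?W = "src A"
  let ?A = "eqv_cat C G ?W (triv_rep ?W) X S" and ?B = "triv_cat C G ?W (triv_rep ?W) V R"
  note [simp] = V.actionD(1-5)[OF act]
  have W [simp]: "?W \<in> Ob C" using V.actionD(1)[OF act] by (rule wf1D)
  have obj: "(mor A, \<lambda>g. cell (m g), \<lambda>g. cell (Inv (m g))) \<in> Obj ?B"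
    using V.action_equivariant[OF act refl] V.action_trivialization[OF act refl]
    unfolding triv_cat_def by simp
  obtain a f where a: "a \<in> Obj ?A"
    and iso: "cat_iso ?B (UF a) (mor A, \<lambda>g. cell (m g), \<lambda>g. cell (Inv (m g))) f"
    using equivalence_ess_surj[OF equivalence[OF W] obj] by blast
  obtain Im \<sigma> where aI: "a = (Im, \<sigma>)" by (cases a)
  define I where "I = Arr1 ?W X Im"
  have I_sel [simp]: "src I = ?W" "tgt I = X" and I_mor: "mor I = Im" by (simp_all add: I_def)
  have I [simp]: "wf1 I"
    using a X.equivariantD(1)[OF _ W, of Im \<sigma>] unfolding aI eqv_cat_def I_def by simp
  define \<tau> where "\<tau> g = (\<iota> Um \<star> \<sigma> g) \<cdot> (\<tau>U g \<star> \<iota> Im)" for g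
  define \<epsilon>I where "\<epsilon>I g = (inv2 C (act R g \<odot> Um) (Um \<odot> act S g) (\<tau>U g) \<star> \<iota> Im) \<cdot> (\<iota> Um \<star> \<epsilon> g \<star> \<iota> Im)" for g
  have UFa: "UF a = (mor (U \<box> I), \<tau>, \<epsilon>I)"
    unfolding aI UF_def \<tau>_def \<epsilon>I_def by (simp add: mor_comp cell_U I_mor)
  have \<epsilon>I: "Arr2 (U \<box> I) (V.rho g \<box> U \<box> I) (\<epsilon>I g) = Inv (u g) \<lhd> I" if "g \<in> carrier G" for g
  proof -
    obtain t e where "UF (lift_obj I) = (mor (U \<box> I), t, e)"
      "\<And>g. g \<in> carrier G \<Longrightarrow> e g = cell (Inv (u g) \<lhd> I)"
      using UF_lift[OF I I_sel(2)] by blast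
    then have "\<epsilon>I g = cell (Inv (u g) \<lhd> I)"
      using that unfolding UF_def lift_obj_def \<epsilon>I_def I_mor by auto
    then show ?thesis using that by simp
  qed
  obtain f' where f: "f \<in> Arr ?B (UF a) (mor A, \<lambda>g. cell (m g), \<lambda>g. cell (Inv (m g)))"
    and f': "f' \<in> Arr ?B (mor A, \<lambda>g. cell (m g), \<lambda>g. cell (Inv (m g))) (UF a)"
    and inv: "f' \<cdot> f = \<iota> (mor (U \<box> I))" "f \<cdot> f' = \<iota> (mor A)"
    using iso unfolding cat_iso_def UFa by (auto simp: triv_cat_def)
  let ?\<kappa> = "Arr2 (U \<box> I) A f" and ?\<kappa>' = "Arr2 A (U \<box> I) f'"
  have wf: "wf2 ?\<kappa>" and comm: "\<And>g. g \<in> carrier G \<Longrightarrow> Inv (m g) \<bullet> ?\<kappa> = (V.rho g \<rhd> ?\<kappa>) \<bullet> (Inv (u g) \<lhd> I)"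
    using f V.triv_arr_iff[of "U \<box> I" ?W A f] \<epsilon>I unfolding UFa by auto
  have wf': "wf2 ?\<kappa>'"
    using f' V.triv_arr_iff[of A ?W "U \<box> I" f'] unfolding UFa by auto
  have iso: "isoc ?\<kappa>"
    by (rule InvI[of _ ?\<kappa>']) (use wf wf' inv in \<open>auto intro!: arr2_eqI simp: cell_comp\<close>)
  have "?\<kappa> \<bullet> (u g \<lhd> I) = m g \<bullet> (V.rho g \<rhd> ?\<kappa>)" if g: "g \<in> carrier G" for g
  proof -
    have "?\<kappa> \<bullet> (u g \<lhd> I) = m g \<bullet> (Inv (m g) \<bullet> ?\<kappa>) \<bullet> (u g \<lhd> I)" using g wf by simp
    then show ?thesis unfolding comm[OF g] using g wf by simp
  qed
  then show thesis using that[of I ?\<kappa>] iso by simp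
qed

end

section \<open>Induction and the expansion of central elements\<close>

text \<open>
  \<open>I\<close> plays the part of the induction functor from the trivial subgroup, with \<open>U I = \<Oplus>\<^sub>h \<rho>(h)\<close>; the \<open>J h\<close> and
  \<open>\<pi> h\<close> are the injections and projections of this direct sum, and the action \<open>u I\<close> translates its summands.
\<close>

locale induced = fixed_object C G V R X S \<epsilon> Um \<tau>U
  for C :: "('k::field, 'o, 'm, 'c::ab_group_add) lin2cat" (structure)
    and G :: "('g, 'z) monoid_scheme" and V R X S \<epsilon> Um \<tau>U +
  fixes I :: "('o, 'm) arr1" and J \<pi> :: "'g \<Rightarrow> ('o, 'm, 'c) arr2"
  assumes I [simp]: "wf1 I" "src I = V" "tgt I = X"
    and IU: "is_biproduct (carrier G) V.rho (U \<box> I) J \<pi>"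
    and u_J: "\<And>g h. g \<in> carrier G \<Longrightarrow> h \<in> carrier G \<Longrightarrow>
      (u g \<lhd> I) \<bullet> (V.rho g \<rhd> J h) = J (g \<otimes>\<^bsub>G\<^esub> h) \<bullet> V.Phi g h"

lemma (in fixed_object) exists_induced:
  assumes fin: "finite (carrier G)"
  obtains I J \<pi> where "induced C G V R X S \<epsilon> Um \<tau>U I J \<pi>"
proof -
  let ?K = "carrier G"
  obtain A j p m where bp: "is_biproduct ?K V.rho A j p" and A: "src A = V" and act: "V.action A m"
    and m_j: "\<And>g h. g \<in> ?K \<Longrightarrow> h \<in> ?K \<Longrightarrow> m g \<bullet> (V.rho g \<rhd> j h) = j (g \<otimes>\<^bsub>G\<^esub> h) \<bullet> V.Phi g h"
    using V.regular_action[OF fin] by blast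
  obtain I \<kappa> where I: "wf1 I" "src I = V" "tgt I = X" and \<kappa>: "isoc \<kappa>" "dm \<kappa> = U \<box> I" "cd \<kappa> = A"
    and eqv: "\<And>g. g \<in> ?K \<Longrightarrow> \<kappa> \<bullet> (u g \<lhd> I) = m g \<bullet> (V.rho g \<rhd> \<kappa>)"
    using action_realized[OF act] A by metis
  note [simp] = I \<kappa> V.actionD(1-5)[OF act]
  have j [simp]: "wf2 (j h)" "dm (j h) = V.rho h" "cd (j h) = A" if "h \<in> ?K" for h
    using hom2D[OF is_biproductD(3)[OF bp that]] .
  have "(u g \<lhd> I) \<bullet> (V.rho g \<rhd> (Inv \<kappa> \<bullet> j h)) = (Inv \<kappa> \<bullet> j (g \<otimes>\<^bsub>G\<^esub> h)) \<bullet> V.Phi g h"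
    if [simp]: "g \<in> ?K" "h \<in> ?K" for g h
  proof -
    have "(u g \<lhd> I) \<bullet> (V.rho g \<rhd> (Inv \<kappa> \<bullet> j h))
        = Inv \<kappa> \<bullet> (\<kappa> \<bullet> (u g \<lhd> I)) \<bullet> (V.rho g \<rhd> Inv \<kappa>) \<bullet> (V.rho g \<rhd> j h)"
      using A by simp
    also have "\<dots> = Inv \<kappa> \<bullet> m g \<bullet> (V.rho g \<rhd> j h)" unfolding eqv[OF that(1)] using A by simp
    also have "\<dots> = Inv \<kappa> \<bullet> j (g \<otimes>\<^bsub>G\<^esub> h) \<bullet> V.Phi g h" unfolding m_j[OF that] ..
    finally show ?thesis by simp
  qed
  then have "induced C G V R X S \<epsilon> Um \<tau>U I (\<lambda>h. Inv \<kappa> \<bullet> j h) (\<lambda>h. p h \<bullet> \<kappa>)"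
    by unfold_locales (use biproduct_iso[OF bp \<kappa>(1,3)] in simp_all)
  then show thesis by (rule that)
qed

context induced
begin

lemma fin: "finite (carrier G)"
  using is_biproductD(1)[OF IU] .

lemma J_sel [simp]:
  assumes "g \<in> carrier G"
  shows "wf2 (J g)" "dm (J g) = V.rho g" "cd (J g) = U \<box> I"
    "wf2 (\<pi> g)" "dm (\<pi> g) = U \<box> I" "cd (\<pi> g) = V.rho g"
  using hom2D[OF is_biproductD(3)[OF IU assms]] hom2D[OF is_biproductD(4)[OF IU assms]] by auto

definition unit :: "('o, 'm, 'c) arr2" where
  "unit = J \<one>\<^bsub>G\<^esub> \<bullet> Inv V.phi1"

lemma unit_sel [simp]: "wf2 unit" "dm unit = id1 V" "cd unit = U \<box> I"
  by (simp_all add: unit_def)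

text \<open>
  The map \<open>\<Lambda>\<^sub>g(\<xi>) I\<close>, restricted along the unit, is \<open>\<xi>\<close> into the summand \<open>\<rho>(g)\<close>: by exchange \<open>\<xi>\<close> comes first, and
  \<open>u\<^sub>g I\<close> translates the summand at 1 to the summand at \<open>g\<close>.
\<close>

lemma u_unit:
  assumes [simp]: "g \<in> carrier G" and \<xi>: "\<xi> \<in> hom2 (id1 V) (V.rho g)"
  shows "(u g \<lhd> I) \<bullet> (\<xi> \<lhd> U \<lhd> I) \<bullet> unit = J g \<bullet> \<xi>"
proof -
  note [simp] = hom2D[OF \<xi>]
  have "(\<xi> \<lhd> U \<lhd> I) \<bullet> unit = (V.rho g \<rhd> unit) \<bullet> \<xi>"
    using exchange[of unit \<xi>] by simp
  then have "(u g \<lhd> I) \<bullet> (\<xi> \<lhd> U \<lhd> I) \<bullet> unit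
      = ((u g \<lhd> I) \<bullet> (V.rho g \<rhd> J \<one>\<^bsub>G\<^esub>)) \<bullet> (V.rho g \<rhd> Inv V.phi1) \<bullet> \<xi>"
    by (simp add: unit_def)
  also have "\<dots> = J g \<bullet> \<xi>" unfolding u_J[OF assms(1) one_closed] by (simp add: V.Phi_unit)
  finally show ?thesis .
qed

text \<open>
  The \<open>u\<^sub>h : \<rho>(h) U \<Rightarrow> U\<close> form a 2-cell \<open>U I U \<Rightarrow> U\<close>. Its compatibility with \<open>u\<close> is, on the summand \<open>\<rho>(h)\<close>, the
  cocycle condition of \<open>u\<close>, and hence it can be lifted along \<open>U\<close>.
\<close>

lemma counit:
  obtains q where "q \<in> hom2 (I \<box> U) (id1 X)" "\<And>g. g \<in> carrier G \<Longrightarrow> (U \<rhd> q) \<bullet> (J g \<lhd> U) = u g"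
proof -
  let ?K = "carrier G"
  have bp: "is_biproduct ?K (\<lambda>h. V.rho h \<box> U) ((U \<box> I) \<box> U) (\<lambda>h. J h \<lhd> U) (\<lambda>h. \<pi> h \<lhd> U)"
    by (rule biproduct_rwhisk[OF IU]) simp_all
  obtain Q where Q: "Q \<in> hom2 ((U \<box> I) \<box> U) U" and QJ: "\<And>g. g \<in> ?K \<Longrightarrow> Q \<bullet> (J g \<lhd> U) = u g"
    by (rule biproduct_copair[OF bp, of u U]) (simp_all add: hom2_def parallel_def)
  note [simp] = hom2D[OF Q]
  have equiv: "Q \<bullet> (u g \<lhd> (I \<box> U)) = (u g \<lhd> id1 X) \<bullet> (V.rho g \<rhd> Q)" if [simp]: "g \<in> ?K" for g
  proof (rule biproduct_eqI)
    show "is_biproduct ?K (\<lambda>h. V.rho g \<box> V.rho h \<box> U) (V.rho g \<box> (U \<box> I) \<box> U)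
       (\<lambda>h. V.rho g \<rhd> J h \<lhd> U) (\<lambda>h. V.rho g \<rhd> \<pi> h \<lhd> U)"
      by (rule biproduct_lwhisk[OF bp]) simp_all
    fix h assume [simp]: "h \<in> ?K"
    have "(Q \<bullet> (u g \<lhd> (I \<box> U))) \<bullet> (V.rho g \<rhd> J h \<lhd> U)
        = Q \<bullet> (((u g \<lhd> I) \<bullet> (V.rho g \<rhd> J h)) \<lhd> U)" by simp
    also have "\<dots> = (Q \<bullet> (J (g \<otimes>\<^bsub>G\<^esub> h) \<lhd> U)) \<bullet> (V.Phi g h \<lhd> U)" unfolding u_J[OF that \<open>h \<in> ?K\<close>] by simp
    also have "\<dots> = u g \<bullet> (V.rho g \<rhd> u h)"
      unfolding QJ[OF m_closed[OF that \<open>h \<in> ?K\<close>]] V.actionD(6)[OF u_action that \<open>h \<in> ?K\<close>] ..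
    also have "\<dots> = ((u g \<lhd> id1 X) \<bullet> (V.rho g \<rhd> Q)) \<bullet> (V.rho g \<rhd> J h \<lhd> U)"
      unfolding QJ[OF \<open>h \<in> ?K\<close>, symmetric] by simp
    finally show "(Q \<bullet> (u g \<lhd> (I \<box> U))) \<bullet> (V.rho g \<rhd> J h \<lhd> U)
        = ((u g \<lhd> id1 X) \<bullet> (V.rho g \<rhd> Q)) \<bullet> (V.rho g \<rhd> J h \<lhd> U)" .
  qed (simp_all add: hom2_def)
  obtain q where "wf2 q" "dm q = I \<box> U" "cd q = id1 X" "U \<rhd> q = Q"
    by (rule U_full[of "I \<box> U" "id1 X" Q]) (use equiv in simp_all)
  then show thesis using that[of q] QJ by (simp add: hom2_def)
qed

text \<open>
  By naturality of \<open>\<eta>\<close> at the counit \<open>q\<close>, and since \<open>U q\<close> is split by the unit, \<open>U \<eta>\<close> is determined by \<open>y\<close>, the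
  restriction of \<open>U \<eta> I\<close> along the unit. The sum runs over the components of \<open>y\<close> in \<open>U I = \<Oplus>\<^sub>g \<rho>(g)\<close>.
\<close>

lemma center_expansion:
  assumes \<eta>: "\<eta> \<in> hom2 (id1 X) (id1 X)"
  defines "y \<equiv> (U \<rhd> \<eta> \<lhd> I) \<bullet> unit"
  shows "U \<rhd> \<eta> = sum2 U U (carrier G) (\<lambda>g. u g \<bullet> ((\<pi> g \<bullet> y) \<lhd> U))"
proof -
  let ?K = "carrier G"
  note [simp] = hom2D[OF \<eta>]
  have y [simp]: "wf2 y" "dm y = id1 V" "cd y = U \<box> I" by (simp_all add: y_def)
  obtain q where q: "q \<in> hom2 (I \<box> U) (id1 X)" and qJ: "\<And>g. g \<in> ?K \<Longrightarrow> (U \<rhd> q) \<bullet> (J g \<lhd> U) = u g"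
    using counit by blast
  note [simp] = hom2D[OF q]
  have "(U \<rhd> q) \<bullet> (unit \<lhd> U) = ((U \<rhd> q) \<bullet> (J \<one>\<^bsub>G\<^esub> \<lhd> U)) \<bullet> (Inv V.phi1 \<lhd> U)"
    by (simp add: unit_def)
  also have "\<dots> = id2 U" unfolding qJ[OF one_closed] V.action_unit[OF u_action] by simp
  finally have split: "(U \<rhd> q) \<bullet> (unit \<lhd> U) = id2 U" .
  have nat: "\<eta> \<bullet> q = q \<bullet> (\<eta> \<lhd> I \<lhd> U)" using exchange[of q \<eta>] by simp
  have "U \<rhd> \<eta> = (U \<rhd> \<eta>) \<bullet> (U \<rhd> q) \<bullet> (unit \<lhd> U)" unfolding split by simp
  also have "\<dots> = (U \<rhd> (\<eta> \<bullet> q)) \<bullet> (unit \<lhd> U)" by simp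
  also have "\<dots> = (U \<rhd> q) \<bullet> (y \<lhd> U)" unfolding nat by (simp add: y_def)
  also have "y = sum2 (id1 V) (U \<box> I) ?K (\<lambda>g. J g \<bullet> \<pi> g \<bullet> y)"
    by (rule biproduct_expand[OF IU]) (simp add: hom2_def)
  also have "\<dots> \<lhd> U = sum2 (id1 V \<box> U) ((U \<box> I) \<box> U) ?K (\<lambda>g. (J g \<bullet> \<pi> g \<bullet> y) \<lhd> U)"
    by (rule rwhisk_sum2) (simp_all add: fin hom2_def parallel_def)
  also have "(U \<rhd> q) \<bullet> \<dots> = sum2 (id1 V \<box> U) (cd (U \<rhd> q)) ?K (\<lambda>g. (U \<rhd> q) \<bullet> ((J g \<bullet> \<pi> g \<bullet> y) \<lhd> U))"
    by (rule vert_sum2) (simp_all add: fin hom2_def parallel_def)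
  also have "\<dots> = sum2 U U ?K (\<lambda>g. (U \<rhd> q) \<bullet> ((J g \<bullet> \<pi> g \<bullet> y) \<lhd> U))" by simp
  also have "\<dots> = sum2 U U ?K (\<lambda>g. u g \<bullet> ((\<pi> g \<bullet> y) \<lhd> U))"
  proof (rule sum2_cong)
    fix g assume g [simp]: "g \<in> ?K"
    have "(U \<rhd> q) \<bullet> ((J g \<bullet> \<pi> g \<bullet> y) \<lhd> U) = ((U \<rhd> q) \<bullet> (J g \<lhd> U)) \<bullet> ((\<pi> g \<bullet> y) \<lhd> U)" by simp
    then show "(U \<rhd> q) \<bullet> ((J g \<bullet> \<pi> g \<bullet> y) \<lhd> U) = u g \<bullet> ((\<pi> g \<bullet> y) \<lhd> U)" unfolding qJ[OF g] .
  qed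
  finally show ?thesis .
qed

text \<open>
  By \<open>u_unit\<close> the elements \<open>\<xi> g\<close> can be read off as the components of the restriction of the sum
  along the unit.
\<close>

lemma Tr_sum_direct:
  assumes \<xi>: "\<And>g. g \<in> carrier G \<Longrightarrow> \<xi> g \<in> hom2 (id1 V) (V.rho g)"
    and zero: "sum2 U U (carrier G) (\<lambda>g. u g \<bullet> (\<xi> g \<lhd> U)) = zero2 U U"
    and k: "k \<in> carrier G"
  shows "\<xi> k = zero2 (id1 V) (V.rho k)"
proof -
  let ?K = "carrier G"
  have \<xi>' [simp]: "wf2 (\<xi> g)" "dm (\<xi> g) = id1 V" "cd (\<xi> g) = V.rho g" if "g \<in> ?K" for g
    using hom2D[OF \<xi>[OF that]] .
  note [simp] = k
  have "zero2 (id1 V) (U \<box> I) = (zero2 U U \<lhd> I) \<bullet> unit"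
    by (simp add: zero2_comp parallel_def)
  also have "\<dots> = (sum2 U U ?K (\<lambda>g. u g \<bullet> (\<xi> g \<lhd> U)) \<lhd> I) \<bullet> unit" unfolding zero ..
  also have "sum2 U U ?K (\<lambda>g. u g \<bullet> (\<xi> g \<lhd> U)) \<lhd> I = sum2 (U \<box> I) (U \<box> I) ?K (\<lambda>g. (u g \<bullet> (\<xi> g \<lhd> U)) \<lhd> I)"
    by (rule rwhisk_sum2) (simp_all add: fin hom2_def parallel_def)
  also have "\<dots> \<bullet> unit = sum2 (dm unit) (U \<box> I) ?K (\<lambda>g. ((u g \<bullet> (\<xi> g \<lhd> U)) \<lhd> I) \<bullet> unit)"
    by (rule sum2_vert) (simp_all add: fin hom2_def parallel_def)
  also have "\<dots> = sum2 (id1 V) (U \<box> I) ?K (\<lambda>g. J g \<bullet> \<xi> g)"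
    unfolding unit_sel by (rule sum2_cong) (simp add: u_unit \<xi>)
  finally have "\<pi> k \<bullet> zero2 (id1 V) (U \<box> I) = \<pi> k \<bullet> sum2 (id1 V) (U \<box> I) ?K (\<lambda>g. J g \<bullet> \<xi> g)" by simp
  also have "\<dots> = sum2 (id1 V) (cd (\<pi> k)) ?K (\<lambda>g. \<pi> k \<bullet> J g \<bullet> \<xi> g)"
    by (rule vert_sum2) (simp_all add: fin hom2_def parallel_def)
  also have "\<dots> = sum2 (id1 V) (V.rho k) ?K (\<lambda>g. if g = k then \<xi> k else zero2 (id1 V) (V.rho k))"
    unfolding J_sel[OF k]
  proof (rule sum2_cong)
    fix g assume g [simp]: "g \<in> ?K"
    have "\<pi> k \<bullet> J g \<bullet> \<xi> g = (\<pi> k \<bullet> J g) \<bullet> \<xi> g" by simp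
    also have "\<dots> = (if g = k then \<xi> k else zero2 (id1 V) (V.rho k))"
      unfolding is_biproductD(5)[OF IU g k] by (simp add: zero2_comp parallel_def)
    finally show "\<pi> k \<bullet> J g \<bullet> \<xi> g = (if g = k then \<xi> k else zero2 (id1 V) (V.rho k))" .
  qed
  also have "\<dots> = \<xi> k" by (rule sum2_delta[OF fin k \<xi>[OF k]])
  finally show ?thesis by (simp add: zero2_comp parallel_def)
qed

section \<open>The dimension of the fixed object\<close>

text \<open>
  This is \<open>\<Lambda>\<^sub>g : \<T>r(\<rho>(g)) \<rightarrow> End(U)\<close> as a map on bare 2-cells, and \<open>Ad\<close> is conjugation by \<open>u\<close> on \<open>End(U)\<close>.
\<close>

definition Lam :: "'g \<Rightarrow> 'c \<Rightarrow> 'c" where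
  "Lam g x = cell (u g \<bullet> (Arr2 (id1 V) (V.rho g) x \<lhd> U))"

definition Ad :: "'g \<Rightarrow> 'c \<Rightarrow> 'c" where
  "Ad s x = cell (V.conj_act u s (Arr2 U U x))"

lemma Tr_hom2: "g \<in> carrier G \<Longrightarrow> x \<in> Tr C V (act R g) \<longleftrightarrow> Arr2 (id1 V) (V.rho g) x \<in> hom2 (id1 V) (V.rho g)"
  using Arr2_hom2[of "id1 V" "V.rho g" x] by (simp add: Tr_def mor_comp V.rep_cell parallel_def)

lemma End_hom2: "x \<in> Cell C Um Um \<longleftrightarrow> Arr2 U U x \<in> hom2 U U"
  using Arr2_hom2[of U U x] by (simp add: cell_U parallel_def)

lemma lin_Lam:
  assumes [simp]: "g \<in> carrier G"
  shows "lin_on (smul C) (Tr C V (act R g)) (Lam g)"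
proof -
  have par: "parallel (id1 V) (V.rho g)" "parallel U (V.rho g \<box> U)" by (simp_all add: parallel_def)
  have w: "lin_on (smul C) (Tr C V (act R g)) (\<lambda>x. x \<star> \<iota> Um)"
    using lin_rwhisk[OF wf_U par(1)] by (simp add: Tr_def mor_comp V.rep_cell cell_U)
  have "x \<star> \<iota> Um \<in> Cell C (mor U) (mor (V.rho g \<box> U))" if "x \<in> Tr C V (act R g)" for x
  proof -
    have "Arr2 (id1 V) (V.rho g) x \<lhd> U \<in> hom2 U (V.rho g \<box> U)"
      using that hom2D[of "Arr2 (id1 V) (V.rho g) x" "id1 V" "V.rho g"] by (simp add: Tr_hom2 hom2_def)
    from cell_hom2[OF this] show ?thesis by (simp add: cell_comp cell_U)
  qed
  then have "lin_on (smul C) (Tr C V (act R g)) (\<lambda>x. cell (u g) \<cdot> (x \<star> \<iota> Um))"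
    using lin_on_compose[OF w _ lin_vert_left[of "u g" U]] par(2) by (simp add: image_subset_iff)
  then show ?thesis unfolding Lam_def by (simp add: cell_comp cell_U)
qed

lemma lin_Ad:
  assumes [simp]: "s \<in> carrier G"
  shows "lin_on (smul C) (Cell C Um Um) (Ad s)"
proof -
  let ?sU = "V.rho s \<box> U"
  have par: "parallel U U" "parallel ?sU ?sU" "parallel U ?sU" by (simp_all add: parallel_def)
  have 1: "lin_on (smul C) (Cell C Um Um) (\<lambda>x. \<iota> (act R s) \<star> x)"
    using lin_lwhisk[of "V.rho s" U U] par by (simp add: V.rep_cell cell_U)
  have 2: "\<iota> (act R s) \<star> x \<in> Cell C (mor ?sU) (mor ?sU)" if "x \<in> Cell C Um Um" for x
  proof -
    have "V.rho s \<rhd> Arr2 U U x \<in> hom2 ?sU ?sU"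
      using that hom2D[of "Arr2 U U x" U U] by (simp add: End_hom2 hom2_def)
    from cell_hom2[OF this] show ?thesis by (simp add: cell_comp V.rep_cell)
  qed
  have 3: "lin_on (smul C) (Cell C Um Um) (\<lambda>x. (\<iota> (act R s) \<star> x) \<cdot> cell (Inv (u s)))"
    using lin_on_compose[OF 1 _ lin_vert_right[of "Inv (u s)" ?sU]] 2 par by (simp add: image_subset_iff)
  have 4: "(\<iota> (act R s) \<star> x) \<cdot> cell (Inv (u s)) \<in> Cell C (mor U) (mor ?sU)" if "x \<in> Cell C Um Um" for x
  proof -
    have "(V.rho s \<rhd> Arr2 U U x) \<bullet> Inv (u s) \<in> hom2 U ?sU"
      using that hom2D[of "Arr2 U U x" U U] by (simp add: End_hom2 hom2_def)
    from cell_hom2[OF this] show ?thesis by (simp add: cell_comp V.rep_cell)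
  qed
  have "lin_on (smul C) (Cell C Um Um) (\<lambda>x. cell (u s) \<cdot> ((\<iota> (act R s) \<star> x) \<cdot> cell (Inv (u s))))"
    using lin_on_compose[OF 3 _ lin_vert_left[of "u s" U]] 4 par by (simp add: image_subset_iff)
  then show ?thesis unfolding Ad_def V.conj_act_def by (simp add: cell_comp V.rep_cell)
qed

text \<open>
  By the exchange law \<open>U x\<close> commutes with \<open>u\<close> for every \<open>x : id\<^sub>X \<Rightarrow> id\<^sub>X\<close>; the converse is \<open>U_full\<close> for the
  identity of \<open>X\<close>.
\<close>

lemma Dim_iso_invariants:
  defines "E \<equiv> {x \<in> Cell C Um Um. \<forall>s\<in>carrier G. Ad s x = x}"
  shows "subspace (Dim C X)" "lin_on (smul C) (Dim C X) (\<lambda>x. \<iota> Um \<star> x)"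
    "inj_on (\<lambda>x. \<iota> Um \<star> x) (Dim C X)" "(\<lambda>x. \<iota> Um \<star> x) ` Dim C X = E"
proof -
  let ?i = "id1 X"
  have Dim: "Dim C X = Cell C (mor ?i) (mor ?i)" by (simp add: Dim_def Tr_def mor_comp)
  have par: "parallel ?i ?i" by (simp add: parallel_def)
  have Dim_hom2: "x \<in> Dim C X \<longleftrightarrow> Arr2 ?i ?i x \<in> hom2 ?i ?i" for x
    unfolding Dim using Arr2_hom2[OF par] by simp
  have cell_whisk: "\<iota> Um \<star> x = cell (U \<rhd> Arr2 ?i ?i x)" for x by (simp add: cell_comp cell_U)
  show "subspace (Dim C X)" unfolding Dim by (rule subspace_Cell[OF par])
  show "lin_on (smul C) (Dim C X) (\<lambda>x. \<iota> Um \<star> x)"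
    unfolding Dim using lin_lwhisk[OF wf_U par] by (simp add: cell_U)
  show "inj_on (\<lambda>x. \<iota> Um \<star> x) (Dim C X)"
  proof (rule inj_onI)
    fix x y assume xy: "x \<in> Dim C X" "y \<in> Dim C X" "\<iota> Um \<star> x = \<iota> Um \<star> y"
    then have "wf2 (Arr2 ?i ?i x)" "wf2 (Arr2 ?i ?i y)" unfolding Dim_hom2 using hom2D(1) by blast+
    then have "Arr2 ?i ?i x = Arr2 ?i ?i y"
      by (rule U_faithful) (use xy(3) in \<open>auto intro!: arr2_eqI simp: cell_comp cell_U\<close>)
    then show "x = y" by simp
  qed
  have fixed_iff: "Ad s x = x \<longleftrightarrow> Arr2 U U x \<bullet> u s = u s \<bullet> (V.rho s \<rhd> Arr2 U U x)"
    if x: "x \<in> Cell C Um Um" and s: "s \<in> carrier G" for x s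
  proof -
    have h: "Arr2 U U x \<in> hom2 U U" using x End_hom2 by blast
    have "Ad s x = x \<longleftrightarrow> V.conj_act u s (Arr2 U U x) = Arr2 U U x"
      unfolding Ad_def using hom2D[OF V.conj_act_hom2[OF u_action s h]]
      by (metis arr2.collapse arr2.sel(3))
    then show ?thesis using V.conj_act_fixed_iff[OF u_action s h] by simp
  qed
  show "(\<lambda>x. \<iota> Um \<star> x) ` Dim C X = E"
  proof (intro subset_antisym subsetI)
    fix y assume "y \<in> (\<lambda>x. \<iota> Um \<star> x) ` Dim C X"
    then obtain x where x: "x \<in> Dim C X" "y = cell (U \<rhd> Arr2 ?i ?i x)" using cell_whisk by auto
    let ?x = "Arr2 ?i ?i x"
    note [simp] = hom2D[OF x(1)[unfolded Dim_hom2]]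
    have y: "Arr2 U U y = U \<rhd> ?x" using x(2) by (intro arr2_eqI) simp_all
    have "y \<in> Cell C Um Um" unfolding End_hom2 y by (simp add: hom2_def)
    moreover have "(U \<rhd> ?x) \<bullet> u s = u s \<bullet> (V.rho s \<rhd> U \<rhd> ?x)" if "s \<in> carrier G" for s
      using exchange[of ?x "u s"] that by simp
    ultimately show "y \<in> E" unfolding E_def using fixed_iff y by simp
  next
    fix y assume "y \<in> E"
    then have y: "y \<in> Cell C Um Um" "\<And>s. s \<in> carrier G \<Longrightarrow> Arr2 U U y \<bullet> u s = u s \<bullet> (V.rho s \<rhd> Arr2 U U y)"
      unfolding E_def using fixed_iff by auto
    note [simp] = hom2D[OF y(1)[unfolded End_hom2]]
    obtain \<zeta> where \<zeta>: "wf2 \<zeta>" "dm \<zeta> = ?i" "cd \<zeta> = ?i" "U \<rhd> \<zeta> = Arr2 U U y"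
      by (rule U_full[of ?i ?i "Arr2 U U y"]) (use y(2) in simp_all)
    then have "Arr2 ?i ?i (cell \<zeta>) = \<zeta>" by simp
    moreover from this have "cell \<zeta> \<in> Dim C X" unfolding Dim_hom2 using \<zeta> by (simp add: hom2_def)
    ultimately show "y \<in> (\<lambda>x. \<iota> Um \<star> x) ` Dim C X"
      using \<zeta>(4) cell_whisk[of "cell \<zeta>"] by (intro image_eqI[of _ _ "cell \<zeta>"]) simp_all
  qed
qed

text \<open>
  The invariants of \<open>End(U)\<close> lie in the sum of the images of the \<open>\<Lambda>\<^sub>g\<close> by \<open>center_expansion\<close>, so that
  \<open>dim_invariants\<close> applies to them.
\<close>

lemma dim_Dim:
  assumes char: "of_nat (card (carrier G)) \<noteq> (0::'k)"
    and fd: "\<And>g. g \<in> carrier G \<Longrightarrow> findim (smul C) (Tr C V (act R g))"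
  shows "findim (smul C) (Dim C X)"
    "of_nat (card (carrier G)) * of_nat (dim (Dim C X)) =
      (\<Sum>(g, h) \<in> {(g, h). g \<in> carrier G \<and> h \<in> carrier G \<and> g \<otimes>\<^bsub>G\<^esub> h = h \<otimes>\<^bsub>G\<^esub> g}.
         character2 C G V R g h)"
proof -
  let ?K = "carrier G" and ?N = "Cell C Um Um" and ?S = "\<lambda>g. Tr C V (act R g)"
  let ?E = "{x \<in> ?N. \<forall>s\<in>?K. Ad s x = x}"
  have sub: "subspace (?S g)" if "g \<in> ?K" for g
    using subspace_Cell[of "id1 V" "V.rho g"] that by (simp add: Tr_def mor_comp V.rep_cell parallel_def)
  have N: "subspace ?N"
    using subspace_Cell[of U U] by (simp add: parallel_def cell_U)
  have parUU: "parallel U U" by (simp add: parallel_def)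
  have Lam_hom: "u g \<bullet> (Arr2 (id1 V) (V.rho g) x \<lhd> U) \<in> hom2 U U" if "g \<in> ?K" "x \<in> ?S g" for g x
    using that hom2D[of "Arr2 (id1 V) (V.rho g) x" "id1 V" "V.rho g"] by (simp add: Tr_hom2 hom2_def)
  have Lam_typed: "Arr2 U U (Lam g x) = u g \<bullet> (Arr2 (id1 V) (V.rho g) x \<lhd> U)"
    if "g \<in> ?K" "x \<in> ?S g" for g x
    unfolding Lam_def using hom2D[OF Lam_hom[OF that]] by (intro arr2_eqI) simp_all
  have Lam_N: "Lam g x \<in> ?N" if "g \<in> ?K" "x \<in> ?S g" for g x
    unfolding End_hom2 Lam_typed[OF that] by (rule Lam_hom[OF that])
  have psi: "psi C G V R s g x \<in> ?S (s \<otimes>\<^bsub>G\<^esub> g \<otimes>\<^bsub>G\<^esub> inv\<^bsub>G\<^esub> s) \<and>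
      Ad s (Lam g x) = Lam (s \<otimes>\<^bsub>G\<^esub> g \<otimes>\<^bsub>G\<^esub> inv\<^bsub>G\<^esub> s) (psi C G V R s g x)"
    if sg: "s \<in> ?K" "g \<in> ?K" and x: "x \<in> ?S g" for s g x
  proof -
    let ?c = "s \<otimes>\<^bsub>G\<^esub> g \<otimes>\<^bsub>G\<^esub> inv\<^bsub>G\<^esub> s" and ?\<xi> = "Arr2 (id1 V) (V.rho g) x"
    have \<xi>: "?\<xi> \<in> hom2 (id1 V) (V.rho g)" using x sg Tr_hom2 by blast
    obtain \<psi> where \<psi>: "\<psi> \<in> hom2 (id1 V) (V.rho ?c)" "cell \<psi> = psi C G V R s g (cell ?\<xi>)"
      "V.Phi ?c s \<bullet> (\<psi> \<lhd> V.rho s) = V.Phi s g \<bullet> (V.rho s \<rhd> ?\<xi>)"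
      using V.psi_intertwines[OF sg \<xi>] by blast
    have \<psi>': "Arr2 (id1 V) (V.rho ?c) (psi C G V R s g x) = \<psi>"
      using \<psi>(2) hom2D[OF \<psi>(1)] by (intro arr2_eqI) simp_all
    have "psi C G V R s g x \<in> ?S ?c" using Tr_hom2[of ?c] sg \<psi>' \<psi>(1) by simp
    moreover have "Ad s (Lam g x) = Lam ?c (psi C G V R s g x)"
      unfolding Ad_def Lam_typed[OF sg(2) x] V.conj_act_psi[OF u_action sg \<xi> \<psi>(1,3)]
      unfolding Lam_def \<psi>' ..
    ultimately show ?thesis by blast
  qed
  have Ad_typed: "V.conj_act u s (Arr2 U U x) \<in> hom2 U U" "Arr2 U U (Ad s x) = V.conj_act u s (Arr2 U U x)"
    if "s \<in> ?K" "x \<in> ?N" for s x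
  proof -
    show h: "V.conj_act u s (Arr2 U U x) \<in> hom2 U U"
      using V.conj_act_hom2[OF u_action that(1)] that(2) End_hom2 by blast
    show "Arr2 U U (Ad s x) = V.conj_act u s (Arr2 U U x)"
      unfolding Ad_def using hom2D[OF h] by (intro arr2_eqI) simp_all
  qed
  have Ad_N: "Ad s x \<in> ?N" if "s \<in> ?K" "x \<in> ?N" for s x
    unfolding End_hom2 Ad_typed(2)[OF that] by (rule Ad_typed(1)[OF that])
  have Ad_mult: "Ad s (Ad t x) = Ad (s \<otimes>\<^bsub>G\<^esub> t) x" if "s \<in> ?K" "t \<in> ?K" "x \<in> ?N" for s t x
    using V.conj_act_mult[OF u_action that(1,2)] that(3) End_hom2 Ad_typed(2)[OF that(2,3)]
    unfolding Ad_def by auto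
  have cell_sum: "cell (sum2 U U ?K (\<lambda>g. u g \<bullet> (Arr2 (id1 V) (V.rho g) (\<xi> g) \<lhd> U))) = (\<Sum>g\<in>?K. Lam g (\<xi> g))" for \<xi>
    by (simp add: sum2_def Lam_def)
  have direct: "\<forall>\<xi>. (\<forall>g\<in>?K. \<xi> g \<in> ?S g) \<longrightarrow> (\<Sum>g\<in>?K. Lam g (\<xi> g)) = 0 \<longrightarrow> (\<forall>g\<in>?K. \<xi> g = 0)"
  proof (intro allI impI ballI)
    fix \<xi> k assume \<xi>: "\<forall>g\<in>?K. \<xi> g \<in> ?S g" and zero: "(\<Sum>g\<in>?K. Lam g (\<xi> g)) = 0" and k: "k \<in> ?K"
    let ?\<xi> = "\<lambda>g. Arr2 (id1 V) (V.rho g) (\<xi> g)"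
    have "sum2 U U ?K (\<lambda>g. u g \<bullet> (?\<xi> g \<lhd> U)) = zero2 U U"
      by (intro arr2_eqI) (use cell_sum[of \<xi>] zero in \<open>simp_all add: zero2_def\<close>)
    then have "?\<xi> k = zero2 (id1 V) (V.rho k)"
      using Tr_sum_direct[of ?\<xi> k] \<xi> Tr_hom2 k by blast
    then show "\<xi> k = 0" by (simp add: zero2_def)
  qed
  have E_sum: "\<exists>\<xi>. (\<forall>g\<in>?K. \<xi> g \<in> ?S g) \<and> y = (\<Sum>g\<in>?K. Lam g (\<xi> g))" if "y \<in> ?E" for y
  proof -
    have "y \<in> (\<lambda>x. \<iota> Um \<star> x) ` Dim C X" using that Dim_iso_invariants(4) by blast
    then obtain x where x: "x \<in> Dim C X" "y = \<iota> Um \<star> x" by blast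
    let ?x = "Arr2 (id1 X) (id1 X) x"
    have hx: "?x \<in> hom2 (id1 X) (id1 X)"
      using x(1) Arr2_hom2[of "id1 X" "id1 X" x] by (simp add: Dim_def Tr_def mor_comp parallel_def)
    note [simp] = hom2D[OF hx]
    \<comment> \<open>the components of \<open>x I\<close> along the unit\<close>
    let ?z = "\<lambda>g. \<pi> g \<bullet> (U \<rhd> ?x \<lhd> I) \<bullet> unit"
    have z: "?z g \<in> hom2 (id1 V) (V.rho g)" if "g \<in> ?K" for g using that by (simp add: hom2_def)
    have z': "Arr2 (id1 V) (V.rho g) (cell (?z g)) = ?z g" if "g \<in> ?K" for g
      using hom2D[OF z[OF that]] by (intro arr2_eqI) simp_all
    have "y = cell (U \<rhd> ?x)" using x(2) by (simp add: cell_comp cell_U)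
    also have "\<dots> = cell (sum2 U U ?K (\<lambda>g. u g \<bullet> (?z g \<lhd> U)))"
      unfolding center_expansion[OF hx] ..
    also have "\<dots> = (\<Sum>g\<in>?K. Lam g (cell (?z g)))"
      unfolding sum2_def Lam_def by (simp add: z')
    finally have "y = (\<Sum>g\<in>?K. Lam g (cell (?z g)))" .
    moreover have "\<forall>g\<in>?K. cell (?z g) \<in> ?S g" using Tr_hom2 z z' by simp
    ultimately show ?thesis by (intro exI[of _ "\<lambda>g. cell (?z g)"] conjI)
  qed
  note dim = dim_invariants[where G = G and S = ?S and \<psi> = "psi C G V R" and L = Lam and N = ?N and Ad = Ad,
      OF is_group fin char sub fd conjunct1[OF psi] lin_Lam direct N Lam_N lin_Ad Ad_N Ad_mult
        conjunct2[OF psi] E_sum]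
  have "findim (smul C) ?E" by (rule dim(1))
  note D = dim_eq_of_bij[OF Dim_iso_invariants this]
  show "findim (smul C) (Dim C X)" by (rule D(1))
  show "of_nat (card ?K) * of_nat (dim (Dim C X)) =
      (\<Sum>(g, h) \<in> {(g, h). g \<in> ?K \<and> h \<in> ?K \<and> g \<otimes>\<^bsub>G\<^esub> h = h \<otimes>\<^bsub>G\<^esub> g}. character2 C G V R g h)"
    unfolding D(2) character2_def by (rule dim(2))
qed

end

theorem corollary5p18:
  fixes C :: "('k::alg_closed_field, 'o, 'm, 'c::ab_group_add) lin2cat"
    and G :: "('g, 'z) monoid_scheme"
    and V X :: 'o
    and R S :: "('g, 'm, 'c) rep2"
    and U :: 'm
    and \<epsilon> \<tau>U :: "'g \<Rightarrow> 'c"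
  assumes "linear_2category C"
    and "group G" and "finite (carrier G)"
    and "of_nat (card (carrier G)) \<noteq> (0::'k)"
    and "is_rep2 C G V R"
    and "\<And>g. g \<in> carrier G \<Longrightarrow> findim (smul C) (Tr C V (act R g))"
    and "is_fixed_object C G V R X S \<epsilon> U \<tau>U"
  shows "findim (smul C) (Dim C X) \<and>
    of_nat (vector_space.dim (smul C) (Dim C X)) =
      1 / of_nat (card (carrier G)) *
      (\<Sum>(g, h) \<in> {(g, h). g \<in> carrier G \<and> h \<in> carrier G \<and> g \<otimes>\<^bsub>G\<^esub> h = h \<otimes>\<^bsub>G\<^esub> g}.
         character2 C G V R g h)"
proof -
  interpret linear_2category C by fact
  interpret group G by fact
  have "is_rep2 C G X S" using assms(7) unfolding is_fixed_object_def by blast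
  then interpret fixed_object C G V R X S \<epsilon> U \<tau>U
    using assms(5,7) by unfold_locales
  obtain I J \<pi> where "induced C G V R X S \<epsilon> U \<tau>U I J \<pi>" using exists_induced[OF assms(3)] .
  then interpret induced C G V R X S \<epsilon> U \<tau>U I J \<pi> .
  from dim_Dim[OF assms(4,6)] show ?thesis using assms(4) by (simp add: field_simps)
qed

end
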